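(* Under the isomorphism $\Phi:\Pi\to\Lambda$ the following hold. 1) For every $k\ge0$, the principal tableau $\tau_k$ corresponds to the Schur function of the square diagram: $\Phi(\tau_k)=\mathrm{const}\cdot s_{(k^k)}$ (with a constant depending on $k$). 2) For every $k\ge0$, $\Phi(\Pi^{(2k)})=\Lambda_{k\times k}$, where $\Lambda_{k\times k}\subset\Lambda$ is the subspace spanned by the Schur functions indexed by the Young diagrams lying in the $k\times k$ square. Under the identification of $\Pi^{(2k)}$ with $F_{2k}[0]\subset\Lambda$, the correspondence between the Schur function basis in $\Lambda_{k\times k}$ and the basis $\{e_0^{i_0}e_{-1}^{i_1}\cdots e_{-k}^{i_k}\Omega_{-2k}: i_0+i_1+\dots+i_k=k\}$ of $F_{2k}[0]$ is given by the formula $$s_\nu=(-1)^{k(k-1)/2}\sum_{\mu=(0^{r_0}1^{r_1}2^{r_2}\cdots)\subset(k^k)}\frac{K_{\nu\mu}}{\prod_{j=0}^kr_j!}\,e_{-(k-\mu_1)}\cdots e_{-(k-\mu_k)}\Omega_{-2k},\qquad \nu\subset(k^k),$$ where $K_{\nu\mu}$ are the Kostka numbers, the sum is over partitions $\mu=(\mu_1\ge\dots\ge\mu_k\ge0)$ with $\mu_1\le k$, and $r_j$ is the number of indices $i\in\{1,\dots,k\}$ with $\mu_i=j$.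
   Context: All spaces are over $\mathbb C$; $N=2n$ is even. $M_d$ is the $d$-dimensional irreducible $\mathfrak{sl}_2$-module with a fixed inner product for which it is unitary ($e^*=f$, $h^*=h$). The basic module. Let $\Lambda$ be the algebra of symmetric functions over $\mathbb C$, with power sums $p_j$, Schur functions $s_\lambda$, and $(k^k)$ the $k\times k$ square diagram. The basic representation $L_{0,1}$ of $\widehat{\mathfrak{sl}}_2$ is realized in $\mathcal H_0=\Lambda\otimes\mathbb C[q,q^{-1}]$ as follows. Put $\Omega_{2m}=1\otimes q^m$ ($m\in\mathbb Z$), let $h\otimes t^0=h_0$ act on $\Lambda\otimes q^m$ as $2m$, and for $j>0$ let $h\otimes t^j$ act as multiplication by $p_j$ and $h\otimes t^{-j}$ as $2j\,\partial/\partial p_j$. Let $V$ be the operator $g\otimes q^m\mapsto g\otimes q^{m-1}$, and $$\Gamma_-(z)=\exp\Big(\sum_{j\ge1}\tfrac{z^{-j}}{j}p_j\Big),\qquad \Gamma_+(z)=\exp\Big(-2\sum_{j\ge1}z^{j}\tfrac{\partial}{\partial p_j}\Big).$$ The operators $e_m=e\otimes t^m$, $f_m=f\otimes t^m$ are given by $$\sum_{m\in\mathbb Z}e_mz^{-m-1}=\Gamma_-(z)\Gamma_+(z)z^{-h_0}V^{-1},\qquad \sum_{m\in\mathbb Z}f_mz^{-m-1}=\Gamma_-(z)^{-1}\Gamma_+(z)^{-1}z^{h_0}V .$$ The inner product is $\langle p_\lambda q^a,p_\mu q^b\rangle=\delta_{ab}\delta_{\lambda\mu}z_\lambda2^{l(\lambda)}$,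 where $z_\lambda=\prod_ii^{m_i}m_i!$ ($m_i$ = number of parts equal to $i$) and $l(\lambda)$ is the number of parts; then $(e_m)^*=f_{-m}$. The grading of $\mathcal H_0$ has $\Omega_0$ in degree 0 and $x\otimes t^m$ of degree $m$. The charge-0 subspace $\mathcal H[0]=\{v\in\mathcal H_0:h_0v=0\}=\Lambda\otimes q^0$ is identified with $\Lambda$. Put $F_{2n}=\mathbb C[e_0,e_{-1},\dots,e_{-(2n-1)}]\Omega_{-2n}\subset\mathcal H_0$ and $F_{2n}[0]=F_{2n}\cap\mathcal H[0]$. It is known that $F_{2n}$ is an $\mathfrak{sl}_2\otimes\mathbb C[t^{-1}]$-submodule, isomorphic to the fusion product $V_{2n}^*$ of $2n$ copies of $\mathbb C^2$; that $F_{2n}\subset F_{2n+2}$ (as $e_{-(2n+1)}\Omega_{-(2n+2)}=\Omega_{-2n}$); that $\bigcup_nF_{2n}=\mathcal H_0$; and that, for every $k\ge0$, the set of vectors $\{e_0^{i_0}e_{-1}^{i_1}\cdots e_{-k}^{i_k}\Omega_{-2k}: i_0,\dots,i_k\ge0,\ i_0+i_1+\dots+i_k=k\}$ is a basis of $F_{2k}[0]$. The degree $\widetilde{\deg}$ on $F_{2n}$ is $\deg-n^2$ (so $\Omega_{-2n}$ has $\widetilde{\deg}=0$). Tableaux. For a standard Young tableau $\tau$ with $N$ cells, $\operatorname{maj}(\tau)$ is the sum of all $i\le N-1$ such that $i+1$ lies in a lower row of $\tau$ than $i$. $\mathcal X_N=\bigoplus_{k=0}^nM_{2k+1}\otimes\pi_k$,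 where $\pi_k$ has orthonormal basis the standard Young tableaux of shape $(n+k,n-k)$; $i_N:\mathcal X_N\to\mathcal X_{N+2}$ sends $x\otimes\tau$ to $x\otimes\tau'$, $\tau'$ being $\tau$ with $N+1$ added to the first row and $N+2$ to the second row. Then $\mathcal X=\varinjlim(\mathcal X_N,i_N)=\bigoplus_{k\ge0}M_{2k+1}\otimes\Pi_k$, where $\Pi_k$ has orthonormal basis $\mathcal T_k$, the set of infinite two-row standard Young tableaux tail-equivalent to $\tau_k$ (differing from it in the row of only finitely many entries, with initial parts of length $2n$ of shape $(n+k,n-k)$ for large $n$). The principal tableau $\tau_k$ has first row $1,\dots,2k,2k+1,2k+3,\dots$ and second row $2k+2,2k+4,\dots$. $\Pi=\bigoplus_{k\ge0}\Pi_k$. $T^{(N)}$ is the finite set of infinite two-row tableaux that coincide with some $\tau_m$, $m\ge0$, from the $N$th level on (i.e. obtained from a standard tableau with $N$ cells and at most two rows by adding $N+1,N+3,\dots$ to the first row and $N+2,N+4,\dots$ to the second row), and $\Pi^{(N)}\subset\Pi$ is its span. The isomorphism $\Phi$. Fix unitary $\mathfrak{sl}_2$-isomorphisms $\rho_N:F_N\to\mathcal X_N$ sending elements with $\widetilde{\deg}=-i$ into the span of the $x\otimes\tau$ with $\operatorname{maj}(\tau)=i$, such that $\rho_{N+2}|_{F_N}=i_N\circ\rho_N$ for all even $N\geq 0$ (such families exist), and let $\rho:\mathcal H_0\to\mathcal X$ be the limit isomorphism. Let $\omega_{-2k}$ be the lowest weight vector of $M_{2k+1}$ and $c_k=\|e_0^k\omega_{-2k}\|^{-1}$.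 Then $\Phi:\Pi\to\mathcal H[0]=\Lambda$ is the linear isomorphism with $\Phi(\tau)=\rho^{-1}(c_k\,e_0^k\omega_{-2k}\otimes\tau)$ for $\tau\in\mathcal T_k$; it maps $\Pi^{(2k)}$ onto $F_{2k}[0]$, which is the identification referred to in the claim. *)

theory Defs
  imports
    Complex_Main
    "HOL-Library.Poly_Mapping"
    "HOL-Library.Groups_Big_Fun"
    "HOL-Computational_Algebra.Polynomial"
    "Jordan_Normal_Form.Determinant"
begin

text \<open>\<open>symf\<close> is \<open>\<Lambda> = \<complex>[p\<^sub>1, p\<^sub>2, \<dots>]\<close>.  Variable number \<open>i\<close> of the polynomial ring
  stands for \<open>p\<^bsub>i+1\<^esub>\<close>, so an exponent function \<open>\<alpha>\<close> is the partition with \<open>\<alpha> i\<close> parts equal to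
  \<open>i + 1\<close>.  \<open>fock\<close> is \<open>\<H>\<^sub>0 = \<Lambda> \<otimes> \<complex>[q, q\<^sup>-\<^sup>1]\<close>, indexed by the exponent of \<open>q\<close>.\<close>

type_synonym symf = "(nat \<Rightarrow>\<^sub>0 nat) \<Rightarrow>\<^sub>0 complex"
type_synonym fock = "int \<Rightarrow>\<^sub>0 symf"

definition cmul :: "complex \<Rightarrow> ('a \<Rightarrow>\<^sub>0 complex) \<Rightarrow> ('a \<Rightarrow>\<^sub>0 complex)" where
  "cmul c g = Poly_Mapping.map ((*) c) g"

definition fmul :: "complex \<Rightarrow> fock \<Rightarrow> fock" where
  "fmul c v = Poly_Mapping.map (cmul c) v"

lemma lookup_cmul: "Poly_Mapping.lookup (cmul c g) x = c * Poly_Mapping.lookup g x"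
  by (simp add: cmul_def Poly_Mapping.map.rep_eq when_def)

lemma lookup_fmul: "Poly_Mapping.lookup (fmul c v) a = cmul c (Poly_Mapping.lookup v a)"
  by (auto simp: fmul_def Poly_Mapping.map.rep_eq when_def lookup_cmul intro!: poly_mapping_eqI)

interpretation CV: vector_space "cmul :: complex \<Rightarrow> ('a \<Rightarrow>\<^sub>0 complex) \<Rightarrow> ('a \<Rightarrow>\<^sub>0 complex)"
  by unfold_locales
    (auto simp: lookup_cmul lookup_add algebra_simps intro!: poly_mapping_eqI)

interpretation FV: vector_space fmul
  by unfold_locales
    (auto simp: lookup_fmul lookup_add CV.scale_right_distrib CV.scale_left_distrib
      intro!: poly_mapping_eqI)

definition psum :: "nat \<Rightarrow> symf" where
  "psum j = Poly_Mapping.single (Poly_Mapping.single (j - 1) 1) 1"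

text \<open>The derivation \<open>\<partial>/\<partial>p\<^sub>j\<close>, for \<open>j \<ge> 1\<close>.\<close>

definition dpsum :: "nat \<Rightarrow> symf \<Rightarrow> symf" where
  "dpsum j g = (\<Sum>\<alpha>\<in>Poly_Mapping.keys g.
     Poly_Mapping.single (\<alpha> - Poly_Mapping.single (j - 1) 1)
       (of_nat (Poly_Mapping.lookup \<alpha> (j - 1)) * Poly_Mapping.lookup g \<alpha>))"

text \<open>The coefficient of \<open>z\<^sup>r\<close> in \<open>exp (\<Sum>\<^bsub>j\<ge>1\<^esub> z\<^sup>j A\<^sub>j)\<close>, applied to \<open>g\<close>: in the \<open>l\<close>-th power of
  the exponent, \<open>z\<^sup>r\<close> collects the products \<open>A\<^bsub>j\<^sub>1\<^esub> \<cdots> A\<^bsub>j\<^sub>l\<^esub>\<close> over compositions of \<open>r\<close> into \<open>l\<close>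
  positive parts.\<close>

definition exp_coeff :: "(nat \<Rightarrow> symf \<Rightarrow> symf) \<Rightarrow> nat \<Rightarrow> symf \<Rightarrow> symf" where
  "exp_coeff A r g =
     (\<Sum>js\<in>{js. 0 \<notin> set js \<and> sum_list js = r}. cmul (1 / fact (length js)) (foldr A js g))"

text \<open>\<open>gamma_minus \<epsilon> r\<close> is the coefficient of \<open>z\<^bsup>-r\<^esup>\<close> in \<open>\<Gamma>\<^sub>-(z)\<^sup>\<epsilon>\<close>, and \<open>gamma_plus \<epsilon> s\<close> that of
  \<open>z\<^sup>s\<close> in \<open>\<Gamma>\<^sub>+(z)\<^sup>\<epsilon>\<close>, for \<open>\<epsilon> = \<plusminus>1\<close>; \<open>vertex \<epsilon> d\<close> is the coefficient of \<open>z\<^sup>d\<close> in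
  \<open>\<Gamma>\<^sub>-(z)\<^sup>\<epsilon> \<Gamma>\<^sub>+(z)\<^sup>\<epsilon>\<close>.  On each \<open>g\<close> only finitely many \<open>s\<close> contribute, because
  \<open>\<Gamma>\<^sub>+\<close> lowers the degree.\<close>

definition gamma_minus :: "complex \<Rightarrow> nat \<Rightarrow> symf \<Rightarrow> symf" where
  "gamma_minus \<epsilon> r = exp_coeff (\<lambda>j g. cmul (\<epsilon> / of_nat j) (psum j * g)) r"

definition gamma_plus :: "complex \<Rightarrow> nat \<Rightarrow> symf \<Rightarrow> symf" where
  "gamma_plus \<epsilon> s = exp_coeff (\<lambda>j g. cmul (- 2 * \<epsilon>) (dpsum j g)) s"

definition vertex :: "complex \<Rightarrow> int \<Rightarrow> symf \<Rightarrow> symf" where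
  "vertex \<epsilon> d g = Sum_any (\<lambda>s::nat.
     if d \<le> int s then gamma_minus \<epsilon> (nat (int s - d)) (gamma_plus \<epsilon> s g) else 0)"

text \<open>On \<open>g \<otimes> q\<^sup>a\<close> the operator \<open>z\<^bsup>-h\<^sub>0\<^esup> V\<^sup>-\<^sup>1\<close> gives \<open>z\<^bsup>-2(a+1)\<^esup> g \<otimes> q\<^bsup>a+1\<^esup>\<close>, and
  \<open>z\<^bsup>h\<^sub>0\<^esup> V\<close> gives \<open>z\<^bsup>2(a-1)\<^esup> g \<otimes> q\<^bsup>a-1\<^esup>\<close>; the coefficient of \<open>z\<^bsup>-m-1\<^esup>\<close> is taken.\<close>

definition e_op :: "int \<Rightarrow> fock \<Rightarrow> fock" where
  "e_op m v = (\<Sum>a\<in>Poly_Mapping.keys v.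
     Poly_Mapping.single (a + 1) (vertex 1 (2 * (a + 1) - m - 1) (Poly_Mapping.lookup v a)))"

definition f_op :: "int \<Rightarrow> fock \<Rightarrow> fock" where
  "f_op m v = (\<Sum>a\<in>Poly_Mapping.keys v.
     Poly_Mapping.single (a - 1) (vertex (- 1) (- 2 * (a - 1) - m - 1) (Poly_Mapping.lookup v a)))"

definition h0_op :: "fock \<Rightarrow> fock" where
  "h0_op v = (\<Sum>a\<in>Poly_Mapping.keys v.
     Poly_Mapping.single a (cmul (2 * of_int a) (Poly_Mapping.lookup v a)))"

text \<open>\<open>vac m\<close> is \<open>\<Omega>\<^bsub>2m\<^esub>\<close>, and \<open>charge0\<close> is the identification of \<open>\<Lambda>\<close> with
  \<open>\<H>[0] = \<Lambda> \<otimes> q\<^sup>0\<close>.\<close>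

definition vac :: "int \<Rightarrow> fock" where
  "vac m = Poly_Mapping.single m 1"

definition charge0 :: "symf \<Rightarrow> fock" where
  "charge0 g = Poly_Mapping.single 0 g"

definition part_size :: "(nat \<Rightarrow>\<^sub>0 nat) \<Rightarrow> nat" where
  "part_size \<alpha> = (\<Sum>i\<in>Poly_Mapping.keys \<alpha>. (i + 1) * Poly_Mapping.lookup \<alpha> i)"

definition part_length :: "(nat \<Rightarrow>\<^sub>0 nat) \<Rightarrow> nat" where
  "part_length \<alpha> = (\<Sum>i\<in>Poly_Mapping.keys \<alpha>. Poly_Mapping.lookup \<alpha> i)"

definition part_z :: "(nat \<Rightarrow>\<^sub>0 nat) \<Rightarrow> nat" where
  "part_z \<alpha> = (\<Prod>i\<in>Poly_Mapping.keys \<alpha>.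
     (i + 1) ^ Poly_Mapping.lookup \<alpha> i * fact (Poly_Mapping.lookup \<alpha> i))"

text \<open>Inner products are linear in the first and antilinear in the second argument.\<close>

definition fock_inner :: "fock \<Rightarrow> fock \<Rightarrow> complex" where
  "fock_inner v w =
     (\<Sum>a\<in>Poly_Mapping.keys v. \<Sum>\<alpha>\<in>Poly_Mapping.keys (Poly_Mapping.lookup v a).
        Poly_Mapping.lookup (Poly_Mapping.lookup v a) \<alpha> *
        cnj (Poly_Mapping.lookup (Poly_Mapping.lookup w a) \<alpha>) *
        of_nat (part_z \<alpha> * 2 ^ part_length \<alpha>))"

text \<open>Since \<open>e\<^sub>m\<close> and \<open>f\<^sub>m\<close> have degree \<open>m\<close>, \<open>e\<^bsub>-(2n+1)\<^esub> \<Omega>\<^bsub>-(2n+2)\<^esub> = \<Omega>\<^bsub>-2n\<^esub>\<close> and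
  \<open>f\<^bsub>-(2n+1)\<^esub> \<Omega>\<^bsub>2n+2\<^esub> = \<Omega>\<^bsub>2n\<^esub>\<close>, the vector \<open>q\<^sup>a\<close> has degree \<open>a\<^sup>2\<close>; multiplication by \<open>p\<^sub>j\<close> adds
  \<open>j\<close>.\<close>

definition homogeneous :: "int \<Rightarrow> fock \<Rightarrow> bool" where
  "homogeneous d v \<longleftrightarrow>
     (\<forall>a\<in>Poly_Mapping.keys v. \<forall>\<alpha>\<in>Poly_Mapping.keys (Poly_Mapping.lookup v a).
        int (part_size \<alpha>) + a\<^sup>2 = d)"

text \<open>\<open>fusion n\<close> is \<open>F\<^bsub>2n\<^esub>\<close>.\<close>

definition fusion :: "nat \<Rightarrow> fock set" where
  "fusion n = FV.span
     {foldr (\<lambda>j. e_op (- int j)) js (vac (- int n)) | js. set js \<subseteq> {..<2 * n}}"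

text \<open>\<open>M\<^sub>d\<close> is modelled by the polynomials in \<open>x\<close> of degree less than \<open>d\<close>, with
  \<open>f = d/dx\<close>, \<open>e = (d-1) x - x\<^sup>2 d/dx\<close> and \<open>h = 2x d/dx - (d-1)\<close>.\<close>

definition irr :: "nat \<Rightarrow> complex poly set" where
  "irr d = {p. degree p < d}"

definition irr_e :: "nat \<Rightarrow> complex poly \<Rightarrow> complex poly" where
  "irr_e d p = [:0, of_nat (d - 1):] * p - [:0, 0, 1:] * pderiv p"

definition irr_f :: "nat \<Rightarrow> complex poly \<Rightarrow> complex poly" where
  "irr_f d p = pderiv p"

definition irr_h :: "nat \<Rightarrow> complex poly \<Rightarrow> complex poly" where
  "irr_h d p = [:0, 2:] * pderiv p - [:of_nat (d - 1):] * p"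

definition unitary_inner :: "nat \<Rightarrow> (complex poly \<Rightarrow> complex poly \<Rightarrow> complex) \<Rightarrow> bool" where
  "unitary_inner d ip \<longleftrightarrow>
     (\<forall>x\<in>irr d. \<forall>y\<in>irr d. \<forall>z\<in>irr d. ip (x + y) z = ip x z + ip y z) \<and>
     (\<forall>c. \<forall>x\<in>irr d. \<forall>y\<in>irr d. ip (smult c x) y = c * ip x y) \<and>
     (\<forall>x\<in>irr d. \<forall>y\<in>irr d. ip y x = cnj (ip x y)) \<and>
     (\<forall>x\<in>irr d. x \<noteq> 0 \<longrightarrow> 0 < Re (ip x x)) \<and>
     (\<forall>x\<in>irr d. \<forall>y\<in>irr d. ip (irr_e d x) y = ip x (irr_f d y)) \<and>
     (\<forall>x\<in>irr d. \<forall>y\<in>irr d. ip (irr_h d x) y = ip x (irr_h d y))"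

definition lowest_weight_vector :: "nat \<Rightarrow> complex poly \<Rightarrow> bool" where
  "lowest_weight_vector d w \<longleftrightarrow>
     w \<in> irr d \<and> w \<noteq> 0 \<and> irr_f d w = 0 \<and> irr_h d w = smult (- of_nat (d - 1)) w"

text \<open>A tableau with at most two rows is recorded by the set \<open>S\<close> of entries of its second row; the
  other entries form the first row, and both rows are listed in increasing order.  The entry
  \<open>b \<in> S\<close> stands in column \<open>card {x \<in> S. x \<le> b}\<close>, and it is larger than the entry above it iff the
  first row has at least that many entries smaller than \<open>b\<close>.\<close>

definition standard :: "nat set \<Rightarrow> bool" where
  "standard S \<longleftrightarrow> 0 \<notin> S \<and>
     (\<forall>b\<in>S. card {x \<in> S. x \<le> b} \<le> card {x. 1 \<le> x \<and> x < b \<and> x \<notin> S})"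

text \<open>The standard tableaux with \<open>N\<close> cells; \<open>S\<close> has shape \<open>(N - card S, card S)\<close>.\<close>

definition tableaux :: "nat \<Rightarrow> nat set set" where
  "tableaux N = {S. S \<subseteq> {1..N} \<and> standard S}"

definition maj :: "nat \<Rightarrow> nat set \<Rightarrow> nat" where
  "maj N S = \<Sum>{i. 1 \<le> i \<and> i + 1 \<le> N \<and> i \<notin> S \<and> i + 1 \<in> S}"

text \<open>\<open>N+1, N+3, \<dots>\<close> go to the first row and \<open>N+2, N+4, \<dots>\<close> to the second.\<close>

definition extend :: "nat \<Rightarrow> nat set \<Rightarrow> nat set" where
  "extend N S = S \<union> {N + 2 + 2 * i | i. True}"

definition principal_tableau :: "nat \<Rightarrow> nat set" where
  "principal_tableau k = {2 * k + 2 + 2 * i | i. True}"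

text \<open>\<open>inf_tableaux k\<close> is \<open>\<T>\<^sub>k\<close>.\<close>

definition inf_tableaux :: "nat \<Rightarrow> nat set set" where
  "inf_tableaux k = {S. standard S \<and>
     finite {i. (i \<in> S) \<noteq> (i \<in> principal_tableau k)} \<and>
     (\<exists>n0. \<forall>n\<ge>n0. card (S \<inter> {1..2 * n}) + k = n)}"

text \<open>\<open>\<Pi>\<close> has basis \<open>\<Union>\<^sub>k \<T>\<^sub>k\<close>, so its elements are finitely supported functions of the tableau;
  \<open>stable_span N\<close> is \<open>\<Pi>\<^bsup>(N)\<^esup>\<close>.\<close>

definition stable_tableaux :: "nat \<Rightarrow> nat set set" where
  "stable_tableaux N = extend N ` tableaux N"

definition stable_span :: "nat \<Rightarrow> (nat set \<Rightarrow>\<^sub>0 complex) set" where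
  "stable_span N = CV.span ((\<lambda>\<tau>. Poly_Mapping.single \<tau> 1) ` stable_tableaux N)"

text \<open>The vector \<open>x \<otimes> \<tau>\<close> is \<open>Poly_Mapping.single \<tau> x\<close>.  A tableau \<open>S\<close> with \<open>2n\<close> cells has shape
  \<open>(n+k, n-k)\<close> for \<open>k = n - card S\<close>, so it carries a copy of \<open>M\<^bsub>2k+1\<^esub>\<close>.\<close>

type_synonym tabvec = "nat set \<Rightarrow>\<^sub>0 complex poly"

definition irr_dim :: "nat \<Rightarrow> nat set \<Rightarrow> nat" where
  "irr_dim n S = 2 * (n - card S) + 1"

definition tspace :: "nat \<Rightarrow> tabvec set" where
  "tspace n = {x. \<forall>S\<in>Poly_Mapping.keys x.
     S \<in> tableaux (2 * n) \<and> Poly_Mapping.lookup x S \<in> irr (irr_dim n S)}"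

definition tmul :: "complex \<Rightarrow> tabvec \<Rightarrow> tabvec" where
  "tmul c x = Poly_Mapping.map (smult c) x"

definition tact :: "(nat \<Rightarrow> complex poly \<Rightarrow> complex poly) \<Rightarrow> nat \<Rightarrow> tabvec \<Rightarrow> tabvec" where
  "tact X n x = (\<Sum>S\<in>Poly_Mapping.keys x.
     Poly_Mapping.single S (X (irr_dim n S) (Poly_Mapping.lookup x S)))"

definition tinner ::
  "(nat \<Rightarrow> complex poly \<Rightarrow> complex poly \<Rightarrow> complex) \<Rightarrow> nat \<Rightarrow> tabvec \<Rightarrow> tabvec \<Rightarrow> complex" where
  "tinner ip n x y = (\<Sum>S\<in>Poly_Mapping.keys x.
     ip (irr_dim n S) (Poly_Mapping.lookup x S) (Poly_Mapping.lookup y S))"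

text \<open>\<open>tstep n\<close> is \<open>i\<^bsub>2n\<^esub> : \<X>\<^bsub>2n\<^esub> \<rightarrow> \<X>\<^bsub>2n+2\<^esub>\<close>, and \<open>tlimit n\<close> is the canonical map from
  \<open>\<X>\<^bsub>2n\<^esub>\<close> to the direct limit \<open>\<X> = \<Oplus>\<^sub>k M\<^bsub>2k+1\<^esub> \<otimes> \<Pi>\<^sub>k\<close>.\<close>

definition tstep :: "nat \<Rightarrow> tabvec \<Rightarrow> tabvec" where
  "tstep n x = (\<Sum>S\<in>Poly_Mapping.keys x.
     Poly_Mapping.single (insert (2 * n + 2) S) (Poly_Mapping.lookup x S))"

definition tlimit :: "nat \<Rightarrow> tabvec \<Rightarrow> tabvec" where
  "tlimit n x = (\<Sum>S\<in>Poly_Mapping.keys x.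
     Poly_Mapping.single (extend (2 * n) S) (Poly_Mapping.lookup x S))"

text \<open>\<open>rho n\<close> is \<open>\<rho>\<^bsub>2n\<^esub>\<close>; it matters only on \<open>F\<^bsub>2n\<^esub>\<close>.  In \<open>F\<^bsub>2n\<^esub>\<close> the shifted degree is \<open>-i\<close>
  where the degree is \<open>n\<^sup>2 - i\<close>.\<close>

definition rho_family ::
  "(nat \<Rightarrow> complex poly \<Rightarrow> complex poly \<Rightarrow> complex) \<Rightarrow> (nat \<Rightarrow> fock \<Rightarrow> tabvec) \<Rightarrow> bool" where
  "rho_family ip rho \<longleftrightarrow>
     (\<forall>n. bij_betw (rho n) (fusion n) (tspace n)) \<and>
     (\<forall>n. \<forall>v\<in>fusion n. \<forall>w\<in>fusion n. rho n (v + w) = rho n v + rho n w) \<and>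
     (\<forall>n c. \<forall>v\<in>fusion n. rho n (fmul c v) = tmul c (rho n v)) \<and>
     (\<forall>n. \<forall>v\<in>fusion n. \<forall>w\<in>fusion n. tinner ip n (rho n v) (rho n w) = fock_inner v w) \<and>
     (\<forall>n. \<forall>v\<in>fusion n. rho n (e_op 0 v) = tact irr_e n (rho n v)) \<and>
     (\<forall>n. \<forall>v\<in>fusion n. rho n (f_op 0 v) = tact irr_f n (rho n v)) \<and>
     (\<forall>n. \<forall>v\<in>fusion n. rho n (h0_op v) = tact irr_h n (rho n v)) \<and>
     (\<forall>n i. \<forall>v\<in>fusion n. homogeneous (int n ^ 2 - int i) v \<longrightarrow>
        (\<forall>S\<in>Poly_Mapping.keys (rho n v). maj (2 * n) S = i)) \<and>
     (\<forall>n. \<forall>v\<in>fusion n. rho (Suc n) v = tstep n (rho n v))"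

text \<open>The limit \<open>\<rho>\<close>; by the compatibility of the \<open>\<rho>\<^bsub>2n\<^esub>\<close>, any \<open>n\<close> with \<open>v \<in> F\<^bsub>2n\<^esub>\<close> gives the same
  value.\<close>

definition rho_limit :: "(nat \<Rightarrow> fock \<Rightarrow> tabvec) \<Rightarrow> fock \<Rightarrow> tabvec" where
  "rho_limit rho v = (let n = (LEAST n. v \<in> fusion n) in tlimit n (rho n v))"

text \<open>\<open>omega k\<close> is \<open>\<omega>\<^bsub>-2k\<^esub>\<close>, and \<open>zero_weight ip omega k\<close> is \<open>c\<^sub>k e\<^sub>0\<^sup>k \<omega>\<^bsub>-2k\<^esub> \<in> M\<^bsub>2k+1\<^esub>\<close>.\<close>

definition zero_weight ::
  "(nat \<Rightarrow> complex poly \<Rightarrow> complex poly \<Rightarrow> complex) \<Rightarrow> (nat \<Rightarrow> complex poly) \<Rightarrow> nat \<Rightarrow> complex poly"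
  where
  "zero_weight ip omega k =
     (let d = 2 * k + 1; x = (irr_e d ^^ k) (omega k)
      in smult (complex_of_real (1 / sqrt (Re (ip d x x)))) x)"

definition Phi_tableau ::
  "(nat \<Rightarrow> complex poly \<Rightarrow> complex poly \<Rightarrow> complex) \<Rightarrow> (nat \<Rightarrow> complex poly) \<Rightarrow>
   (nat \<Rightarrow> fock \<Rightarrow> tabvec) \<Rightarrow> nat set \<Rightarrow> fock" where
  "Phi_tableau ip omega rho \<tau> =
     (let k = (THE k. \<tau> \<in> inf_tableaux k)
      in inv_into UNIV (rho_limit rho) (Poly_Mapping.single \<tau> (zero_weight ip omega k)))"

definition Phi ::
  "(nat \<Rightarrow> complex poly \<Rightarrow> complex poly \<Rightarrow> complex) \<Rightarrow> (nat \<Rightarrow> complex poly) \<Rightarrow>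
   (nat \<Rightarrow> fock \<Rightarrow> tabvec) \<Rightarrow> (nat set \<Rightarrow>\<^sub>0 complex) \<Rightarrow> fock" where
  "Phi ip omega rho u =
     (\<Sum>\<tau>\<in>Poly_Mapping.keys u. fmul (Poly_Mapping.lookup u \<tau>) (Phi_tableau ip omega rho \<tau>))"

text \<open>Complete symmetric functions, by \<open>\<Sum>\<^sub>r h\<^sub>r z\<^sup>r = exp (\<Sum>\<^bsub>j\<ge>1\<^esub> z\<^sup>j p\<^sub>j / j)\<close>, with \<open>h\<^sub>r = 0\<close> for
  \<open>r < 0\<close>.  Schur functions are given by the Jacobi-Trudi determinant.  Partitions are weakly
  decreasing lists, and trailing zeros change neither the Schur function nor the Kostka numbers.\<close>

definition complete_h :: "int \<Rightarrow> symf" where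
  "complete_h r =
     (if r < 0 then 0
      else exp_coeff (\<lambda>j g. cmul (1 / of_nat j) (psum j * g)) (nat r) 1)"

definition schur :: "nat list \<Rightarrow> symf" where
  "schur l = det (mat (length l) (length l) (\<lambda>(i, j). complete_h (int (l ! i) - int i + int j)))"

definition cells :: "nat list \<Rightarrow> (nat \<times> nat) set" where
  "cells l = {(i, j). i < length l \<and> j < l ! i}"

text \<open>Fillings are functions on all of \<open>\<nat> \<times> \<nat>\<close> that vanish off the diagram.\<close>

definition semistandard :: "nat list \<Rightarrow> (nat \<times> nat \<Rightarrow> nat) set" where
  "semistandard l = {T.
     (\<forall>c. c \<notin> cells l \<longrightarrow> T c = 0) \<and> (\<forall>c\<in>cells l. 1 \<le> T c) \<and>
     (\<forall>i j. (i, j) \<in> cells l \<and> (i, Suc j) \<in> cells l \<longrightarrow> T (i, j) \<le> T (i, Suc j)) \<and>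
     (\<forall>i j. (i, j) \<in> cells l \<and> (Suc i, j) \<in> cells l \<longrightarrow> T (i, j) < T (Suc i, j))}"

definition kostka :: "nat list \<Rightarrow> nat list \<Rightarrow> nat" where
  "kostka l m = card {T \<in> semistandard l.
     \<forall>i\<ge>1. card {c \<in> cells l. T c = i} = (if i \<le> length m then m ! (i - 1) else 0)}"

text \<open>Partitions inside the \<open>k \<times> k\<close> square, padded with zeros to length \<open>k\<close>.\<close>

definition in_square :: "nat \<Rightarrow> nat list set" where
  "in_square k = {l. length l = k \<and> sorted_wrt (\<ge>) l \<and> (\<forall>x\<in>set l. x \<le> k)}"

definition square_span :: "nat \<Rightarrow> symf set" where
  "square_span k = CV.span (schur ` in_square k)"

end

theory Submission
  imports Defs "HOL-Combinatorics.Multiset_Permutations"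
begin

text \<open>
  Write \<open>h\<^sub>r\<close> for \<^const>\<open>complete_h\<close>, so that \<open>\<Gamma>\<^sub>-(z)\<close> is multiplication by \<open>\<Sum>\<^sub>r h\<^sub>r z\<^bsup>-r\<^esup>\<close>.  The operator
  \<open>\<Gamma>\<^sub>+(z)\<close> is a ring homomorphism (the exponential of a derivation) with
  \<open>h\<^sub>r \<mapsto> h\<^sub>r - 2 z h\<^bsub>r-1\<^esub> + z\<^sup>2 h\<^bsub>r-2\<^esub>\<close>.  Hence a word of \<open>k\<close> operators \<open>e\<^bsub>-m\<^esub>\<close> applied to a vacuum is a
  coefficient of \<open>\<Prod>\<^bsub>i<j\<^esub> (x\<^sub>i - x\<^sub>j)\<^sup>2 \<cdot> \<Prod>\<^sub>i \<Sum>\<^sub>r h\<^sub>r x\<^sub>i\<^bsup>-r\<^esup>\<close> (lemma \<open>e_word\<close>).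
  One Vandermonde factor turns the product of the \<open>h\<close> into a Jacobi-Trudi determinant, up to the sign
  \<open>(-1)\<^bsup>k(k-1)/2\<^esup>\<close> of the reversal permutation; the other one symmetrizes.  So the word with exponents
  \<open>\<mu>\<close> is \<open>(-1)\<^bsup>k(k-1)/2\<^esup> \<Sum>\<^sub>p s\<^bsub>\<mu>\<circ>p\<^esub>\<close>, where \<open>s\<^sub>\<beta>\<close> is the Jacobi-Trudi determinant of a composition
  (lemma \<open>word_symf_jtdet\<close>).

  Summing these words over the contents of all semistandard tableaux of shape \<open>\<nu>\<close> means multiplying
  the two Vandermonde factors by the Schur polynomial \<open>s\<^sub>\<nu>(x)\<close>.  By the bialternant formula this
  product with one of the factors is the single alternant with exponents \<open>\<nu>\<^sub>j + k - 1 - j\<close>, and the sum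
  collapses to \<open>k!\<close> times the Schur function \<open>s\<^sub>\<nu>\<close> (lemma \<open>sum_ssyt_word_symf\<close>).  Kostka numbers and
  words are symmetric in the content, so grouping contents by their sorted version gives the
  formula of the theorem (lemma \<open>schur_word_symf\<close>).

  The same formula, for \<open>k \<times> c\<close> rectangles with \<open>k + c = 2n\<close>, puts every Schur function of such a
  rectangle into \<open>F\<^bsub>2n\<^esub>\<close> in charge \<open>k - n\<close>; since Schur functions span \<open>\<Lambda>\<close>, the spaces \<open>F\<^bsub>2n\<^esub>\<close> exhaust
  the Fock space and the limit \<open>\<rho>\<close> is injective on all of it.  Conversely the words expand into
  Jacobi-Trudi determinants that straighten to Schur functions in the square, so the zero-charge part of
  \<open>F\<^bsub>2k\<^esub>\<close> is exactly \<open>\<Lambda>\<^bsub>k\<times>k\<^esub>\<close>.  The map \<open>\<rho>\<^bsub>2k\<^esub>\<close> matches zero charge with zero weight, and the zero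
  weight space of each irreducible module is a line, which gives \<open>\<Phi>(\<Pi>\<^bsup>(2k)\<^esup>) = \<Lambda>\<^bsub>k\<times>k\<^esub>\<close>.
  Finally \<open>maj\<close> vanishes only on the one-row tableau, and in \<open>\<Lambda>\<^bsub>k\<times>k\<^esub>\<close> only the full square has the
  top degree \<open>k\<^sup>2\<close>; comparing gradings identifies \<open>\<Phi>(\<tau>\<^sub>k)\<close> up to a nonzero factor.
\<close>

abbreviation (input) single where "single \<equiv> Poly_Mapping.single"
abbreviation (input) lookup where "lookup \<equiv> Poly_Mapping.lookup"
abbreviation (input) keys where "keys \<equiv> Poly_Mapping.keys"
abbreviation (input) hf where "hf \<equiv> complete_h"

type_synonym 'a mpoly = "(nat \<Rightarrow>\<^sub>0 nat) \<Rightarrow>\<^sub>0 'a"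

section \<open>Alternants and the bialternant formula\<close>

definition alternant :: "nat \<Rightarrow> (nat \<Rightarrow> 'a::comm_ring_1) \<Rightarrow> (nat \<Rightarrow> nat) \<Rightarrow> 'a" where
  "alternant k x \<gamma> = det (mat k k (\<lambda>(i, j). x i ^ \<gamma> j))"

lemma alternant_cong:
  "(\<And>i. i < k \<Longrightarrow> x i = y i) \<Longrightarrow> (\<And>j. j < k \<Longrightarrow> \<gamma> j = \<delta> j) \<Longrightarrow> alternant k x \<gamma> = alternant k y \<delta>"
  unfolding alternant_def by (intro arg_cong[where f = det] cong_mat) auto

lemma alternant_expand:
  "alternant k x \<gamma> = (\<Sum>p | p permutes {..<k}. signof p * (\<Prod>j<k. x (p j) ^ \<gamma> j))"
  unfolding alternant_def
  by (subst det_col[where n = k]) (auto simp: atLeast0LessThan permutes_in_image intro!: sum.cong prod.cong)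

lemma power_diff_factor:
  fixes a b :: "'a::comm_ring_1"
  assumes "m \<le> n"
  shows "a ^ n - a ^ m * b ^ (n - m) = (a - b) * (\<Sum>c\<in>{m..<n}. a ^ c * b ^ (n - 1 - c))"
proof -
  have "a ^ n - a ^ m * b ^ (n - m) = a ^ m * (a ^ (n - m) - b ^ (n - m))"
    using assms by (simp add: right_diff_distrib power_add[symmetric])
  also have "\<dots> = (a - b) * (\<Sum>i<n - m. a ^ m * (b ^ (n - m - Suc i) * a ^ i))"
    by (simp add: power_diff_sumr2 sum_distrib_left mult.left_commute)
  also have "(\<Sum>i<n - m. a ^ m * (b ^ (n - m - Suc i) * a ^ i)) = (\<Sum>c\<in>{m..<n}. a ^ c * b ^ (n - 1 - c))"
    by (rule sum.reindex_bij_witness[where i = "\<lambda>c. c - m" and j = "\<lambda>i. i + m"])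
       (auto simp: power_add mult_ac diff_diff_left add.commute)
  finally show ?thesis .
qed

text \<open>Subtracting from each column the next one, scaled by a power of \<open>x\<^sub>k\<close>, clears the last row up to its
final entry; the remaining \<open>k \<times> k\<close> minor has rows divisible by \<open>x\<^sub>i - x\<^sub>k\<close>, and its entries are geometric
sums, which multilinearity in the columns spreads out.\<close>

lemma alternant_branch:
  fixes x :: "nat \<Rightarrow> 'a::comm_ring_1"
  assumes dec: "\<And>j. j < k \<Longrightarrow> \<gamma> (Suc j) \<le> \<gamma> j"
  shows "alternant (Suc k) x \<gamma> = x k ^ \<gamma> k * (\<Prod>i<k. x i - x k) *
    (\<Sum>\<kappa>\<in>PiE {..<k} (\<lambda>j. {\<gamma> (Suc j)..<\<gamma> j}). (\<Prod>j<k. x k ^ (\<gamma> j - 1 - \<kappa> j)) * alternant k x \<kappa>)"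
proof -
  define M where "M = mat (Suc k) (Suc k) (\<lambda>(i, j). x i ^ \<gamma> j)"
  define U where "U = mat (Suc k) (Suc k)
     (\<lambda>(a, j). if a = j then 1 else if a = Suc j then - (x k ^ (\<gamma> j - \<gamma> (Suc j))) else 0)"
  have M: "M \<in> carrier_mat (Suc k) (Suc k)" and U: "U \<in> carrier_mat (Suc k) (Suc k)"
    by (auto simp: M_def U_def)
  \<comment> \<open>The matrix \<open>U\<close> performs the column operations.\<close>
  have dU: "det U = 1"
  proof -
    have "det U = prod_list (diag_mat U)"
      by (rule det_lower_triangular[OF _ U]) (auto simp: U_def)
    also have "diag_mat U = map (\<lambda>_. 1) [0..<Suc k]"
      unfolding diag_mat_def U_def by (intro map_cong) auto
    also have "prod_list \<dots> = (1::'a)" by (simp add: map_replicate_const)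
    finally show ?thesis .
  qed
  have MU: "(M * U) $$ (i, j) = (if j < k then x i ^ \<gamma> j - x i ^ \<gamma> (Suc j) * x k ^ (\<gamma> j - \<gamma> (Suc j)) else x i ^ \<gamma> k)"
    if "i < Suc k" "j < Suc k" for i j
  proof -
    have "(M * U) $$ (i, j) = (\<Sum>a<Suc k. x i ^ \<gamma> a * (if a = j then 1 else if a = Suc j then - (x k ^ (\<gamma> j - \<gamma> (Suc j))) else 0))"
      using that by (simp add: M_def U_def scalar_prod_def atLeast0LessThan del: sum.lessThan_Suc)
    also have "\<dots> = (\<Sum>a<Suc k. (if a = j then x i ^ \<gamma> j else 0) + (if a = Suc j then - (x i ^ \<gamma> (Suc j) * x k ^ (\<gamma> j - \<gamma> (Suc j))) else 0))"
      by (intro sum.cong) auto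
    also have "\<dots> = x i ^ \<gamma> j + (if Suc j < Suc k then - (x i ^ \<gamma> (Suc j) * x k ^ (\<gamma> j - \<gamma> (Suc j))) else 0)"
      using that by (simp add: sum.distrib sum.delta del: sum.lessThan_Suc)
    finally show ?thesis using that by (auto simp: less_Suc_eq)
  qed
  have MUc: "M * U \<in> carrier_mat (Suc k) (Suc k)" using M U by simp
  define D where "D = mat_delete (M * U) k k"
  have "alternant (Suc k) x \<gamma> = det (M * U)"
    using det_mult[OF M U] dU by (simp add: alternant_def M_def)
  also have "\<dots> = (\<Sum>j<Suc k. (M * U) $$ (k, j) * cofactor (M * U) k j)"
    by (rule laplace_expansion_row[OF MUc]) simp
  also have "\<dots> = (\<Sum>j<Suc k. if j = k then x k ^ \<gamma> k * cofactor (M * U) k k else 0)"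
  proof (intro sum.cong refl)
    fix j assume j: "j \<in> {..<Suc k}"
    show "(M * U) $$ (k, j) * cofactor (M * U) k j = (if j = k then x k ^ \<gamma> k * cofactor (M * U) k k else 0)"
      using j dec[of j] by (auto simp: MU less_Suc_eq power_add[symmetric])
  qed
  also have "\<dots> = x k ^ \<gamma> k * det D"
    by (simp add: cofactor_def D_def)
  also have "D = mat k k (\<lambda>(i, j). (x i - x k) * (\<Sum>c\<in>{\<gamma> (Suc j)..<\<gamma> j}. x i ^ c * x k ^ (\<gamma> j - 1 - c)))"
    using carrier_matD[OF M] carrier_matD[OF U] unfolding D_def mat_delete_def
    by (intro eq_matI) (auto simp: MU power_diff_factor[OF dec] simp del: index_mult_mat(1))
  also have "det \<dots> = (\<Sum>p | p permutes {..<k}. signof p * (\<Prod>j<k. (x (p j) - x k) * (\<Sum>c\<in>{\<gamma> (Suc j)..<\<gamma> j}. x (p j) ^ c * x k ^ (\<gamma> j - 1 - c))))"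
    by (subst det_col[where n = k]) (auto simp: atLeast0LessThan permutes_in_image intro!: sum.cong prod.cong)
  also have "\<dots> = (\<Sum>p | p permutes {..<k}. signof p * ((\<Prod>i<k. x i - x k) *
      (\<Sum>\<kappa>\<in>PiE {..<k} (\<lambda>j. {\<gamma> (Suc j)..<\<gamma> j}). \<Prod>j<k. x (p j) ^ \<kappa> j * x k ^ (\<gamma> j - 1 - \<kappa> j))))"
  proof (intro sum.cong refl arg_cong[where f = "\<lambda>t. _ * t"])
    fix p assume p: "p \<in> {p. p permutes {..<k}}"
    have "(\<Prod>j<k. x (p j) - x k) = (\<Prod>j<k. x j - x k)"
      using prod.permute[of p "{..<k}" "\<lambda>j. x j - x k"] p by (simp add: o_def)
    then show "(\<Prod>j<k. (x (p j) - x k) * (\<Sum>c\<in>{\<gamma> (Suc j)..<\<gamma> j}. x (p j) ^ c * x k ^ (\<gamma> j - 1 - c)))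
      = (\<Prod>i<k. x i - x k) * (\<Sum>\<kappa>\<in>PiE {..<k} (\<lambda>j. {\<gamma> (Suc j)..<\<gamma> j}). \<Prod>j<k. x (p j) ^ \<kappa> j * x k ^ (\<gamma> j - 1 - \<kappa> j))"
      by (subst prod_sum_PiE[symmetric]) (simp_all add: prod.distrib)
  qed
  also have "\<dots> = (\<Prod>i<k. x i - x k) * (\<Sum>\<kappa>\<in>PiE {..<k} (\<lambda>j. {\<gamma> (Suc j)..<\<gamma> j}). \<Sum>p | p permutes {..<k}.
       signof p * (\<Prod>j<k. x (p j) ^ \<kappa> j * x k ^ (\<gamma> j - 1 - \<kappa> j)))"
    by (subst sum.swap) (simp add: sum_distrib_left mult.left_commute)
  also have "(\<Sum>\<kappa>\<in>PiE {..<k} (\<lambda>j. {\<gamma> (Suc j)..<\<gamma> j}). \<Sum>p | p permutes {..<k}.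
       signof p * (\<Prod>j<k. x (p j) ^ \<kappa> j * x k ^ (\<gamma> j - 1 - \<kappa> j)))
    = (\<Sum>\<kappa>\<in>PiE {..<k} (\<lambda>j. {\<gamma> (Suc j)..<\<gamma> j}). (\<Prod>j<k. x k ^ (\<gamma> j - 1 - \<kappa> j)) * alternant k x \<kappa>)"
    by (intro sum.cong refl) (simp add: alternant_expand prod.distrib sum_distrib_left mult_ac)
  finally show ?thesis by (simp add: mult.assoc)
qed

text \<open>The Schur polynomial \<open>s\<^sub>\<nu>(x\<^sub>0, \<dots>, x\<^bsub>k-1\<^esub>)\<close>, summed over Gelfand-Tsetlin patterns: \<open>\<kappa>\<close> interlaces \<open>\<nu>\<close>, and
\<open>x\<^sub>k\<close> records the size of the horizontal strip \<open>\<nu> / \<kappa>\<close>.\<close>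

primrec gt_sum :: "nat \<Rightarrow> (nat \<Rightarrow> 'a::comm_ring_1) \<Rightarrow> (nat \<Rightarrow> nat) \<Rightarrow> 'a" where
  "gt_sum 0 x \<nu> = 1"
| "gt_sum (Suc k) x \<nu> = x k ^ \<nu> k *
     (\<Sum>\<kappa>\<in>PiE {..<k} (\<lambda>j. {\<nu> (Suc j)..\<nu> j}). (\<Prod>j<k. x k ^ (\<nu> j - \<kappa> j)) * gt_sum k x \<kappa>)"

lemma gt_sum_cong: "(\<And>j. j < k \<Longrightarrow> \<nu> j = \<mu> j) \<Longrightarrow> gt_sum k x \<nu> = gt_sum k x \<mu>"
proof (cases k)
  case (Suc k')
  assume *: "\<And>j. j < k \<Longrightarrow> \<nu> j = \<mu> j"
  then have "PiE {..<k'} (\<lambda>j. {\<nu> (Suc j)..\<nu> j}) = PiE {..<k'} (\<lambda>j. {\<mu> (Suc j)..\<mu> j})"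
    by (intro PiE_cong) (auto simp: Suc)
  then show ?thesis using * by (simp add: Suc)
qed simp

definition vandermonde :: "nat \<Rightarrow> (nat \<Rightarrow> 'a::comm_ring_1) \<Rightarrow> 'a" where
  "vandermonde k x = (\<Prod>j<k. \<Prod>i<j. x i - x j)"

text \<open>The determinant \<open>alternant\<close> and the product on the right obey the same recursion in \<open>k\<close>: adding \<open>k - 1 - j\<close> turns
the interlacing condition \<open>\<nu>\<^bsub>j+1\<^esub> \<le> \<kappa>\<^sub>j \<le> \<nu>\<^sub>j\<close> into the half-open intervals of \<open>alternant_branch\<close>.\<close>

lemma bialternant:
  fixes x :: "nat \<Rightarrow> 'a::comm_ring_1"
  assumes "\<And>j. Suc j < k \<Longrightarrow> \<nu> (Suc j) \<le> \<nu> j"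
  shows "alternant k x (\<lambda>j. \<nu> j + (k - 1 - j)) = gt_sum k x \<nu> * vandermonde k x"
  using assms
proof (induction k arbitrary: \<nu>)
  case 0
  then show ?case by (simp add: alternant_def vandermonde_def)
next
  case (Suc k)
  let ?C = "\<lambda>j. {\<nu> (Suc j) + (k - Suc j)..<\<nu> j + (k - j)}"
  have "alternant (Suc k) x (\<lambda>j. \<nu> j + (Suc k - 1 - j)) =
      x k ^ \<nu> k * (\<Prod>i<k. x i - x k) *
    (\<Sum>\<kappa>\<in>PiE {..<k} ?C. (\<Prod>j<k. x k ^ (\<nu> j + (k - j) - 1 - \<kappa> j)) * alternant k x \<kappa>)"
  proof -
    have "\<nu> (Suc j) + (Suc k - 1 - Suc j) \<le> \<nu> j + (Suc k - 1 - j)" if "j < k" for j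
      using Suc.prems[of j] that by linarith
    from alternant_branch[of k "\<lambda>j. \<nu> j + (Suc k - 1 - j)" x, OF this] show ?thesis by simp
  qed
  also have "(\<Sum>\<kappa>\<in>PiE {..<k} ?C. (\<Prod>j<k. x k ^ (\<nu> j + (k - j) - 1 - \<kappa> j)) * alternant k x \<kappa>)
    = (\<Sum>\<kappa>\<in>PiE {..<k} (\<lambda>j. {\<nu> (Suc j)..\<nu> j}). (\<Prod>j<k. x k ^ (\<nu> j - \<kappa> j)) * alternant k x (\<lambda>j. \<kappa> j + (k - 1 - j)))"
  proof (rule sum.reindex_bij_witness[where
        i = "\<lambda>\<kappa>. restrict (\<lambda>j. \<kappa> j + (k - 1 - j)) {..<k}" and
        j = "\<lambda>\<kappa>. restrict (\<lambda>j. \<kappa> j - (k - 1 - j)) {..<k}"], goal_cases)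
    case (1 \<kappa>)
    have "\<kappa> j \<ge> k - 1 - j" if "j < k" for j
      using PiE_mem[OF 1, of j] that by auto
    then have "restrict (\<lambda>j. \<kappa> j - (k - 1 - j) + (k - 1 - j)) {..<k} = restrict \<kappa> {..<k}"
      by (intro restrict_ext) (metis le_add_diff_inverse2 lessThan_iff)
    moreover have "restrict \<kappa> {..<k} = \<kappa>" using 1 by (rule PiE_restrict)
    ultimately show ?case by (simp only: restrict_def lessThan_iff if_True cong: if_cong)
  next
    case (2 \<kappa>)
    show ?case
    proof (rule PiE_I)
      fix j assume j: "j \<in> {..<k}"
      from PiE_mem[OF 2 j] j show "restrict (\<lambda>j. \<kappa> j - (k - 1 - j)) {..<k} j \<in> {\<nu> (Suc j)..\<nu> j}"
        by auto
    qed auto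
  next
    case (3 \<kappa>)
    then show ?case by (auto simp: fun_eq_iff restrict_def PiE_def extensional_def)
  next
    case (4 \<kappa>)
    show ?case
    proof (rule PiE_I)
      fix j assume j: "j \<in> {..<k}"
      from PiE_mem[OF 4 j] j show "restrict (\<lambda>j. \<kappa> j + (k - 1 - j)) {..<k} j \<in> ?C j"
        by auto
    qed auto
  next
    case (5 \<kappa>)
    have *: "\<kappa> j \<ge> k - 1 - j" if "j < k" for j
      using PiE_mem[OF 5, of j] that by auto
    have "(\<Prod>j<k. x k ^ (\<nu> j - restrict (\<lambda>j. \<kappa> j - (k - 1 - j)) {..<k} j)) = (\<Prod>j<k. x k ^ (\<nu> j + (k - j) - 1 - \<kappa> j))"
    proof (intro prod.cong refl arg_cong[where f = "\<lambda>t. x k ^ t"])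
      fix j assume "j \<in> {..<k}"
      then show "\<nu> j - restrict (\<lambda>j. \<kappa> j - (k - 1 - j)) {..<k} j = \<nu> j + (k - j) - 1 - \<kappa> j"
        using *[of j] by auto
    qed
    moreover have "alternant k x (\<lambda>j. restrict (\<lambda>j. \<kappa> j - (k - 1 - j)) {..<k} j + (k - 1 - j)) = alternant k x \<kappa>"
    proof (rule alternant_cong)
      fix j assume j: "j < k"
      then show "restrict (\<lambda>j. \<kappa> j - (k - 1 - j)) {..<k} j + (k - 1 - j) = \<kappa> j"
        using *[OF j] by (simp only: restrict_apply lessThan_iff if_True le_add_diff_inverse2)
    qed simp
    ultimately show ?case by simp
  qed
  also have "\<dots> = (\<Sum>\<kappa>\<in>PiE {..<k} (\<lambda>j. {\<nu> (Suc j)..\<nu> j}). (\<Prod>j<k. x k ^ (\<nu> j - \<kappa> j)) * (gt_sum k x \<kappa> * vandermonde k x))"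
  proof (intro sum.cong refl arg_cong[where f = "\<lambda>t. _ * t"] Suc.IH)
    fix \<kappa> j assume \<kappa>: "\<kappa> \<in> PiE {..<k} (\<lambda>j. {\<nu> (Suc j)..\<nu> j})" and j: "Suc j < k"
    show "\<kappa> (Suc j) \<le> \<kappa> j"
      using PiE_mem[OF \<kappa>, of j] PiE_mem[OF \<kappa>, of "Suc j"] j by auto
  qed
  finally show ?case by (simp add: vandermonde_def sum_distrib_left sum_distrib_right mult_ac)
qed

lemma vandermonde_alternant: "vandermonde k x = alternant k x (\<lambda>j. k - 1 - j)"
proof -
  have "gt_sum k x (\<lambda>_. 0) = 1"
  proof (induction k)
    case (Suc k)
    have *: "PiE {..<k} (\<lambda>j. {(0::nat)..0}) = {restrict (\<lambda>_. 0) {..<k}}"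
      by (simp add: PiE_singleton)
    have "gt_sum k x (restrict (\<lambda>_. 0) {..<k}) = gt_sum k x (\<lambda>_. 0)"
      by (rule gt_sum_cong) auto
    then show ?case unfolding gt_sum.simps * using Suc by simp
  qed simp
  then show ?thesis using bialternant[of k "\<lambda>_. 0" x] by simp
qed

section \<open>Schur polynomials as sums over semistandard tableaux\<close>

definition diagram :: "nat \<Rightarrow> (nat \<Rightarrow> nat) \<Rightarrow> (nat \<times> nat) set" where
  "diagram k \<nu> = Sigma {..<k} (\<lambda>i. {..<\<nu> i})"

definition ssyt :: "nat \<Rightarrow> (nat \<Rightarrow> nat) \<Rightarrow> (nat \<times> nat \<Rightarrow> nat) set" where
  "ssyt k \<nu> = {T. (\<forall>c. c \<notin> diagram k \<nu> \<longrightarrow> T c = 0) \<and> (\<forall>c\<in>diagram k \<nu>. 1 \<le> T c \<and> T c \<le> k) \<and>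
     (\<forall>i j. (i, Suc j) \<in> diagram k \<nu> \<longrightarrow> T (i, j) \<le> T (i, Suc j)) \<and>
     (\<forall>i j. (Suc i, j) \<in> diagram k \<nu> \<longrightarrow> T (i, j) < T (Suc i, j))}"

lemma finite_diagram [simp]: "finite (diagram k \<nu>)"
  by (simp add: diagram_def)

lemma finite_ssyt [simp]: "finite (ssyt k \<nu>)"
proof (rule finite_subset)
  show "ssyt k \<nu> \<subseteq> {T. \<forall>c. (c \<in> diagram k \<nu> \<longrightarrow> T c \<in> {..k}) \<and> (c \<notin> diagram k \<nu> \<longrightarrow> T c = 0)}"
    by (auto simp: ssyt_def)
  show "finite {T. \<forall>c. (c \<in> diagram k \<nu> \<longrightarrow> T c \<in> {..k}) \<and> (c \<notin> diagram k \<nu> \<longrightarrow> T c = (0::nat))}"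
    by (rule finite_set_of_finite_funs) auto
qed

lemma downward_closed_eq_lessThan:
  fixes A :: "nat set"
  assumes "finite A" and down: "\<And>a b. a \<in> A \<Longrightarrow> b \<le> a \<Longrightarrow> b \<in> A"
  shows "A = {..<card A}"
proof -
  have "a < card A" if "a \<in> A" for a
  proof -
    have "{..a} \<subseteq> A" using down that by auto
    then have "card {..a} \<le> card A" by (rule card_mono[OF assms(1)])
    then show ?thesis by simp
  qed
  then have "A \<subseteq> {..<card A}" by auto
  then show ?thesis by (intro card_subset_eq) auto
qed

text \<open>Row \<open>i\<close> of a semistandard tableau has entries at least \<open>i + 1\<close>, so with entries up to \<open>k + 1\<close> the last of
\<open>k + 1\<close> rows consists of \<open>k + 1\<close> only; strictness in the columns makes the shape \<open>\<kappa>\<close> of the entries at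
most \<open>k\<close> interlace \<open>\<nu>\<close>.\<close>

lemma ssyt_remove_largest:
  assumes T: "T \<in> ssyt (Suc k) \<nu>" and dec: "\<And>j. j < k \<Longrightarrow> \<nu> (Suc j) \<le> \<nu> j"
  defines "\<kappa> \<equiv> \<lambda>i. card {j. j < \<nu> i \<and> T (i, j) \<le> k}"
  shows "i < Suc k \<Longrightarrow> j < \<nu> i \<Longrightarrow> T (i, j) \<le> k \<longleftrightarrow> j < \<kappa> i"
    and "\<kappa> i \<le> \<nu> i" and "\<kappa> k = 0" and "i < k \<Longrightarrow> \<nu> (Suc i) \<le> \<kappa> i"
proof -
  have row: "T (i, j) \<le> T (i, Suc j)" if "i < Suc k" "Suc j < \<nu> i" for i j
    using T that by (auto simp: ssyt_def diagram_def)
  have col: "T (i, j) < T (Suc i, j)" if "i < k" "j < \<nu> (Suc i)" for i j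
    using T that by (auto simp: ssyt_def diagram_def)
  have pos: "1 \<le> T (i, j)" "T (i, j) \<le> Suc k" if "i < Suc k" "j < \<nu> i" for i j
    using T that by (auto simp: ssyt_def diagram_def)
  have rows: "T (i, a) \<le> T (i, b)" if "i < Suc k" "b < \<nu> i" "a \<le> b" for i a b
    using that(3,2)
  proof (induction b rule: dec_induct)
    case (step n)
    then show ?case using row[of i n] that(1) by auto
  qed simp
  have set: "{j. j < \<nu> i \<and> T (i, j) \<le> k} = {..<\<kappa> i}" if "i < Suc k" for i
    unfolding \<kappa>_def
  proof (rule downward_closed_eq_lessThan)
    fix a b assume "a \<in> {j. j < \<nu> i \<and> T (i, j) \<le> k}" "b \<le> a"
    then show "b \<in> {j. j < \<nu> i \<and> T (i, j) \<le> k}"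
      using rows[of i a b] that by auto
  qed auto
  show "T (i, j) \<le> k \<longleftrightarrow> j < \<kappa> i" if "i < Suc k" "j < \<nu> i" for i j
    using set[OF that(1)] that by auto
  have "card {j. j < \<nu> i \<and> T (i, j) \<le> k} \<le> card {..<\<nu> i}" by (rule card_mono) auto
  then show "\<kappa> i \<le> \<nu> i" by (simp add: \<kappa>_def)
  have low: "i < Suc k \<Longrightarrow> j < \<nu> i \<Longrightarrow> Suc i \<le> T (i, j)" for i j
  proof (induction i)
    case 0 then show ?case using pos by auto
  next
    case (Suc i)
    then have "j < \<nu> i" using dec[of i] by auto
    then show ?case using Suc col[of i j] by auto
  qed
  have "{j. j < \<nu> k \<and> T (k, j) \<le> k} = {}" using low[of k] by force
  then show "\<kappa> k = 0" by (simp add: \<kappa>_def)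
  show "\<nu> (Suc i) \<le> \<kappa> i" if i: "i < k"
  proof -
    have "j < \<kappa> i" if "j < \<nu> (Suc i)" for j
    proof -
      have "j < \<nu> i" using dec[OF i] that by auto
      moreover have "T (i, j) \<le> k" using col[OF i that] pos(2)[of "Suc i" j] i that by auto
      ultimately show ?thesis using set[of i] i by auto
    qed
    then show ?thesis by (meson not_le less_irrefl)
  qed
qed

text \<open>Removing the cells with the largest entry is a bijection onto pairs of an interlacing shape \<open>\<kappa>\<close> and
a tableau of shape \<open>\<kappa>\<close>; the removed cells contribute the power of \<open>x\<^sub>k\<close> in the recursion.\<close>

lemma gt_sum_ssyt:
  fixes x :: "nat \<Rightarrow> 'a::comm_ring_1"
  assumes "\<And>j. Suc j < k \<Longrightarrow> \<nu> (Suc j) \<le> \<nu> j"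
  shows "gt_sum k x \<nu> = (\<Sum>T\<in>ssyt k \<nu>. \<Prod>c\<in>diagram k \<nu>. x (T c - 1))"
  using assms
proof (induction k arbitrary: \<nu>)
  case 0
  have "ssyt 0 \<nu> = {\<lambda>_. 0}" by (auto simp: ssyt_def diagram_def)
  then show ?case by (simp add: diagram_def)
next
  case (Suc k)
  have dec: "\<nu> (Suc j) \<le> \<nu> j" if "j < k" for j using Suc.prems that by simp
  define K where "K = PiE {..<k} (\<lambda>j. {\<nu> (Suc j)..\<nu> j})"
  have fK: "finite K" unfolding K_def by (intro finite_PiE) auto
  have K: "\<nu> (Suc j) \<le> \<kappa> j" "\<kappa> j \<le> \<nu> j" if "\<kappa> \<in> K" "j < k" for \<kappa> j
    using PiE_mem[of \<kappa> "{..<k}" _ j] that unfolding K_def by auto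
  define shape where "shape T = restrict (\<lambda>i. card {j. j < \<nu> i \<and> T (i, j) \<le> k}) {..<k}" for T :: "nat \<times> nat \<Rightarrow> nat"
  define cut where "cut T = (\<lambda>c. if c \<in> diagram k (shape T) then T c else 0)" for T :: "nat \<times> nat \<Rightarrow> nat"
  define fill where "fill \<kappa> T = (\<lambda>c. if c \<in> diagram k \<kappa> then T c else if c \<in> diagram (Suc k) \<nu> then Suc k else 0)"
    for \<kappa> and T :: "nat \<times> nat \<Rightarrow> nat"
  have "gt_sum (Suc k) x \<nu> = (\<Sum>\<kappa>\<in>K. \<Sum>T\<in>ssyt k \<kappa>. x k ^ \<nu> k * (\<Prod>j<k. x k ^ (\<nu> j - \<kappa> j)) * (\<Prod>c\<in>diagram k \<kappa>. x (T c - 1)))"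
  proof -
    have "gt_sum k x \<kappa> = (\<Sum>T\<in>ssyt k \<kappa>. \<Prod>c\<in>diagram k \<kappa>. x (T c - 1))" if "\<kappa> \<in> K" for \<kappa>
      by (rule Suc.IH) (use K(1)[OF that] K(2)[OF that] in \<open>meson Suc_lessD order_trans\<close>)
    then show ?thesis by (simp add: K_def sum_distrib_left mult.assoc)
  qed
  also have "\<dots> = (\<Sum>(\<kappa>, T)\<in>Sigma K (ssyt k). x k ^ \<nu> k * (\<Prod>j<k. x k ^ (\<nu> j - \<kappa> j)) * (\<Prod>c\<in>diagram k \<kappa>. x (T c - 1)))"
    by (rule sum.Sigma) (auto simp: fK)
  also have "\<dots> = (\<Sum>T\<in>ssyt (Suc k) \<nu>. \<Prod>c\<in>diagram (Suc k) \<nu>. x (T c - 1))"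
  proof (rule sym, rule sum.reindex_bij_witness[where i = "\<lambda>(\<kappa>, T). fill \<kappa> T" and j = "\<lambda>T. (shape T, cut T)"], goal_cases)
    case (1 T)
    note rl = ssyt_remove_largest[OF 1 dec]
    have "T c = 0" if "c \<notin> diagram (Suc k) \<nu>" for c using 1 that unfolding ssyt_def by blast
    moreover have "T (i, j) = Suc k" if "(i, j) \<in> diagram (Suc k) \<nu>" "(i, j) \<notin> diagram k (shape T)" for i j
    proof -
      have ij: "i < Suc k" "j < \<nu> i" using that by (auto simp: diagram_def)
      have "\<not> T (i, j) \<le> k"
        using rl(1)[OF _ ij] rl(3) ij that(2) by (cases "i = k") (auto simp: diagram_def shape_def)
      moreover have "T (i, j) \<le> Suc k" using 1 that by (auto simp: ssyt_def)
      ultimately show ?thesis by simp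
    qed
    ultimately show ?case by (auto simp: fill_def cut_def fun_eq_iff)
  next
    case (2 T)
    note rl = ssyt_remove_largest[OF 2 dec]
    have sh: "shape T i = card {j. j < \<nu> i \<and> T (i, j) \<le> k}" if "i < k" for i using that by (simp add: shape_def)
    have shK: "shape T \<in> K" unfolding K_def
    proof (rule PiE_I)
      fix i assume "i \<in> {..<k}"
      then show "shape T i \<in> {\<nu> (Suc i)..\<nu> i}" using rl(2)[of i] rl(4)[of i] by (simp add: sh)
    qed (simp add: shape_def)
    have sub: "diagram k (shape T) \<subseteq> diagram (Suc k) \<nu>"
      using K(2)[OF shK] by (auto simp: diagram_def intro: less_le_trans)
    have le: "T c \<le> k" if "c \<in> diagram k (shape T)" for c
    proof -
      obtain i j where c: "c = (i, j)" "i < k" "j < shape T i" using \<open>c \<in> _\<close> by (auto simp: diagram_def)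
      then show ?thesis using rl(1)[of i j] sh[of i] K(2)[OF shK, of i] by auto
    qed
    have dsh: "shape T (Suc i) \<le> shape T i" if "Suc i < k" for i
      using K(1)[OF shK, of i] K(2)[OF shK, of "Suc i"] that by auto
    have "cut T \<in> ssyt k (shape T)"
      unfolding ssyt_def mem_Collect_eq
    proof (intro conjI allI impI ballI)
      fix c assume c: "c \<in> diagram k (shape T)"
      then show "1 \<le> cut T c" "cut T c \<le> k" using 2 sub le[OF c] by (auto simp: cut_def ssyt_def)
    next
      fix i j assume c: "(i, Suc j) \<in> diagram k (shape T)"
      then have "(i, j) \<in> diagram k (shape T)" by (auto simp: diagram_def)
      then show "cut T (i, j) \<le> cut T (i, Suc j)" using c sub 2 by (auto simp: cut_def ssyt_def)
    next
      fix i j assume c: "(Suc i, j) \<in> diagram k (shape T)"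
      then have "(i, j) \<in> diagram k (shape T)" using dsh[of i] by (auto simp: diagram_def)
      then show "cut T (i, j) < cut T (Suc i, j)" using c sub 2 by (auto simp: cut_def ssyt_def)
    qed (auto simp: cut_def)
    then show ?case using shK by auto
  next
    case (3 p)
    then obtain \<kappa> T where p: "p = (\<kappa>, T)" "\<kappa> \<in> K" "T \<in> ssyt k \<kappa>" by auto
    have val: "fill \<kappa> T (i, j) \<le> k \<longleftrightarrow> j < \<kappa> i" if "i < k" "j < \<nu> i" for i j
      using that p(3) by (auto simp: fill_def diagram_def ssyt_def)
    have sf: "shape (fill \<kappa> T) = \<kappa>"
    proof
      fix i show "shape (fill \<kappa> T) i = \<kappa> i"
      proof (cases "i < k")
        case True
        have "{j. j < \<nu> i \<and> fill \<kappa> T (i, j) \<le> k} = {..<\<kappa> i}"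
          using val[OF True] K(2)[OF p(2) True] by auto
        then show ?thesis using True by (simp add: shape_def)
      next
        case False
        then show ?thesis using PiE_arb[OF p(2)[unfolded K_def], of i] by (simp add: shape_def)
      qed
    qed
    have "T c = 0" if "c \<notin> diagram k \<kappa>" for c using p(3) that unfolding ssyt_def by blast
    then have "cut (fill \<kappa> T) = T" unfolding cut_def sf by (auto simp: fill_def fun_eq_iff)
    then show ?case by (simp add: p sf)
  next
    case (4 p)
    then obtain \<kappa> T where p: "p = (\<kappa>, T)" "\<kappa> \<in> K" "T \<in> ssyt k \<kappa>" by auto
    have sub: "diagram k \<kappa> \<subseteq> diagram (Suc k) \<nu>"
      using K(2)[OF p(2)] by (auto simp: diagram_def intro: less_le_trans)
    have le: "T c \<le> k" "1 \<le> T c" if "c \<in> diagram k \<kappa>" for c using p(3) that unfolding ssyt_def by blast+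
    have row: "T (i, j) \<le> T (i, Suc j)" if "(i, Suc j) \<in> diagram k \<kappa>" for i j
      using p(3) that unfolding ssyt_def by blast
    have col: "T (i, j) < T (Suc i, j)" if "(Suc i, j) \<in> diagram k \<kappa>" for i j
      using p(3) that unfolding ssyt_def by blast
    have "fill \<kappa> T \<in> ssyt (Suc k) \<nu>"
      unfolding ssyt_def mem_Collect_eq
    proof (intro conjI allI impI ballI)
      fix c assume "c \<notin> diagram (Suc k) \<nu>"
      then show "fill \<kappa> T c = 0" using sub by (auto simp: fill_def)
    next
      fix c assume c: "c \<in> diagram (Suc k) \<nu>"
      then show "1 \<le> fill \<kappa> T c" "fill \<kappa> T c \<le> Suc k" using le[of c] by (auto simp: fill_def)
    next
      fix i j assume c: "(i, Suc j) \<in> diagram (Suc k) \<nu>"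
      then have "(i, j) \<in> diagram (Suc k) \<nu>" by (auto simp: diagram_def)
      moreover have "(i, j) \<in> diagram k \<kappa>" if "(i, Suc j) \<in> diagram k \<kappa>" using that by (auto simp: diagram_def)
      ultimately show "fill \<kappa> T (i, j) \<le> fill \<kappa> T (i, Suc j)"
        using c le(1)[of "(i, j)"] row[of i j] by (fastforce simp add: fill_def)
    next
      fix i j assume c: "(Suc i, j) \<in> diagram (Suc k) \<nu>"
      then have *: "(i, j) \<in> diagram k \<kappa>" using K(1)[OF p(2), of i] by (auto simp: diagram_def)
      show "fill \<kappa> T (i, j) < fill \<kappa> T (Suc i, j)"
        using c * le(1)[OF *] col[of i j] by (simp add: fill_def)
    qed
    then show ?case by (simp add: p)
  next
    case (5 T)
    note rl = ssyt_remove_largest[OF 5 dec]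
    have sh: "shape T i = card {j. j < \<nu> i \<and> T (i, j) \<le> k}" if "i < k" for i using that by (simp add: shape_def)
    have big: "T (i, j) = Suc k" if "i < Suc k" "j < \<nu> i" "\<not> T (i, j) \<le> k" for i j
      using 5 that by (auto simp: ssyt_def diagram_def le_Suc_eq)
    have split: "(\<Prod>j<\<nu> i. x (T (i, j) - 1)) = (\<Prod>j<shape T i. x (cut T (i, j) - 1)) * x k ^ (\<nu> i - shape T i)"
      if i: "i < k" for i
    proof -
      have "shape T i \<le> \<nu> i" using rl(2)[of i] by (simp add: sh i)
      then have eq: "{..<\<nu> i} = {..<shape T i} \<union> {shape T i..<\<nu> i}" by auto
      have "(\<Prod>j<\<nu> i. x (T (i, j) - 1)) = (\<Prod>j<shape T i. x (T (i, j) - 1)) * (\<Prod>j\<in>{shape T i..<\<nu> i}. x (T (i, j) - 1))"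
        unfolding eq by (rule prod.union_disjoint) auto
      also have "(\<Prod>j\<in>{shape T i..<\<nu> i}. x (T (i, j) - 1)) = (\<Prod>j\<in>{shape T i..<\<nu> i}. x k)"
        using rl(1)[of i] big[of i] i by (intro prod.cong refl) (auto simp: sh)
      also have "(\<Prod>j<shape T i. x (T (i, j) - 1)) = (\<Prod>j<shape T i. x (cut T (i, j) - 1))"
        using i by (intro prod.cong refl) (auto simp: cut_def diagram_def)
      finally show ?thesis by simp
    qed
    have last: "(\<Prod>j<\<nu> k. x (T (k, j) - 1)) = x k ^ \<nu> k"
    proof -
      have "(\<Prod>j<\<nu> k. x (T (k, j) - 1)) = (\<Prod>j<\<nu> k. x k)"
        using rl(1)[of k] rl(3) big[of k] by (intro prod.cong refl) auto
      then show ?thesis by simp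
    qed
    have "(\<Prod>c\<in>diagram (Suc k) \<nu>. x (T c - 1)) = (\<Prod>i<Suc k. \<Prod>j<\<nu> i. x (T (i, j) - 1))"
      unfolding diagram_def by (subst prod.Sigma) (auto simp: case_prod_beta)
    also have "\<dots> = (\<Prod>i<k. (\<Prod>j<shape T i. x (cut T (i, j) - 1)) * x k ^ (\<nu> i - shape T i)) * x k ^ \<nu> k"
    proof -
      have "(\<Prod>i<k. \<Prod>j<\<nu> i. x (T (i, j) - 1)) = (\<Prod>i<k. (\<Prod>j<shape T i. x (cut T (i, j) - 1)) * x k ^ (\<nu> i - shape T i))"
        by (rule prod.cong) (simp_all only: lessThan_iff split)
      then show ?thesis by (simp only: prod.lessThan_Suc last)
    qed
    also have "\<dots> = x k ^ \<nu> k * (\<Prod>i<k. x k ^ (\<nu> i - shape T i)) * (\<Prod>i<k. \<Prod>j<shape T i. x (cut T (i, j) - 1))"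
      by (simp add: prod.distrib mult_ac)
    also have "(\<Prod>i<k. \<Prod>j<shape T i. x (cut T (i, j) - 1)) = (\<Prod>c\<in>diagram k (shape T). x (cut T c - 1))"
      unfolding diagram_def by (subst prod.Sigma) (auto simp: case_prod_beta)
    finally show ?case by simp
  qed
  finally show ?case .
qed

section \<open>Symmetry of the Kostka numbers\<close>

definition mpvar :: "nat \<Rightarrow> ('a::comm_ring_1 mpoly)" where
  "mpvar i = single (single i 1) 1"

lemma prod_single_one:
  "(\<Prod>c\<in>D. single (a c) (1::'a::comm_ring_1)) = single (\<Sum>c\<in>D. a c :: nat \<Rightarrow>\<^sub>0 nat) 1"
  by (induction D rule: infinite_finite_induct) (simp_all add: mult_single)

lemma mpvar_power: "mpvar i ^ n = single (single i n) (1::'a::comm_ring_1)"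
  by (induction n) (simp_all add: mpvar_def mult_single single_add[symmetric])

lemma mpvar_inj: "(mpvar i :: 'a::comm_ring_1 mpoly) = mpvar j \<longleftrightarrow> i = j"
proof
  assume "(mpvar i :: 'a mpoly) = mpvar j"
  then have "keys (mpvar i :: 'a mpoly) = keys (mpvar j :: 'a mpoly)"
    by (rule arg_cong)
  then have "single i (1::nat) = single j 1" by (simp add: mpvar_def)
  then have "keys (single i (1::nat)) = keys (single j (1::nat))" by (rule arg_cong)
  then show "i = j" by simp
qed simp

lemma vandermonde_mpvar_nonzero:
  "vandermonde k (mpvar :: nat \<Rightarrow> 'a::idom mpoly) \<noteq> 0"
  by (auto simp: vandermonde_def mpvar_inj)

lemma alternant_permute:
  assumes "p permutes {..<k}"
  shows "alternant k (\<lambda>i. x (p i)) \<gamma> = signof p * alternant k x \<gamma>"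
proof -
  have "alternant k (\<lambda>i. x (p i)) \<gamma> = det (mat k k (\<lambda>(i, j). mat k k (\<lambda>(i, j). x i ^ \<gamma> j) $$ (p i, j)))"
    unfolding alternant_def
    using permutes_in_image[OF assms] by (intro arg_cong[where f = det] cong_mat) auto
  also have "\<dots> = signof p * alternant k x \<gamma>"
    unfolding alternant_def by (rule det_permute_rows) (use assms in \<open>auto simp: atLeast0LessThan\<close>)
  finally show ?thesis .
qed

lemma vandermonde_permute:
  "p permutes {..<k} \<Longrightarrow> vandermonde k (\<lambda>i. x (p i)) = signof p * vandermonde k x"
  by (simp add: vandermonde_alternant alternant_permute)

lemma signof_square: "signof p * signof p = (1 :: 'a::comm_ring_1)"
  by (simp add: sign_def)

text \<open>Numerator and denominator of the bialternant formula change by the same sign when the variables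
are permuted, and the Vandermonde product can be cancelled in an integral domain.\<close>

lemma gt_sum_symmetric:
  assumes p: "p permutes {..<k}" and dec: "\<And>j. Suc j < k \<Longrightarrow> \<nu> (Suc j) \<le> \<nu> j"
  shows "gt_sum k (\<lambda>i. mpvar (p i) :: 'a::idom mpoly) \<nu> = gt_sum k mpvar \<nu>"
proof -
  let ?X = "mpvar :: nat \<Rightarrow> 'a mpoly"
  let ?Y = "\<lambda>i. ?X (p i)"
  let ?\<gamma> = "\<lambda>j. \<nu> j + (k - 1 - j)"
  have "signof p * (gt_sum k ?Y \<nu> * vandermonde k ?X) = gt_sum k ?Y \<nu> * vandermonde k ?Y"
    unfolding vandermonde_permute[OF p, of ?X] by (rule mult.left_commute)
  also have "\<dots> = alternant k ?Y ?\<gamma>" by (rule bialternant[symmetric]) (rule dec)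
  also have "\<dots> = signof p * alternant k ?X ?\<gamma>" by (rule alternant_permute[OF p])
  also have "alternant k ?X ?\<gamma> = gt_sum k ?X \<nu> * vandermonde k ?X" by (rule bialternant) (rule dec)
  finally have "signof p * (gt_sum k ?Y \<nu> * vandermonde k ?X) = signof p * (gt_sum k ?X \<nu> * vandermonde k ?X)" .
  then have "signof p * signof p * (gt_sum k ?Y \<nu> * vandermonde k ?X) = signof p * signof p * (gt_sum k ?X \<nu> * vandermonde k ?X)"
    by (simp only: mult.assoc)
  then show ?thesis unfolding signof_square using vandermonde_mpvar_nonzero[of k, where 'a = 'a] by simp
qed

definition content :: "nat \<Rightarrow> (nat \<Rightarrow> nat) \<Rightarrow> (nat \<times> nat \<Rightarrow> nat) \<Rightarrow> nat \<Rightarrow>\<^sub>0 nat" where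
  "content k \<nu> T = (\<Sum>c\<in>diagram k \<nu>. single (T c - 1) 1)"

lemma lookup_sum_single_one:
  assumes "finite D"
  shows "lookup (\<Sum>c\<in>D. single (f c) (1::'a::semiring_1)) i = of_nat (card {c\<in>D. f c = i})"
proof -
  have "lookup (\<Sum>c\<in>D. single (f c) (1::'a)) i = (\<Sum>c\<in>D. if f c = i then 1 else 0)"
    by (simp add: lookup_sum lookup_single when_def)
  also have "\<dots> = (\<Sum>c\<in>{c\<in>D. f c = i}. 1)"
    by (simp only: sum.inter_filter[OF assms])
  finally show ?thesis by simp
qed

lemma lookup_content:
  assumes "T \<in> ssyt k \<nu>"
  shows "lookup (content k \<nu> T) i = card {c\<in>diagram k \<nu>. T c = Suc i}"
proof -
  have "{c\<in>diagram k \<nu>. T c - 1 = i} = {c\<in>diagram k \<nu>. T c = Suc i}"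
    using assms by (force simp: ssyt_def)
  then show ?thesis unfolding content_def by (subst lookup_sum_single_one) auto
qed

lemma gt_sum_content:
  assumes "\<And>j. Suc j < k \<Longrightarrow> \<nu> (Suc j) \<le> \<nu> j"
  shows "gt_sum k mpvar \<nu> = (\<Sum>T\<in>ssyt k \<nu>. single (content k \<nu> T) 1)"
proof -
  have "gt_sum k mpvar \<nu> = (\<Sum>T\<in>ssyt k \<nu>. \<Prod>c\<in>diagram k \<nu>. mpvar (T c - 1))"
    by (rule gt_sum_ssyt) (rule assms)
  then show ?thesis by (simp only: mpvar_def prod_single_one content_def)
qed

definition weight_count :: "nat \<Rightarrow> (nat \<Rightarrow> nat) \<Rightarrow> (nat \<Rightarrow> nat) \<Rightarrow> nat" where
  "weight_count k \<nu> \<beta> = card {T\<in>ssyt k \<nu>. \<forall>i<k. card {c\<in>diagram k \<nu>. T c = Suc i} = \<beta> i}"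

lemma weight_count_cong: "(\<And>i. i < k \<Longrightarrow> \<beta> i = \<beta>' i) \<Longrightarrow> weight_count k \<nu> \<beta> = weight_count k \<nu> \<beta>'"
  unfolding weight_count_def by (intro arg_cong[where f = card]) auto

text \<open>Both sides are coefficients of the same Schur polynomial, before and after permuting the variables.\<close>

lemma weight_count_permute:
  assumes p: "p permutes {..<k}" and dec: "\<And>j. Suc j < k \<Longrightarrow> \<nu> (Suc j) \<le> \<nu> j"
  shows "weight_count k \<nu> (\<lambda>i. \<beta> (p i)) = weight_count k \<nu> \<beta>"
proof -
  define \<alpha> :: "nat \<Rightarrow>\<^sub>0 nat" where "\<alpha> = (\<Sum>i<k. single i (\<beta> i))"
  have look\<alpha>: "lookup \<alpha> i = (if i < k then \<beta> i else 0)" for i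
    by (simp add: \<alpha>_def lookup_sum lookup_single when_def)
  define cp where "cp q T = (\<Sum>c\<in>diagram k \<nu>. single (q (T c - 1)) (1::nat))"
    for q :: "nat \<Rightarrow> nat" and T :: "nat \<times> nat \<Rightarrow> nat"
  have gt: "gt_sum k (\<lambda>i. mpvar (q i) :: int mpoly) \<nu> = (\<Sum>T\<in>ssyt k \<nu>. single (cp q T) 1)" for q
  proof -
    have "gt_sum k (\<lambda>i. mpvar (q i) :: int mpoly) \<nu>
        = (\<Sum>T\<in>ssyt k \<nu>. \<Prod>c\<in>diagram k \<nu>. mpvar (q (T c - 1)))"
      by (rule gt_sum_ssyt) (rule dec)
    then show ?thesis by (simp only: mpvar_def prod_single_one cp_def)
  qed
  have look: "lookup (gt_sum k (\<lambda>i. mpvar (q i) :: int mpoly) \<nu>) \<alpha> = int (weight_count k \<nu> (\<lambda>i. \<beta> (q i)))"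
    if q: "q permutes {..<k}" for q
  proof -
    have "cp q T = \<alpha> \<longleftrightarrow> (\<forall>i<k. card {c\<in>diagram k \<nu>. T c = Suc i} = \<beta> (q i))" if T: "T \<in> ssyt k \<nu>" for T
    proof -
      have lk: "lookup (cp q T) (q i) = card {c\<in>diagram k \<nu>. T c = Suc i}" for i
      proof -
        have "{c\<in>diagram k \<nu>. q (T c - 1) = q i} = {c\<in>diagram k \<nu>. T c = Suc i}"
          using T by (force simp: ssyt_def inj_eq[OF permutes_inj[OF q]])
        then show ?thesis unfolding cp_def by (subst lookup_sum_single_one) auto
      qed
      have big: "card {c\<in>diagram k \<nu>. T c = Suc i} = 0" if "\<not> i < k" for i
      proof -
        have "{c\<in>diagram k \<nu>. T c = Suc i} = {}" using T that by (force simp: ssyt_def)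
        then show ?thesis by (simp only: card.empty)
      qed
      have "cp q T = \<alpha> \<longleftrightarrow> (\<forall>i. lookup (cp q T) (q i) = lookup \<alpha> (q i))"
        by (metis poly_mapping_eqI permutes_surj[OF q] surjD)
      also have "\<dots> \<longleftrightarrow> (\<forall>i. card {c\<in>diagram k \<nu>. T c = Suc i} = (if i < k then \<beta> (q i) else 0))"
        using permutes_in_image[OF q] by (simp add: lk look\<alpha>)
      also have "\<dots> \<longleftrightarrow> (\<forall>i<k. card {c\<in>diagram k \<nu>. T c = Suc i} = \<beta> (q i))"
        using big by auto
      finally show ?thesis .
    qed
    then have "{T\<in>ssyt k \<nu>. cp q T = \<alpha>} = {T\<in>ssyt k \<nu>. \<forall>i<k. card {c\<in>diagram k \<nu>. T c = Suc i} = \<beta> (q i)}"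
      by blast
    then show ?thesis
      by (simp add: gt weight_count_def lookup_sum_single_one)
  qed
  have "int (weight_count k \<nu> (\<lambda>i. \<beta> (p i))) = int (weight_count k \<nu> (\<lambda>i. \<beta> (id i)))"
    unfolding look[OF p, symmetric] look[OF permutes_id, symmetric]
    using gt_sum_symmetric[of p k \<nu>, where 'a = int] p dec by simp
  then show ?thesis by simp
qed

section \<open>Polynomials acting by shifts\<close>

text \<open>Coefficients of \<open>P(x) \<cdot> \<Sum>\<^sub>\<gamma> F(\<gamma>) x\<^bsup>-\<gamma>\<^esup>\<close> for families \<open>F\<close> indexed by integer vectors, without formal series in
infinitely many exponents: the variable \<open>x\<^sub>i\<close> acts by raising the \<open>i\<close>-th index by one.\<close>

definition act :: "complex mpoly \<Rightarrow> ((nat \<Rightarrow> int) \<Rightarrow> symf) \<Rightarrow> (nat \<Rightarrow> int) \<Rightarrow> symf" where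
  "act P F \<gamma> = (\<Sum>\<alpha>\<in>keys P. cmul (lookup P \<alpha>) (F (\<lambda>i. \<gamma> i + int (lookup \<alpha> i))))"

lemma act_superset:
  "finite A \<Longrightarrow> keys P \<subseteq> A \<Longrightarrow>
    act P F \<gamma> = (\<Sum>\<alpha>\<in>A. cmul (lookup P \<alpha>) (F (\<lambda>i. \<gamma> i + int (lookup \<alpha> i))))"
  unfolding act_def by (rule sum.mono_neutral_left) (auto simp: in_keys_iff)

lemma act_zero [simp]: "act 0 F \<gamma> = 0"
  by (simp add: act_def)

lemma act_add: "act (P + Q) F \<gamma> = act P F \<gamma> + act Q F \<gamma>"
proof -
  let ?A = "keys P \<union> keys Q"
  show ?thesis
    using act_superset[of ?A P F \<gamma>] act_superset[of ?A Q F \<gamma>]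
      act_superset[of ?A "P + Q" F \<gamma>] Poly_Mapping.keys_add[of P Q]
    by (simp add: lookup_add CV.scale_left_distrib sum.distrib)
qed

lemma act_uminus: "act (- P) F \<gamma> = - act P F \<gamma>"
  using act_add[of P "- P" F \<gamma>] by (simp add: add_eq_0_iff2)

lemma act_diff: "act (P - Q) F \<gamma> = act P F \<gamma> - act Q F \<gamma>"
  using act_add[of P "- Q" F \<gamma>] by (simp add: act_uminus)

lemma act_sum: "act (\<Sum>a\<in>A. P a) F \<gamma> = (\<Sum>a\<in>A. act (P a) F \<gamma>)"
  by (induction A rule: infinite_finite_induct) (simp_all add: act_add)

lemma act_single: "act (single \<alpha> c) F \<gamma> = cmul c (F (\<lambda>i. \<gamma> i + int (lookup \<alpha> i)))"
  by (simp add: act_def)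

lemma act_one [simp]: "act 1 F \<gamma> = F \<gamma>"
  using act_single[of 0 1 F \<gamma>] by simp

lemma act_mpvar: "act (mpvar j) F \<gamma> = F (\<gamma>(j := \<gamma> j + 1))"
  unfolding mpvar_def act_single by (auto intro!: arg_cong[where f = F] simp: lookup_single when_def fun_eq_iff)

lemma poly_mapping_sum_single:
  "P = (\<Sum>\<alpha>\<in>keys P. single \<alpha> (lookup P \<alpha>))"
  by (rule poly_mapping_eqI) (simp add: lookup_sum lookup_single when_def in_keys_iff)

lemma act_mult_single:
  "act (single \<alpha> c * Q) F \<gamma> = cmul c (act Q F (\<lambda>i. \<gamma> i + int (lookup \<alpha> i)))"
proof -
  have "act (single \<alpha> c * Q) F \<gamma>
    = (\<Sum>\<beta>\<in>keys Q. act (single (\<alpha> + \<beta>) (c * lookup Q \<beta>)) F \<gamma>)"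
    by (subst poly_mapping_sum_single[of Q]) (simp add: sum_distrib_left mult_single act_sum)
  also have "\<dots> = cmul c (act Q F (\<lambda>i. \<gamma> i + int (lookup \<alpha> i)))"
    unfolding act_def[of Q] by (simp add: act_single CV.scale_sum_right lookup_add add_ac)
  finally show ?thesis .
qed

lemma act_mult: "act (P * Q) F \<gamma> = act P (act Q F) \<gamma>"
proof -
  have "act (P * Q) F \<gamma> = (\<Sum>\<alpha>\<in>keys P. act (single \<alpha> (lookup P \<alpha>) * Q) F \<gamma>)"
    by (subst poly_mapping_sum_single[of P]) (simp add: sum_distrib_right act_sum)
  then show ?thesis by (simp add: act_mult_single act_def[of P])
qed

lemma act_signof: "act (signof p * P) F \<gamma> = signof p * act P F \<gamma>"
  by (auto simp: sign_def act_uminus)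

lemma act_alternant:
  "act (alternant k mpvar e) F \<gamma> = (\<Sum>p | p permutes {..<k}. signof p * F (\<lambda>i. \<gamma> i + (if i < k then int (e (inv_into UNIV p i)) else 0)))"
proof -
  have "act (\<Prod>j<k. mpvar (p j) ^ e j) F \<gamma> = F (\<lambda>i. \<gamma> i + (if i < k then int (e (inv_into UNIV p i)) else 0))"
    if p: "p permutes {..<k}" for p
  proof -
    have "lookup (\<Sum>j<k. single (p j) (e j)) i = (if i < k then e (inv_into UNIV p i) else 0)" for i
    proof -
      have "lookup (\<Sum>j<k. single (p j) (e j)) i = (\<Sum>j<k. if j = inv_into UNIV p i then e j else 0)"
        unfolding lookup_sum lookup_single when_def
        using permutes_inverses[OF p] by (intro sum.cong) auto
      also have "\<dots> = (if inv_into UNIV p i < k then e (inv_into UNIV p i) else 0)" by simp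
      also have "inv_into UNIV p i < k \<longleftrightarrow> i < k" using permutes_in_image[OF permutes_inv[OF p], of i] by simp
      finally show ?thesis .
    qed
    then show ?thesis
      unfolding mpvar_power prod_single_one act_single
      by (auto intro!: arg_cong[where f = F] simp: fun_eq_iff)
  qed
  then show ?thesis by (simp add: alternant_expand act_sum act_signof)
qed

section \<open>Exponentials of commuting operators\<close>

lemma cmul_mult: "cmul c g = single 0 c * g" for g :: symf
  unfolding cmul_def by (rule mult_map_scale_conv_mult)

lemma cmul_mult_left: "cmul c g * h = cmul c (g * h)" for g h :: symf
  by (simp add: cmul_mult mult.assoc)

lemma cmul_mult_right: "g * cmul c h = cmul c (g * h)" for g h :: symf
  by (simp add: cmul_mult mult.left_commute)

lemma cmul_single: "cmul c (single \<alpha> a) = single \<alpha> (c * a)"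
  by (rule poly_mapping_eqI) (simp add: lookup_cmul lookup_single when_def)

lemma cmul_of_nat: "cmul (of_nat n) g = of_nat n * g" for g :: symf
  by (simp add: cmul_mult)

lemma cmul_of_int: "cmul (of_int n) g = of_int n * g" for g :: symf
  by (simp add: cmul_mult)

lemma cmul_zero_right [simp]: "cmul c 0 = 0"
  by (rule CV.scale_zero_right)

lemma cmul_cancel_of_nat: "r > 0 \<Longrightarrow> cmul (of_nat r) x = cmul (of_nat r) y \<Longrightarrow> x = y" for x y :: symf
  by (simp add: CV.scale_left_imp_eq)

text \<open>The sum of \<open>A\<^bsub>j\<^sub>1\<^esub> \<cdots> A\<^bsub>j\<^sub>l\<^esub> g\<close> over the compositions of \<open>r\<close> into \<open>l\<close> positive parts.\<close>

primrec comp_sum :: "(nat \<Rightarrow> symf \<Rightarrow> symf) \<Rightarrow> symf \<Rightarrow> nat \<Rightarrow> nat \<Rightarrow> symf" where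
  "comp_sum A g 0 r = (if r = 0 then g else 0)"
| "comp_sum A g (Suc l) r = (\<Sum>j\<in>{1..r}. A j (comp_sum A g l (r - j)))"

locale linear_family =
  fixes A :: "nat \<Rightarrow> symf \<Rightarrow> symf"
  assumes A_add: "A j (f + g) = A j f + A j g"
    and A_cmul: "A j (cmul c f) = cmul c (A j f)"
begin

lemma A_zero [simp]: "A j 0 = 0"
  using A_cmul[of j 0 0] by simp

lemma A_sum: "A j (\<Sum>i\<in>I. f i) = (\<Sum>i\<in>I. A j (f i))"
  by (induction I rule: infinite_finite_induct) (simp_all add: A_add)

lemma sum_compositions:
  "finite {js. 0 \<notin> set js \<and> length js = l \<and> sum_list js = r} \<and>
   (\<Sum>js\<in>{js. 0 \<notin> set js \<and> length js = l \<and> sum_list js = r}. foldr A js g) = comp_sum A g l r"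
proof (induction l arbitrary: r)
  case 0
  have "{js :: nat list. 0 \<notin> set js \<and> length js = 0 \<and> sum_list js = r} = (if r = 0 then {[]} else {})" by auto
  then show ?case by simp
next
  case (Suc l)
  let ?C = "\<lambda>l r. {js :: nat list. 0 \<notin> set js \<and> length js = l \<and> sum_list js = r}"
  have eq: "?C (Suc l) r = (\<Union>j\<in>{1..r}. (#) j ` ?C l (r - j))"
  proof (rule subset_antisym; rule subsetI)
    fix js assume "js \<in> ?C (Suc l) r"
    then obtain j js' where js: "js = j # js'" "0 \<notin> set js'" "j \<noteq> 0" "length js' = l" "j + sum_list js' = r"
      by (cases js) auto
    then have "j \<in> {1..r}" "js' \<in> ?C l (r - j)" by auto
    then show "js \<in> (\<Union>j\<in>{1..r}. (#) j ` ?C l (r - j))" using js(1) by blast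
  next
    fix js assume "js \<in> (\<Union>j\<in>{1..r}. (#) j ` ?C l (r - j))"
    then show "js \<in> ?C (Suc l) r" by auto
  qed
  have "(\<Sum>js\<in>?C (Suc l) r. foldr A js g) = (\<Sum>j\<in>{1..r}. \<Sum>js\<in>(#) j ` ?C l (r - j). foldr A js g)"
    unfolding eq by (rule sum.UNION_disjoint) (use Suc.IH in auto)
  also have "\<dots> = (\<Sum>j\<in>{1..r}. \<Sum>js\<in>?C l (r - j). A j (foldr A js g))"
    by (rule sum.cong[OF refl], subst sum.reindex) (auto simp: o_def)
  also have "\<dots> = comp_sum A g (Suc l) r"
    using Suc.IH by (simp add: A_sum[symmetric] del: One_nat_def)
  finally show ?case unfolding eq using Suc.IH by auto
qed

lemma exp_coeff_comp_sum:
  assumes "r \<le> n"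
  shows "exp_coeff A r g = (\<Sum>l\<le>n. cmul (1 / fact l) (comp_sum A g l r))"
proof -
  let ?C = "\<lambda>l. {js :: nat list. 0 \<notin> set js \<and> length js = l \<and> sum_list js = r}"
  have len: "length js \<le> sum_list js" if "0 \<notin> set js" for js :: "nat list"
    using that by (induction js) (auto simp: Suc_le_eq)
  have eq: "{js. 0 \<notin> set js \<and> sum_list js = r} = (\<Union>l\<in>{..n}. ?C l)"
    using len assms by fastforce
  have "exp_coeff A r g = (\<Sum>l\<le>n. \<Sum>js\<in>?C l. cmul (1 / fact (length js)) (foldr A js g))"
    unfolding exp_coeff_def eq by (rule sum.UNION_disjoint) (use sum_compositions in auto)
  also have "\<dots> = (\<Sum>l\<le>n. cmul (1 / fact l) (\<Sum>js\<in>?C l. foldr A js g))"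
    by (intro sum.cong refl) (simp add: CV.scale_sum_right)
  finally show ?thesis using sum_compositions by simp
qed

lemma exp_coeff_0 [simp]: "exp_coeff A 0 g = g"
  by (subst exp_coeff_comp_sum[of 0 0]) simp_all

lemma foldr_add: "foldr A js (f + g) = foldr A js f + foldr A js g"
  by (induction js) (simp_all add: A_add)

lemma foldr_cmul: "foldr A js (cmul c f) = cmul c (foldr A js f)"
  by (induction js) (simp_all add: A_cmul)

lemma exp_coeff_add: "exp_coeff A r (f + g) = exp_coeff A r f + exp_coeff A r g"
  by (simp add: exp_coeff_def foldr_add CV.scale_right_distrib sum.distrib)

lemma exp_coeff_cmul: "exp_coeff A r (cmul c f) = cmul c (exp_coeff A r f)"
  by (simp add: exp_coeff_def foldr_cmul CV.scale_sum_right mult.commute)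

lemma exp_coeff_zero [simp]: "exp_coeff A r 0 = 0"
  using exp_coeff_cmul[of r 0 0] by simp

end

locale commuting_family = linear_family +
  assumes A_commute: "A i (A j f) = A j (A i f)"
begin

lemma sum_triangle_swap:
  fixes \<phi> :: "nat \<Rightarrow> nat \<Rightarrow> nat \<Rightarrow> 'b::comm_monoid_add"
  shows "(\<Sum>j\<in>{1..r}. \<Sum>i\<in>{1..r - j}. \<phi> j i (r - j - i)) = (\<Sum>i\<in>{1..r}. \<Sum>j\<in>{1..r - i}. \<phi> j i (r - i - j))"
proof -
  have "(\<Sum>j\<in>{1..r}. \<Sum>i\<in>{1..r - j}. \<phi> j i (r - j - i)) = (\<Sum>(j, i)\<in>Sigma {1..r} (\<lambda>j. {1..r - j}). \<phi> j i (r - j - i))"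
    by (rule sum.Sigma) auto
  also have "\<dots> = (\<Sum>(i, j)\<in>Sigma {1..r} (\<lambda>i. {1..r - i}). \<phi> j i (r - i - j))"
    by (rule sum.reindex_bij_witness[where i = prod.swap and j = prod.swap]) (auto simp: add.commute)
  also have "\<dots> = (\<Sum>i\<in>{1..r}. \<Sum>j\<in>{1..r - i}. \<phi> j i (r - i - j))"
    by (rule sum.Sigma[symmetric]) auto
  finally show ?thesis .
qed

text \<open>The identity \<open>z d/dz (\<Sum>\<^sub>j z\<^sup>j A\<^sub>j)\<^bsup>l+1\<^esup> = (l + 1) (\<Sum>\<^sub>j j z\<^sup>j A\<^sub>j) (\<Sum>\<^sub>j z\<^sup>j A\<^sub>j)\<^sup>l\<close>, coefficient by coefficient;
it is here that the operators have to commute.\<close>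

lemma comp_sum_euler:
  "cmul (of_nat r) (comp_sum A g (Suc l) r) =
     cmul (of_nat (Suc l)) (\<Sum>j\<in>{1..r}. cmul (of_nat j) (A j (comp_sum A g l (r - j))))"
proof (induction l arbitrary: r)
  case 0
  show ?case
    by (simp add: CV.scale_sum_right if_distrib cong: if_cong del: One_nat_def)
       (auto intro!: sum.cong simp del: One_nat_def)
next
  case (Suc l)
  let ?Y = "comp_sum A g"
  have "cmul (of_nat r) (?Y (Suc (Suc l)) r) = (\<Sum>j\<in>{1..r}. cmul (of_nat r) (A j (?Y (Suc l) (r - j))))"
    by (simp add: CV.scale_sum_right del: One_nat_def)
  also have "\<dots> = (\<Sum>j\<in>{1..r}. cmul (of_nat j) (A j (?Y (Suc l) (r - j))) + A j (cmul (of_nat (r - j)) (?Y (Suc l) (r - j))))"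
  proof (intro sum.cong refl)
    fix j assume "j \<in> {1..r}"
    then have "of_nat r = (of_nat j + of_nat (r - j) :: complex)" by (simp add: of_nat_diff)
    then show "cmul (of_nat r) (A j (?Y (Suc l) (r - j))) = cmul (of_nat j) (A j (?Y (Suc l) (r - j))) + A j (cmul (of_nat (r - j)) (?Y (Suc l) (r - j)))"
      by (simp only: CV.scale_left_distrib A_cmul)
  qed
  also have "\<dots> = (\<Sum>j\<in>{1..r}. cmul (of_nat j) (A j (?Y (Suc l) (r - j)))) +
      cmul (of_nat (Suc l)) (\<Sum>j\<in>{1..r}. \<Sum>i\<in>{1..r - j}. cmul (of_nat i) (A j (A i (?Y l (r - j - i)))))"
    by (simp only: Suc.IH sum.distrib A_cmul A_sum CV.scale_sum_right)
  also have "(\<Sum>j\<in>{1..r}. \<Sum>i\<in>{1..r - j}. cmul (of_nat i) (A j (A i (?Y l (r - j - i)))))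
     = (\<Sum>i\<in>{1..r}. \<Sum>j\<in>{1..r - i}. cmul (of_nat i) (A i (A j (?Y l (r - i - j)))))"
    by (subst sum_triangle_swap) (simp only: A_commute)
  also have "\<dots> = (\<Sum>i\<in>{1..r}. cmul (of_nat i) (A i (?Y (Suc l) (r - i))))"
    by (simp add: CV.scale_sum_right A_sum del: One_nat_def)
  finally show ?case
    by (simp only: of_nat_Suc[of "Suc l"] CV.scale_left_distrib CV.scale_one add.commute)
qed

text \<open>The differential equation of the exponential.  With \<open>exp_coeff A 0 g = g\<close> it determines all coefficients,
and the properties of \<open>\<Gamma>\<^sub>\<plusminus>\<close> below follow from it by induction on the degree.\<close>

lemma exp_coeff_euler:
  "cmul (of_nat r) (exp_coeff A r g) = (\<Sum>j\<in>{1..r}. cmul (of_nat j) (A j (exp_coeff A (r - j) g)))"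
proof (cases r)
  case (Suc n)
  let ?Y = "comp_sum A g"
  have "cmul (of_nat r) (exp_coeff A r g) = (\<Sum>l\<le>Suc n. cmul (1 / fact l) (cmul (of_nat r) (?Y l r)))"
    by (subst exp_coeff_comp_sum[of r "Suc n"])
       (simp_all only: Suc order_refl CV.scale_sum_right CV.scale_scale mult.commute)
  also have "\<dots> = (\<Sum>l\<le>n. cmul (1 / fact (Suc l)) (cmul (of_nat r) (?Y (Suc l) r)))"
    by (simp only: sum.atMost_Suc_shift) (simp add: Suc del: comp_sum.simps(2))
  also have "\<dots> = (\<Sum>l\<le>n. cmul (1 / fact l) (\<Sum>j\<in>{1..r}. cmul (of_nat j) (A j (?Y l (r - j)))))"
  proof (intro sum.cong refl)
    fix l
    have "1 / fact (Suc l) * of_nat (Suc l) = (1 / fact l :: complex)"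
      by (simp add: fact_Suc field_simps del: of_nat_Suc)
    then show "cmul (1 / fact (Suc l)) (cmul (of_nat r) (?Y (Suc l) r)) = cmul (1 / fact l) (\<Sum>j\<in>{1..r}. cmul (of_nat j) (A j (?Y l (r - j))))"
      unfolding comp_sum_euler by (simp only: CV.scale_scale)
  qed
  also have "\<dots> = (\<Sum>j\<in>{1..r}. cmul (of_nat j) (A j (\<Sum>l\<le>n. cmul (1 / fact l) (?Y l (r - j)))))"
    by (simp only: CV.scale_sum_right A_sum A_cmul CV.scale_scale mult.commute) (rule sum.swap)
  also have "\<dots> = (\<Sum>j\<in>{1..r}. cmul (of_nat j) (A j (exp_coeff A (r - j) g)))"
    by (intro sum.cong refl, subst exp_coeff_comp_sum[of _ n]) (auto simp: Suc)
  finally show ?thesis .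
qed simp

end

section \<open>Derivations and complete symmetric functions\<close>

lemma dpsum_superset:
  assumes "finite S" "keys g \<subseteq> S"
  shows "dpsum j g = (\<Sum>\<alpha>\<in>S. single (\<alpha> - single (j - 1) 1)
       (of_nat (lookup \<alpha> (j - 1)) * lookup g \<alpha>))"
  unfolding dpsum_def using assms by (intro sum.mono_neutral_left) (auto simp: in_keys_iff)

lemma dpsum_add: "dpsum j (f + g) = dpsum j f + dpsum j g"
proof -
  let ?S = "keys f \<union> keys g"
  show ?thesis
    using dpsum_superset[of ?S f j] dpsum_superset[of ?S g j] dpsum_superset[of ?S "f + g" j] Poly_Mapping.keys_add[of f g]
    by (simp add: lookup_add distrib_left single_add sum.distrib)
qed

lemma dpsum_cmul: "dpsum j (cmul c f) = cmul c (dpsum j f)"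
proof -
  have "keys (cmul c f) \<subseteq> keys f" by (auto simp: in_keys_iff lookup_cmul)
  then show ?thesis
    by (subst dpsum_superset[of "keys f"])
       (simp_all add: dpsum_def CV.scale_sum_right cmul_single lookup_cmul mult.left_commute)
qed

lemma dpsum_zero [simp]: "dpsum j 0 = 0" by (simp add: dpsum_def)

lemma dpsum_sum: "dpsum j (\<Sum>i\<in>I. f i) = (\<Sum>i\<in>I. dpsum j (f i))"
  by (induction I rule: infinite_finite_induct) (simp_all add: dpsum_add)

lemma dpsum_single: "dpsum j (single \<alpha> c) =
   single (\<alpha> - single (j - 1) 1) (of_nat (lookup \<alpha> (j - 1)) * c)"
  by (cases "c = 0") (simp_all add: dpsum_def)

lemma dpsum_mult: "dpsum j (f * g) = dpsum j f * g + f * dpsum j g"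
proof -
  have single: "dpsum j (single \<alpha> a * single \<beta> b) =
    dpsum j (single \<alpha> a) * single \<beta> b + single \<alpha> a * dpsum j (single \<beta> b)"
    for \<alpha> \<beta> a b
  proof -
    let ?e = "single (j - 1) (1::nat)"
    let ?l = "\<lambda>\<alpha>. lookup \<alpha> (j - 1)"
    have 1: "(\<alpha> - ?e) + \<beta> = \<alpha> + \<beta> - ?e" if "?l \<alpha> \<noteq> 0" for \<alpha> \<beta> :: "nat \<Rightarrow>\<^sub>0 nat"
      using that by (intro poly_mapping_eqI) (auto simp: lookup_add lookup_minus lookup_single when_def)
    have "single ((\<alpha> - ?e) + \<beta>) (of_nat (?l \<alpha>) * a * b) = single (\<alpha> + \<beta> - ?e) (of_nat (?l \<alpha>) * a * b)"
      using 1[of \<alpha> \<beta>] by (cases "?l \<alpha> = 0") auto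
    moreover have "single (\<alpha> + (\<beta> - ?e)) (a * (of_nat (?l \<beta>) * b)) = single (\<alpha> + \<beta> - ?e) (a * (of_nat (?l \<beta>) * b))"
      using 1[of \<beta> \<alpha>] by (cases "?l \<beta> = 0") (auto simp: add.commute)
    ultimately show ?thesis
      by (simp add: dpsum_single mult_single lookup_add single_add[symmetric] algebra_simps)
  qed
  have "dpsum j (f * single \<beta> b) = dpsum j f * single \<beta> b + f * dpsum j (single \<beta> b)" for \<beta> b
    by (subst (1 2 3) poly_mapping_sum_single[of f]) (simp only: sum_distrib_right dpsum_sum single sum.distrib)
  then show ?thesis
    by (subst (1 2 3) poly_mapping_sum_single[of g]) (simp only: sum_distrib_left dpsum_sum sum.distrib)
qed

lemma dpsum_commute: "dpsum i (dpsum j f) = dpsum j (dpsum i f)"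
proof -
  have "dpsum i (dpsum j (single \<alpha> a)) = dpsum j (dpsum i (single \<alpha> a))" for \<alpha> a
  proof -
    have "\<alpha> - x - y = \<alpha> - y - x" for x y :: "nat \<Rightarrow>\<^sub>0 nat"
      by (simp only: diff_diff_eq add.commute)
    then show ?thesis
      by (cases "i - 1 = j - 1") (auto simp: dpsum_single lookup_minus lookup_single when_def mult_ac)
  qed
  then show ?thesis
    by (subst (1 2) poly_mapping_sum_single[of f]) (simp only: dpsum_sum)
qed

lemma dpsum_one [simp]: "dpsum j 1 = 0"
  using dpsum_single[of j 0 1] by simp

lemma dpsum_psum: "1 \<le> i \<Longrightarrow> 1 \<le> j \<Longrightarrow> dpsum j (psum i) = (if i = j then 1 else 0)"
  by (auto simp: psum_def dpsum_single lookup_single when_def)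

interpretation mult_family: commuting_family "\<lambda>j g. cmul (1 / of_nat j) (psum j * g)"
  by unfold_locales (simp_all add: distrib_left CV.scale_right_distrib cmul_mult_right CV.scale_left_commute mult.left_commute)

interpretation diff_family: commuting_family "\<lambda>j g. cmul (- 2 * 1) (dpsum j g)"
proof unfold_locales
  fix i j and c :: complex and f g :: symf
  show "cmul (- 2 * 1) (dpsum j (f + g)) = cmul (- 2 * 1) (dpsum j f) + cmul (- 2 * 1) (dpsum j g)"
    by (simp only: dpsum_add CV.scale_right_distrib)
  show "cmul (- 2 * 1) (dpsum j (cmul c f)) = cmul c (cmul (- 2 * 1) (dpsum j f))"
    unfolding dpsum_cmul by (rule CV.scale_left_commute)
  show "cmul (- 2 * 1) (dpsum i (cmul (- 2 * 1) (dpsum j f))) = cmul (- 2 * 1) (dpsum j (cmul (- 2 * 1) (dpsum i f)))"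
    unfolding dpsum_cmul dpsum_commute[of i j] ..
qed

lemma complete_h_neg [simp]: "r < 0 \<Longrightarrow> hf r = 0"
  by (simp add: complete_h_def)

lemma complete_h_0 [simp]: "hf 0 = 1"
  by (simp add: complete_h_def)

lemma newton_identity:
  "of_nat n * hf (int n) = (\<Sum>j\<in>{1..n}. psum j * hf (int n - int j))"
proof -
  have "cmul (of_nat n) (hf (int n)) = (\<Sum>j\<in>{1..n}. cmul (of_nat j) (cmul (1 / of_nat j) (psum j * hf (int n - int j))))"
  proof -
    have ch: "hf (int m) = exp_coeff (\<lambda>j g. cmul (1 / of_nat j) (psum j * g)) m 1" for m
      by (simp add: complete_h_def)
    have "hf (int n - int j) = exp_coeff (\<lambda>j g. cmul (1 / of_nat j) (psum j * g)) (n - j) 1" if "j \<in> {1..n}" for j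
    proof -
      have "int n - int j = int (n - j)" using that by (simp add: of_nat_diff)
      then show ?thesis by (simp only: ch)
    qed
    then show ?thesis unfolding ch mult_family.exp_coeff_euler[of n 1] by (intro sum.cong refl) (simp only:)
  qed
  also have "\<dots> = (\<Sum>j\<in>{1..n}. psum j * hf (int n - int j))"
    by (intro sum.cong refl) simp
  finally show ?thesis by (simp only: cmul_of_nat)
qed

lemma gamma_minus_complete_h: "gamma_minus 1 r g = hf (int r) * g"
proof -
  have "foldr (\<lambda>j g. cmul (1 / of_nat j) (psum j * g)) js g = foldr (\<lambda>j g. cmul (1 / of_nat j) (psum j * g)) js 1 * g" for js
    by (induction js) (simp_all add: cmul_mult_left mult.assoc)
  then show ?thesis
    unfolding gamma_minus_def complete_h_def exp_coeff_def
    by (simp add: sum_distrib_right cmul_mult_left)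
qed

text \<open>Differentiating \<open>\<Sum>\<^sub>r h\<^sub>r z\<^sup>r = exp (\<Sum>\<^sub>j z\<^sup>j p\<^sub>j / j)\<close> by \<open>p\<^sub>j\<close> multiplies it by \<open>z\<^sup>j / j\<close>; the proof runs through
Newton's identity instead.\<close>

lemma dpsum_complete_h:
  assumes "1 \<le> j"
  shows "dpsum j (hf n) = cmul (1 / of_nat j) (hf (n - int j))"
proof -
  have "dpsum j (hf (int n)) = cmul (1 / of_nat j) (hf (int n - int j))" for n
  proof (induction n rule: less_induct)
    case (less n)
    show ?case
    proof (cases "n = 0")
      case True
      then show ?thesis using assms by simp
    next
      case False
      have shift: "(\<Sum>i\<in>{1..n}. psum i * hf (int n - int j - int i)) = (if j \<le> n then of_nat (n - j) * hf (int n - int j) else 0)"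
      proof (cases "j \<le> n")
        case True
        then have "(\<Sum>i\<in>{1..n}. psum i * hf (int n - int j - int i)) = (\<Sum>i\<in>{1..n - j}. psum i * hf (int (n - j) - int i))"
          by (intro sum.mono_neutral_cong_right) auto
        then show ?thesis using True newton_identity[of "n - j"] by (simp add: of_nat_diff)
      qed (auto intro!: sum.neutral)
      have "cmul (of_nat n) (dpsum j (hf (int n))) = dpsum j (cmul (of_nat n) (hf (int n)))"
        by (simp only: dpsum_cmul)
      also have "\<dots> = (\<Sum>i\<in>{1..n}. dpsum j (psum i) * hf (int n - int i) + psum i * dpsum j (hf (int n - int i)))"
        by (simp only: cmul_of_nat newton_identity dpsum_sum dpsum_mult)
      also have "\<dots> = (\<Sum>i\<in>{1..n}. (if i = j then hf (int n - int j) else 0) + cmul (1 / of_nat j) (psum i * hf (int n - int j - int i)))"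
      proof (intro sum.cong refl)
        fix i assume i: "i \<in> {1..n}"
        then have "dpsum j (hf (int n - int i)) = cmul (1 / of_nat j) (hf (int n - int j - int i))"
          using less[of "n - i"] by (simp add: of_nat_diff algebra_simps)
        then show "dpsum j (psum i) * hf (int n - int i) + psum i * dpsum j (hf (int n - int i))
            = (if i = j then hf (int n - int j) else 0) + cmul (1 / of_nat j) (psum i * hf (int n - int j - int i))"
          using i assms by (simp add: dpsum_psum cmul_mult_right)
      qed
      also have "\<dots> = (if j \<le> n then hf (int n - int j) else 0) + cmul (1 / of_nat j) (if j \<le> n then of_nat (n - j) * hf (int n - int j) else 0)"
        using assms by (simp only: sum.distrib CV.scale_sum_right[symmetric] shift) (simp add: sum.delta')
      also have "\<dots> = cmul (of_nat n) (cmul (1 / of_nat j) (hf (int n - int j)))"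
      proof (cases "j \<le> n")
        case True
        have "(1 :: complex) + 1 / of_nat j * of_nat (n - j) = of_nat n * (1 / of_nat j)"
          using True assms by (simp add: of_nat_diff field_simps)
        then have "cmul (1 + 1 / of_nat j * of_nat (n - j)) (hf (int n - int j)) = cmul (of_nat n) (cmul (1 / of_nat j) (hf (int n - int j)))"
          by (simp only: CV.scale_scale)
        then show ?thesis using True by (simp only: CV.scale_left_distrib CV.scale_one CV.scale_scale[symmetric] cmul_of_nat if_True)
      qed simp
      finally show ?thesis by (rule cmul_cancel_of_nat[rotated]) (use False in simp)
    qed
  qed
  then show ?thesis
  proof (cases "n < 0")
    case False
    then show ?thesis using \<open>\<And>n. dpsum j (hf (int n)) = _ n\<close>[of "nat n"] by simp
  qed simp
qed

section \<open>Words of vertex operators\<close>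

abbreviation Gam :: "nat \<Rightarrow> symf \<Rightarrow> symf" where "Gam \<equiv> gamma_plus 1"

lemma Gam_euler: "cmul (of_nat s) (Gam s g) = (\<Sum>j\<in>{1..s}. cmul (of_nat j) (cmul (- 2 * 1) (dpsum j (Gam (s - j) g))))"
  unfolding gamma_plus_def by (rule diff_family.exp_coeff_euler)

lemma Gam_0 [simp]: "Gam 0 g = g"
  unfolding gamma_plus_def by (rule diff_family.exp_coeff_0)

lemma Gam_add: "Gam s (f + g) = Gam s f + Gam s g"
  unfolding gamma_plus_def by (rule diff_family.exp_coeff_add)

lemma Gam_cmul: "Gam s (cmul c f) = cmul c (Gam s f)"
  unfolding gamma_plus_def by (rule diff_family.exp_coeff_cmul)

lemma Gam_zero [simp]: "Gam s 0 = 0"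
  unfolding gamma_plus_def by (rule diff_family.exp_coeff_zero)

lemma sum_triangle_left:
  fixes \<phi> :: "nat \<Rightarrow> nat \<Rightarrow> nat \<Rightarrow> 'b::comm_monoid_add"
  shows "(\<Sum>i\<le>s. \<Sum>j\<in>{1..i}. \<phi> j (i - j) (s - i)) = (\<Sum>j\<in>{1..s}. \<Sum>i\<le>s - j. \<phi> j i (s - j - i))"
proof -
  have "(\<Sum>i\<le>s. \<Sum>j\<in>{1..i}. \<phi> j (i - j) (s - i)) = (\<Sum>(i, j)\<in>Sigma {..s} (\<lambda>i. {1..i}). \<phi> j (i - j) (s - i))"
    by (rule sum.Sigma) auto
  also have "\<dots> = (\<Sum>(j, i)\<in>Sigma {1..s} (\<lambda>j. {..s - j}). \<phi> j i (s - j - i))"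
    by (rule sum.reindex_bij_witness[where i = "\<lambda>(j, i). (i + j, j)" and j = "\<lambda>(i, j). (j, i - j)"]) auto
  also have "\<dots> = (\<Sum>j\<in>{1..s}. \<Sum>i\<le>s - j. \<phi> j i (s - j - i))"
    by (rule sum.Sigma[symmetric]) auto
  finally show ?thesis .
qed

lemma sum_triangle_right:
  fixes \<phi> :: "nat \<Rightarrow> nat \<Rightarrow> nat \<Rightarrow> 'b::comm_monoid_add"
  shows "(\<Sum>i\<le>s. \<Sum>j\<in>{1..s - i}. \<phi> j i (s - i - j)) = (\<Sum>j\<in>{1..s}. \<Sum>i\<le>s - j. \<phi> j i (s - j - i))"
proof -
  have "(\<Sum>i\<le>s. \<Sum>j\<in>{1..s - i}. \<phi> j i (s - i - j)) = (\<Sum>(i, j)\<in>Sigma {..s} (\<lambda>i. {1..s - i}). \<phi> j i (s - i - j))"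
    by (rule sum.Sigma) auto
  also have "\<dots> = (\<Sum>(j, i)\<in>Sigma {1..s} (\<lambda>j. {..s - j}). \<phi> j i (s - j - i))"
    by (rule sum.reindex_bij_witness[where i = prod.swap and j = prod.swap]) (auto simp: add.commute)
  also have "\<dots> = (\<Sum>j\<in>{1..s}. \<Sum>i\<le>s - j. \<phi> j i (s - j - i))"
    by (rule sum.Sigma[symmetric]) auto
  finally show ?thesis .
qed

text \<open>The exponential of a derivation is multiplicative: both sides satisfy \<open>Gam_euler\<close>.\<close>

lemma Gam_mult: "Gam s (f * g) = (\<Sum>i\<le>s. Gam i f * Gam (s - i) g)"
proof (induction s rule: less_induct)
  case (less s)
  show ?case
  proof (cases "s = 0")
    case False
    let ?D = "\<lambda>j g. cmul (- 2 * 1) (dpsum j g)"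
    have D: "cmul (of_nat j) (?D j (x * y)) = cmul (of_nat j) (?D j x) * y + x * cmul (of_nat j) (?D j y)" for j x y
      by (simp only: dpsum_mult CV.scale_right_distrib cmul_mult_left cmul_mult_right)
    have Dsum: "cmul (of_nat j) (?D j (\<Sum>i\<in>I. x i)) = (\<Sum>i\<in>I. cmul (of_nat j) (?D j (x i)))" for j x and I :: "nat set"
      by (simp only: dpsum_sum CV.scale_sum_right)
    have split: "cmul (of_nat s) (x * y) = cmul (of_nat i) x * y + x * cmul (of_nat (s - i)) y" if "i \<le> s" for i and x y :: symf
    proof -
      have "of_nat s = (of_nat i + of_nat (s - i) :: complex)" using that by (simp add: of_nat_diff)
      then show ?thesis by (simp only: CV.scale_left_distrib cmul_mult_left cmul_mult_right)
    qed
    have "cmul (of_nat s) (Gam s (f * g)) = (\<Sum>j\<in>{1..s}. cmul (of_nat j) (?D j (\<Sum>i\<le>s - j. Gam i f * Gam (s - j - i) g)))"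
      unfolding Gam_euler[of s "f * g"] using less.IH False by (intro sum.cong refl) auto
    also have "\<dots> = (\<Sum>j\<in>{1..s}. \<Sum>i\<le>s - j. cmul (of_nat j) (?D j (Gam i f)) * Gam (s - j - i) g) +
        (\<Sum>j\<in>{1..s}. \<Sum>i\<le>s - j. Gam i f * cmul (of_nat j) (?D j (Gam (s - j - i) g)))"
      by (simp only: Dsum D sum.distrib)
    also have "\<dots> = (\<Sum>i\<le>s. \<Sum>j\<in>{1..i}. cmul (of_nat j) (?D j (Gam (i - j) f)) * Gam (s - i) g) +
        (\<Sum>i\<le>s. \<Sum>j\<in>{1..s - i}. Gam i f * cmul (of_nat j) (?D j (Gam (s - i - j) g)))"
      unfolding sum_triangle_left[of "\<lambda>j i l. cmul (of_nat j) (?D j (Gam i f)) * Gam l g"]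
        sum_triangle_right[of "\<lambda>j i l. Gam i f * cmul (of_nat j) (?D j (Gam l g))"] ..
    also have "\<dots> = (\<Sum>i\<le>s. cmul (of_nat i) (Gam i f) * Gam (s - i) g) + (\<Sum>i\<le>s. Gam i f * cmul (of_nat (s - i)) (Gam (s - i) g))"
      by (simp only: sum_distrib_right[symmetric] sum_distrib_left[symmetric] Gam_euler[symmetric])
    also have "\<dots> = (\<Sum>i\<le>s. cmul (of_nat s) (Gam i f * Gam (s - i) g))"
      unfolding sum.distrib[symmetric] by (intro sum.cong refl split[symmetric]) simp
    also have "\<dots> = cmul (of_nat s) (\<Sum>i\<le>s. Gam i f * Gam (s - i) g)"
      by (simp only: CV.scale_sum_right)
    finally show ?thesis by (rule cmul_cancel_of_nat[rotated]) (use False in simp)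
  qed simp
qed

text \<open>The coefficients of \<open>(1 - z)\<^sup>2\<close>.\<close>

definition sq_coeff :: "nat \<Rightarrow> complex" where
  "sq_coeff s = (if s = 0 then 1 else if s = 1 then - 2 else if s = 2 then 1 else 0)"

lemma sq_coeff_euler: "(\<Sum>j\<in>{1..s}. - 2 * sq_coeff (s - j)) = of_nat s * sq_coeff s"
proof -
  have "(\<Sum>j\<in>{1..s}. - 2 * sq_coeff (s - j)) = (\<Sum>i<s. - 2 * sq_coeff i)"
    by (rule sum.reindex_bij_witness[where i = "\<lambda>i. s - i" and j = "\<lambda>j. s - j"]) auto
  also have "\<dots> = of_nat s * sq_coeff s"
    by (induction s) (auto simp: sq_coeff_def numeral_2_eq_2)
  finally show ?thesis .
qed

text \<open>This is \<open>\<Gamma>\<^sub>+(z) H(w) = (1 - z w)\<^sup>2 H(w)\<close> for \<open>H(w) = \<Sum>\<^sub>r h\<^sub>r w\<^sup>r\<close>.\<close>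

lemma Gam_complete_h: "Gam s (hf n) = cmul (sq_coeff s) (hf (n - int s))"
proof (induction s rule: less_induct)
  case (less s)
  show ?case
  proof (cases "s = 0")
    case False
    have "cmul (of_nat s) (Gam s (hf n)) = (\<Sum>j\<in>{1..s}. cmul (- 2 * sq_coeff (s - j)) (hf (n - int s)))"
      unfolding Gam_euler
    proof (rule sum.cong[OF refl])
      fix j assume j: "j \<in> {1..s}"
      have "n - int (s - j) - int j = n - int s" using j by (simp add: of_nat_diff)
      moreover have "Gam (s - j) (hf n) = cmul (sq_coeff (s - j)) (hf (n - int (s - j)))"
        using less.IH[of "s - j"] j by simp
      moreover have "of_nat j * (- 2 * 1 * (sq_coeff (s - j) * (1 / of_nat j))) = - 2 * sq_coeff (s - j)"
        using j by (simp add: field_simps)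
      moreover have "dpsum j (hf m) = cmul (1 / of_nat j) (hf (m - int j))" for m
        using dpsum_complete_h[of j m] j by simp
      ultimately show "cmul (of_nat j) (cmul (- 2 * 1) (dpsum j (Gam (s - j) (hf n)))) = cmul (- 2 * sq_coeff (s - j)) (hf (n - int s))"
        by (simp only: dpsum_cmul CV.scale_scale)
    qed
    also have "\<dots> = cmul (of_nat s) (cmul (sq_coeff s) (hf (n - int s)))"
      by (simp only: CV.scale_sum_left[symmetric] sq_coeff_euler CV.scale_scale)
    finally show ?thesis by (rule cmul_cancel_of_nat[rotated]) (use False in simp)
  qed (simp add: sq_coeff_def)
qed

text \<open>A bound on the number of terms in the sum over \<open>s\<close> that defines a coefficient of the vertex operator; without one,
\<^const>\<open>Sum_any\<close> is not additive.\<close>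

definition killed_from :: "nat \<Rightarrow> symf \<Rightarrow> bool" where
  "killed_from N g \<longleftrightarrow> (\<forall>s\<ge>N. Gam s g = 0)"

lemma Gam_mult_complete_h:
  "Gam s (g * hf r) = Gam s g * hf r
     - 2 * (if s \<ge> 1 then Gam (s - 1) g * hf (r - 1) else 0)
     + (if s \<ge> 2 then Gam (s - 2) g * hf (r - 2) else 0)"
proof -
  let ?t = "\<lambda>i. Gam (s - i) g * cmul (sq_coeff i) (hf (r - int i))"
  have "Gam s (g * hf r) = (\<Sum>i\<le>s. ?t i)"
    unfolding Gam_mult Gam_complete_h
    by (rule sum.reindex_bij_witness[where i = "\<lambda>i. s - i" and j = "\<lambda>i. s - i"]) auto
  also have "\<dots> = (\<Sum>i\<in>{0, 1, 2} \<inter> {..s}. ?t i)"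
    by (rule sum.mono_neutral_right) (auto simp: sq_coeff_def)
  also have "\<dots> = (\<Sum>i\<in>{0, 1, 2}. if i \<le> s then ?t i else 0)"
    by (simp add: sum.inter_restrict)
  also have "\<dots> = Gam s g * hf r
     - 2 * (if s \<ge> 1 then Gam (s - 1) g * hf (r - 1) else 0)
     + (if s \<ge> 2 then Gam (s - 2) g * hf (r - 2) else 0)"
    using cmul_of_int[of "- 2" "hf (r - 1)"] by (simp add: sq_coeff_def)
  finally show ?thesis .
qed

lemma killed_from_mono: "killed_from N g \<Longrightarrow> N \<le> M \<Longrightarrow> killed_from M g"
  by (auto simp: killed_from_def)

lemma killed_from_mult_complete_h: "killed_from N g \<Longrightarrow> killed_from (N + 2) (g * hf r)"
  by (auto simp: killed_from_def Gam_mult_complete_h)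

lemma killed_from_one: "killed_from 1 1"
  unfolding killed_from_def
proof (intro allI impI)
  fix s :: nat assume "1 \<le> s"
  then show "Gam s 1 = 0" using Gam_complete_h[of s 0] by simp
qed

lemma killed_from_prod_complete_h: "killed_from (2 * k + 1) (\<Prod>i<k. hf (\<gamma> i))"
proof (induction k)
  case 0 then show ?case using killed_from_one by simp
next
  case (Suc k)
  then show ?case using killed_from_mult_complete_h[OF Suc] by simp
qed

text \<open>The coefficient of \<open>z\<^bsup>-e\<^esup>\<close> in \<open>\<Gamma>\<^sub>-(z) \<Gamma>\<^sub>+(z)\<close>.  The sign is chosen so that \<open>e\<close> is the index of the new
factor \<open>h\<close>, on which \<open>z\<close> acts as a raising variable like the others.\<close>

definition vcoeff :: "int \<Rightarrow> symf \<Rightarrow> symf" where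
  "vcoeff e g = Sum_any (\<lambda>s. hf (int s + e) * Gam s g)"

lemma vertex_vcoeff: "vertex 1 d g = vcoeff (- d) g"
proof -
  have "(if d \<le> int s then gamma_minus 1 (nat (int s - d)) (Gam s g) else 0) = hf (int s + - d) * Gam s g" for s
    by (simp add: gamma_minus_complete_h)
  then show ?thesis unfolding vertex_def vcoeff_def by simp
qed

lemma vcoeff_eq_sum:
  assumes "killed_from N g"
  shows "vcoeff e g = (\<Sum>s<N. hf (int s + e) * Gam s g)"
  unfolding vcoeff_def
proof (rule Sum_any.expand_superset)
  show "{s. hf (int s + e) * Gam s g \<noteq> 0} \<subseteq> {..<N}"
  proof
    fix s assume "s \<in> {s. hf (int s + e) * Gam s g \<noteq> 0}"
    then have "Gam s g \<noteq> 0" by auto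
    then show "s \<in> {..<N}" using assms by (auto simp: killed_from_def not_le[symmetric])
  qed
qed simp

lemma vcoeff_zero [simp]: "vcoeff e 0 = 0"
  using vcoeff_eq_sum[of 0 0 e] by (simp add: killed_from_def)

lemma vcoeff_mult_complete_h:
  assumes "killed_from N g"
  shows "vcoeff e (g * hf r) = vcoeff e g * hf r - 2 * (vcoeff (e + 1) g * hf (r - 1)) + vcoeff (e + 2) g * hf (r - 2)"
proof -
  let ?H = hf
  have v: "vcoeff e' g = (\<Sum>s<N. ?H (int s + e') * Gam s g)" for e' by (rule vcoeff_eq_sum[OF assms])
  have N2: "vcoeff e' g = (\<Sum>s<N + 2. ?H (int s + e') * Gam s g)" for e'
    by (rule vcoeff_eq_sum[OF killed_from_mono[OF assms]]) simp
  have N1: "vcoeff e' g = (\<Sum>s<N + 1. ?H (int s + e') * Gam s g)" for e'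
    by (rule vcoeff_eq_sum[OF killed_from_mono[OF assms]]) simp
  have s1: "(\<Sum>s<N + 2. ?H (int s + e) * (if s \<ge> 1 then Gam (s - 1) g * ?H (r - 1) else 0)) = vcoeff (e + 1) g * ?H (r - 1)"
  proof -
    have "(\<Sum>s<N + 2. ?H (int s + e) * (if s \<ge> 1 then Gam (s - 1) g * ?H (r - 1) else 0)) = (\<Sum>s<Suc (N + 1). ?H (int s + e) * (if s \<ge> 1 then Gam (s - 1) g * ?H (r - 1) else 0))"
      by simp
    also have "\<dots> = (\<Sum>s<N + 1. ?H (int (Suc s) + e) * (Gam s g * ?H (r - 1)))"
      by (subst sum.lessThan_Suc_shift) simp
    also have "\<dots> = vcoeff (e + 1) g * ?H (r - 1)"
      unfolding N1 sum_distrib_right by (intro sum.cong refl) (simp add: ac_simps)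
    finally show ?thesis .
  qed
  have s2: "(\<Sum>s<N + 2. ?H (int s + e) * (if s \<ge> 2 then Gam (s - 2) g * ?H (r - 2) else 0)) = vcoeff (e + 2) g * ?H (r - 2)"
  proof -
    have "(\<Sum>s<N + 2. ?H (int s + e) * (if s \<ge> 2 then Gam (s - 2) g * ?H (r - 2) else 0)) = (\<Sum>s<Suc (Suc N). ?H (int s + e) * (if s \<ge> 2 then Gam (s - 2) g * ?H (r - 2) else 0))"
      by simp
    also have "\<dots> = (\<Sum>s<N. ?H (int (Suc (Suc s)) + e) * (Gam s g * ?H (r - 2)))"
      unfolding sum.lessThan_Suc_shift[of _ "Suc N"] sum.lessThan_Suc_shift[of _ N] by simp
    also have "\<dots> = vcoeff (e + 2) g * ?H (r - 2)"
      unfolding v sum_distrib_right by (intro sum.cong refl) (simp add: ac_simps)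
    finally show ?thesis .
  qed
  have "vcoeff e (g * ?H r) = (\<Sum>s<N + 2. ?H (int s + e) * Gam s (g * ?H r))"
    by (rule vcoeff_eq_sum[OF killed_from_mult_complete_h[OF assms]])
  also have "\<dots> = (\<Sum>s<N + 2. ?H (int s + e) * Gam s g * ?H r
      - 2 * (?H (int s + e) * (if s \<ge> 1 then Gam (s - 1) g * ?H (r - 1) else 0))
      + ?H (int s + e) * (if s \<ge> 2 then Gam (s - 2) g * ?H (r - 2) else 0))"
    unfolding Gam_mult_complete_h by (intro sum.cong refl) (simp only: algebra_simps)
  also have "\<dots> = vcoeff e g * ?H r - 2 * (vcoeff (e + 1) g * ?H (r - 1)) + vcoeff (e + 2) g * ?H (r - 2)"
    unfolding sum.distrib sum_subtractf sum_distrib_left[symmetric] s1 s2 N2[of e] sum_distrib_right[symmetric] ..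
  finally show ?thesis .
qed

lemma vcoeff_add: "killed_from N f \<Longrightarrow> killed_from N g \<Longrightarrow> vcoeff e (f + g) = vcoeff e f + vcoeff e g"
  using vcoeff_eq_sum[of N "f + g" e] by (simp add: vcoeff_eq_sum killed_from_def Gam_add distrib_left sum.distrib)

lemma vcoeff_cmul: "killed_from N f \<Longrightarrow> vcoeff e (cmul c f) = cmul c (vcoeff e f)"
  using vcoeff_eq_sum[of N "cmul c f" e]
  by (simp add: vcoeff_eq_sum killed_from_def Gam_cmul CV.scale_sum_right cmul_mult_right)

lemma killed_from_sum: "(\<And>i. i \<in> I \<Longrightarrow> killed_from N (f i)) \<Longrightarrow> killed_from N (\<Sum>i\<in>I. f i)"
  by (induction I rule: infinite_finite_induct) (auto simp: killed_from_def Gam_add)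

lemma killed_from_cmul: "killed_from N f \<Longrightarrow> killed_from N (cmul c f)"
  by (auto simp: killed_from_def Gam_cmul)

lemma vcoeff_act:
  assumes "\<And>\<delta>. killed_from N (F \<delta>)"
  shows "vcoeff e (act P F \<gamma>) = act P (\<lambda>\<delta>. vcoeff e (F \<delta>)) \<gamma>"
proof -
  have "vcoeff e (\<Sum>\<alpha>\<in>S. cmul (c \<alpha>) (F (d \<alpha>))) = (\<Sum>\<alpha>\<in>S. cmul (c \<alpha>) (vcoeff e (F (d \<alpha>))))" for S c and d :: "(nat \<Rightarrow>\<^sub>0 nat) \<Rightarrow> _"
  proof (induction S rule: infinite_finite_induct)
    case (insert \<alpha> S)
    have "killed_from N (cmul (c \<alpha>) (F (d \<alpha>)))" "killed_from N (\<Sum>\<alpha>\<in>S. cmul (c \<alpha>) (F (d \<alpha>)))"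
      by (auto intro!: killed_from_cmul killed_from_sum assms)
    then show ?case using insert by (simp add: vcoeff_add vcoeff_cmul[OF assms])
  qed simp_all
  then show ?thesis unfolding act_def by simp
qed

text \<open>A factor that does not see the variables of a polynomial is a constant for its action.\<close>

lemma act_indep:
  assumes "\<And>i v \<delta>. i \<in> I \<Longrightarrow> G (\<delta>(i := v)) = G \<delta>"
    and "J \<subseteq> I \<times> I"
  shows "act (\<Prod>(a, b)\<in>J. (mpvar a - mpvar b)\<^sup>2) (\<lambda>\<delta>. F \<delta> * G \<delta>) \<gamma> = act (\<Prod>(a, b)\<in>J. (mpvar a - mpvar b)\<^sup>2) F \<gamma> * G \<gamma>"
proof -
  define ind where "ind P \<longleftrightarrow> (\<forall>F \<gamma>. act P (\<lambda>\<delta>. F \<delta> * G \<delta>) \<gamma> = act P F \<gamma> * G \<gamma>)" for P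
  have mult: "ind P \<Longrightarrow> ind Q \<Longrightarrow> ind (P * Q)" for P Q
  proof -
    assume P: "ind P" and Q: "ind Q"
    have "act Q (\<lambda>\<delta>. F \<delta> * G \<delta>) = (\<lambda>\<delta>. act Q F \<delta> * G \<delta>)" for F
      using Q by (intro ext) (simp add: ind_def)
    then show "ind (P * Q)" using P by (simp add: ind_def act_mult)
  qed
  have diff: "ind P \<Longrightarrow> ind Q \<Longrightarrow> ind (P - Q)" for P Q
    by (simp add: ind_def act_diff left_diff_distrib)
  have var: "ind (mpvar i)" if "i \<in> I" for i
    using assms(1)[OF that] by (simp add: ind_def act_mpvar)
  have "ind (\<Prod>(a, b)\<in>J. (mpvar a - mpvar b)\<^sup>2)"
    using assms(2)
  proof (induction J rule: infinite_finite_induct)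
    case (insert x J)
    then show ?case by (auto simp: power2_eq_square split: prod.splits intro!: mult diff var)
  qed (simp_all add: ind_def)
  then show ?thesis by (simp add: ind_def)
qed

text \<open>The action of a polynomial commutes with every reindexing that is equivariant in its variables.\<close>

lemma act_transport:
  assumes "\<And>i \<delta>. i \<in> I \<Longrightarrow> T (\<delta>(i := \<delta> i + 1)) = (T \<delta>)(i := T \<delta> i + 1)"
    and "J \<subseteq> I \<times> I"
  shows "act (\<Prod>(a, b)\<in>J. (mpvar a - mpvar b)\<^sup>2) (\<lambda>\<delta>. F (T \<delta>)) \<gamma> = act (\<Prod>(a, b)\<in>J. (mpvar a - mpvar b)\<^sup>2) F (T \<gamma>)"
proof -
  define tr where "tr P \<longleftrightarrow> (\<forall>F \<gamma>. act P (\<lambda>\<delta>. F (T \<delta>)) \<gamma> = act P F (T \<gamma>))" for P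
  have mult: "tr P \<Longrightarrow> tr Q \<Longrightarrow> tr (P * Q)" for P Q
  proof -
    assume P: "tr P" and Q: "tr Q"
    have "act Q (\<lambda>\<delta>. F (T \<delta>)) = (\<lambda>\<delta>. act Q F (T \<delta>))" for F
      using Q by (intro ext) (simp add: tr_def)
    then show "tr (P * Q)" using P by (simp add: tr_def act_mult)
  qed
  have diff: "tr P \<Longrightarrow> tr Q \<Longrightarrow> tr (P - Q)" for P Q
    by (simp add: tr_def act_diff)
  have var: "tr (mpvar i)" if "i \<in> I" for i
    using assms(1)[OF that] by (simp add: tr_def act_mpvar)
  have "tr (\<Prod>(a, b)\<in>J. (mpvar a - mpvar b)\<^sup>2)"
    using assms(2)
  proof (induction J rule: infinite_finite_induct)
    case (insert x J)
    then show ?case by (auto simp: power2_eq_square split: prod.splits intro!: mult diff var)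
  qed (simp_all add: tr_def)
  then show ?thesis by (simp add: tr_def)
qed

lemma act_square_diff:
  assumes "i \<noteq> j"
  shows "act ((mpvar i - mpvar j)\<^sup>2) F \<gamma> = F (\<gamma>(i := \<gamma> i + 2)) - 2 * F (\<gamma>(i := \<gamma> i + 1, j := \<gamma> j + 1)) + F (\<gamma>(j := \<gamma> j + 2))"
proof -
  have sq: "(mpvar i - mpvar j)\<^sup>2 = (mpvar i * mpvar i - mpvar i * mpvar j - mpvar i * mpvar j + mpvar j * mpvar j :: complex mpoly)"
    by (simp add: power2_eq_square algebra_simps)
  show ?thesis
    unfolding sq act_diff act_add act_mult act_mpvar using assms by (simp add: fun_upd_twist add.assoc)
qed

text \<open>Applying the vertex operator to a product of \<open>k\<close> factors \<open>h\<close> adds a factor with the new variable \<open>x\<^sub>K\<close> and multiplies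
by \<open>\<Prod>\<^bsub>i<k\<^esub> (1 - x\<^sub>K / x\<^sub>i)\<^sup>2\<close>.  The denominators are absorbed in the shift by \<open>2\<close>.\<close>

lemma vcoeff_prod_complete_h:
  assumes "k \<le> K"
  shows "act (\<Prod>(a, b)\<in>{..<k} \<times> {K}. (mpvar a - mpvar b)\<^sup>2) (\<lambda>\<delta>. (\<Prod>i<k. hf (\<delta> i)) * hf (\<delta> K)) \<gamma>
    = vcoeff (\<gamma> K) (\<Prod>i<k. hf (\<gamma> i + 2))"
  using assms
proof (induction k arbitrary: \<gamma>)
  case 0
  then show ?case using vcoeff_eq_sum[OF killed_from_one] by simp
next
  case (Suc k)
  let ?Q = "\<Prod>(a, b)\<in>{..<k} \<times> {K}. (mpvar a - mpvar b)\<^sup>2 :: complex mpoly"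
  have K: "k < K" using Suc.prems by simp
  have Q: "(\<Prod>(a, b)\<in>{..<Suc k} \<times> {K}. (mpvar a - mpvar b)\<^sup>2 :: complex mpoly) = (mpvar k - mpvar K)\<^sup>2 * ?Q"
  proof -
    have "{..<Suc k} \<times> {K} = insert (k, K) ({..<k} \<times> {K})" by auto
    then show ?thesis by simp
  qed
  have IH: "act ?Q (\<lambda>\<delta>. (\<Prod>i<Suc k. hf (\<delta> i)) * hf (\<delta> K)) \<delta> = vcoeff (\<delta> K) (\<Prod>i<k. hf (\<delta> i + 2)) * hf (\<delta> k)" for \<delta>
  proof -
    have "act ?Q (\<lambda>\<delta>. ((\<Prod>i<k. hf (\<delta> i)) * hf (\<delta> K)) * hf (\<delta> k)) \<delta> = act ?Q (\<lambda>\<delta>. (\<Prod>i<k. hf (\<delta> i)) * hf (\<delta> K)) \<delta> * hf (\<delta> k)"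
      by (rule act_indep[where I = "insert K {..<k}"]) (use K in auto)
    then show ?thesis using Suc.IH K by (simp add: mult_ac)
  qed
  define G where "G = (\<Prod>i<k. hf (\<gamma> i + 2))"
  define R where "R \<delta> = vcoeff (\<delta> K) (\<Prod>i<k. hf (\<delta> i + 2)) * hf (\<delta> k)" for \<delta>
  have prodG: "(\<Prod>i<k. hf (\<delta> i + 2)) = G" if "\<And>i. i < k \<Longrightarrow> \<delta> i = \<gamma> i" for \<delta>
    unfolding G_def by (rule prod.cong) (simp_all add: that)
  have R: "R \<delta> = vcoeff (\<delta> K) G * hf (\<delta> k)" if "\<And>i. i < k \<Longrightarrow> \<delta> i = \<gamma> i" for \<delta>
    unfolding R_def using prodG[OF that] by simp
  have "act ((mpvar k - mpvar K)\<^sup>2 * ?Q) (\<lambda>\<delta>. (\<Prod>i<Suc k. hf (\<delta> i)) * hf (\<delta> K)) \<gamma>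
    = vcoeff (\<gamma> K) (\<Prod>i<k. hf (\<gamma> i + 2)) * hf (\<gamma> k + 2)
      - 2 * (vcoeff (\<gamma> K + 1) (\<Prod>i<k. hf (\<gamma> i + 2)) * hf (\<gamma> k + 1))
      + vcoeff (\<gamma> K + 2) (\<Prod>i<k. hf (\<gamma> i + 2)) * hf (\<gamma> k)"
  proof -
    have "act ((mpvar k - mpvar K)\<^sup>2 * ?Q) (\<lambda>\<delta>. (\<Prod>i<Suc k. hf (\<delta> i)) * hf (\<delta> K)) \<gamma> = act ((mpvar k - mpvar K)\<^sup>2) R \<gamma>"
      unfolding act_mult by (rule arg_cong[where f = "\<lambda>F. act _ F _"]) (intro ext, simp only: IH R_def)
    also have "\<dots> = R (\<gamma>(k := \<gamma> k + 2)) - 2 * R (\<gamma>(k := \<gamma> k + 1, K := \<gamma> K + 1)) + R (\<gamma>(K := \<gamma> K + 2))"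
      by (rule act_square_diff) (use K in simp)
    also have "R (\<gamma>(k := \<gamma> k + 2)) = vcoeff (\<gamma> K) G * hf (\<gamma> k + 2)"
      using K by (subst R) auto
    also have "R (\<gamma>(k := \<gamma> k + 1, K := \<gamma> K + 1)) = vcoeff (\<gamma> K + 1) G * hf (\<gamma> k + 1)"
      using K by (subst R) auto
    also have "R (\<gamma>(K := \<gamma> K + 2)) = vcoeff (\<gamma> K + 2) G * hf (\<gamma> k)"
      using K by (subst R) auto
    finally show ?thesis unfolding G_def .
  qed
  also have "\<dots> = vcoeff (\<gamma> K) ((\<Prod>i<k. hf (\<gamma> i + 2)) * hf (\<gamma> k + 2))"
    by (subst vcoeff_mult_complete_h[OF killed_from_prod_complete_h]) (simp add: algebra_simps)
  finally show ?case unfolding Q by simp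
qed

definition vandermonde_sq :: "nat \<Rightarrow> complex mpoly" where
  "vandermonde_sq k = (\<Prod>(a, b)\<in>{(a, b). a < b \<and> b < k}. (mpvar a - mpvar b)\<^sup>2)"

lemma finite_pairs [simp]: "finite {(a :: nat, b). a < b \<and> b < k}"
  by (rule finite_subset[of _ "{..<k} \<times> {..<k}"]) auto

lemma vandermonde_sq_Suc:
  "vandermonde_sq (Suc k) = vandermonde_sq k * (\<Prod>(a, b)\<in>{..<k} \<times> {k}. (mpvar a - mpvar b)\<^sup>2)"
proof -
  have "{(a, b). a < b \<and> b < Suc k} = {(a, b). a < b \<and> b < k} \<union> {..<k} \<times> {k}" by auto
  then show ?thesis unfolding vandermonde_sq_def
    by (simp only:) (rule prod.union_disjoint, auto)
qed

lemma vandermonde_sq_eq: "vandermonde_sq k = vandermonde k mpvar * vandermonde k mpvar"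
proof (induction k)
  case (Suc k)
  have "(\<Prod>(a, b)\<in>{..<k} \<times> {k}. (mpvar a - mpvar b)\<^sup>2 :: complex mpoly) = (\<Prod>a<k. mpvar a - mpvar k) * (\<Prod>a<k. mpvar a - mpvar k)"
    by (subst prod.cartesian_product[symmetric]) (simp add: power2_eq_square prod.distrib)
  then show ?case using Suc by (simp add: vandermonde_sq_Suc vandermonde_def mult_ac)
qed (simp add: vandermonde_sq_def vandermonde_def)

text \<open>Up to the shift of indices in \<open>e_word\<close>, the symmetric function that a word of \<open>k\<close> operators \<open>e\<^bsub>-m\<^esub>\<close>
creates from a vacuum.\<close>

definition word_symf :: "nat \<Rightarrow> (nat \<Rightarrow> int) \<Rightarrow> symf" where
  "word_symf k = act (vandermonde_sq k) (\<lambda>\<delta>. \<Prod>i<k. hf (\<delta> i))"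

lemma word_symf_cong: "(\<And>i. i < k \<Longrightarrow> \<gamma> i = \<gamma>' i) \<Longrightarrow> word_symf k \<gamma> = word_symf k \<gamma>'"
  unfolding word_symf_def act_def by (intro sum.cong refl arg_cong[where f = "cmul _"] prod.cong) auto

lemma vcoeff_word_symf: "vcoeff e (word_symf k \<gamma>) = word_symf (Suc k) (\<lambda>i. if i < k then \<gamma> i - 2 else e)"
proof -
  let ?T = "\<lambda>\<delta> i. if i < k then \<delta> i - 2 else e"
  let ?F = "\<lambda>\<delta>. (\<Prod>i<k. hf (\<delta> i)) * hf (\<delta> k)"
  let ?Q = "\<Prod>(a, b)\<in>{..<k} \<times> {k}. (mpvar a - mpvar b)\<^sup>2 :: complex mpoly"
  have "vcoeff e (word_symf k \<gamma>) = act (vandermonde_sq k) (\<lambda>\<delta>. vcoeff e (\<Prod>i<k. hf (\<delta> i))) \<gamma>"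
    unfolding word_symf_def by (rule vcoeff_act[OF killed_from_prod_complete_h])
  also have "(\<lambda>\<delta>. vcoeff e (\<Prod>i<k. hf (\<delta> i))) = (\<lambda>\<delta>. act ?Q ?F (?T \<delta>))"
    using vcoeff_prod_complete_h[of k k "?T _"] by (auto simp: fun_eq_iff)
  also have "act (vandermonde_sq k) (\<lambda>\<delta>. act ?Q ?F (?T \<delta>)) \<gamma> = act (vandermonde_sq k) (act ?Q ?F) (?T \<gamma>)"
    unfolding vandermonde_sq_def by (rule act_transport[where I = "{..<k}"]) (auto simp: fun_eq_iff)
  also have "\<dots> = word_symf (Suc k) (?T \<gamma>)"
    by (simp add: word_symf_def vandermonde_sq_Suc act_mult)
  finally show ?thesis .
qed

lemma e_op_single: "e_op m (single a g) = single (a + 1) (vcoeff (m + 1 - 2 * (a + 1)) g)"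
  by (cases "g = 0") (simp_all add: e_op_def vertex_vcoeff algebra_simps)

text \<open>Variable \<open>i\<close> belongs to the \<open>i\<close>-th operator applied, hence the reversal.  Each further operator lowers the
indices of the earlier ones by \<open>2\<close>, which is the dependence on the length of the word.\<close>

lemma e_word:
  "foldr (\<lambda>m. e_op (- m)) ms (vac (- int n)) =
     single (int (length ms) - int n)
       (word_symf (length ms) (\<lambda>i. 1 - rev ms ! i + 2 * (int n - int (length ms))))"
proof (induction ms)
  case Nil
  have "word_symf 0 \<gamma> = 1" for \<gamma> by (simp add: word_symf_def vandermonde_sq_def)
  then show ?case by (simp add: vac_def)
next
  case (Cons m ms)
  let ?k = "length ms"
  have "foldr (\<lambda>m. e_op (- m)) (m # ms) (vac (- int n)) = single (int ?k - int n + 1)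
     (vcoeff (- m + 1 - 2 * (int ?k - int n + 1)) (word_symf ?k (\<lambda>i. 1 - rev ms ! i + 2 * (int n - int ?k))))"
    using Cons by (simp add: e_op_single)
  also have "vcoeff (- m + 1 - 2 * (int ?k - int n + 1)) (word_symf ?k (\<lambda>i. 1 - rev ms ! i + 2 * (int n - int ?k)))
     = word_symf (Suc ?k) (\<lambda>i. 1 - rev (m # ms) ! i + 2 * (int n - int (Suc ?k)))"
    unfolding vcoeff_word_symf by (rule word_symf_cong) (auto simp: nth_append less_Suc_eq)
  finally show ?case by (simp add: algebra_simps)
qed

section \<open>Words as sums of Jacobi-Trudi determinants\<close>

text \<open>Row \<open>i\<close> starts with \<open>h\<close> of index \<open>g i\<close>, so permuting \<open>g\<close> permutes rows; for a partition \<open>\<nu>\<close> one takes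
\<open>g i = \<nu>\<^sub>i - i\<close>.\<close>

definition jtdet :: "nat \<Rightarrow> (nat \<Rightarrow> int) \<Rightarrow> symf" where
  "jtdet k g = det (mat k k (\<lambda>(i, j). hf (g i + int j)))"

lemma schur_jtdet: "schur l = jtdet (length l) (\<lambda>i. int (l ! i) - int i)"
  by (simp add: schur_def jtdet_def)

lemma jtdet_cong: "(\<And>i. i < k \<Longrightarrow> g i = g' i) \<Longrightarrow> jtdet k g = jtdet k g'"
  unfolding jtdet_def by (intro arg_cong[where f = det] cong_mat) auto

lemma jtdet_permute:
  assumes "p permutes {..<k}"
  shows "jtdet k (\<lambda>i. g (p i)) = signof p * jtdet k g"
proof -
  have "jtdet k (\<lambda>i. g (p i)) = det (mat k k (\<lambda>(i, j). mat k k (\<lambda>(i, j). hf (g i + int j)) $$ (p i, j)))"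
    unfolding jtdet_def using permutes_in_image[OF assms]
    by (intro arg_cong[where f = det] cong_mat) auto
  also have "\<dots> = signof p * jtdet k g"
    unfolding jtdet_def by (rule det_permute_rows) (use assms in \<open>auto simp: atLeast0LessThan\<close>)
  finally show ?thesis .
qed

lemma jtdet_expand: "jtdet k g = (\<Sum>p | p permutes {..<k}. signof p * (\<Prod>i<k. hf (g i + int (p i))))"
  unfolding jtdet_def
  by (subst det_def'[where n = k]) (auto simp: atLeast0LessThan permutes_in_image intro!: sum.cong prod.cong)

definition reversal :: "nat \<Rightarrow> nat \<Rightarrow> nat" where
  "reversal k i = (if i < k then k - 1 - i else i)"

lemma reversal_permutes: "reversal k permutes {..<k}"
  by (rule bij_imp_permutes) (auto simp: reversal_def intro!: bij_betwI[where g = "reversal k"])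

lemma vandermonde_pairs: "vandermonde k x = (\<Prod>(a, b)\<in>{(a, b). a < b \<and> b < k}. x a - x b)"
proof -
  have "vandermonde k x = (\<Prod>(b, a)\<in>Sigma {..<k} (\<lambda>b. {..<b}). x a - x b)"
    unfolding vandermonde_def by (rule prod.Sigma) auto
  also have "\<dots> = (\<Prod>(a, b)\<in>{(a, b). a < b \<and> b < k}. x a - x b)"
    by (rule prod.reindex_bij_witness[where i = prod.swap and j = prod.swap]) auto
  finally show ?thesis .
qed

lemma card_pairs: "card {(a :: nat, b). a < b \<and> b < k} = k * (k - 1) div 2"
proof -
  have "card {(a :: nat, b). a < b \<and> b < k} = card (Sigma {..<k} (\<lambda>b. {..<b}))"
    by (rule bij_betw_same_card[of prod.swap]) (auto intro!: bij_betwI[where g = prod.swap])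
  also have "\<dots> = (\<Sum>b<k. b)" by (simp add: card_SigmaI)
  also have "\<dots> = k * (k - 1) div 2"
    using Sum_Ico_nat[of 0 k] by (simp add: atLeast0LessThan)
  finally show ?thesis .
qed

text \<open>Reversing the variables multiplies the Vandermonde product by this sign, but also by \<open>-1\<close> for each of its factors.\<close>

lemma sign_reversal: "sign (reversal k) = (- 1) ^ (k * (k - 1) div 2)"
proof -
  let ?V = "vandermonde k (mpvar :: nat \<Rightarrow> complex mpoly)"
  let ?x = "mpvar :: nat \<Rightarrow> complex mpoly"
  have "signof (reversal k) * ?V = vandermonde k (\<lambda>i. ?x (reversal k i))"
    by (rule vandermonde_permute[OF reversal_permutes, symmetric])
  also have "\<dots> = (\<Prod>(a, b)\<in>{(a, b). a < b \<and> b < k}. (- 1) * (?x a - ?x b))"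
    unfolding vandermonde_pairs
    by (rule prod.reindex_bij_witness[where i = "\<lambda>(a, b). (reversal k b, reversal k a)" and j = "\<lambda>(a, b). (reversal k b, reversal k a)"])
       (auto simp: reversal_def)
  also have "\<dots> = (- 1) ^ (k * (k - 1) div 2) * ?V"
  proof -
    define P where "P = {(a :: nat, b). a < b \<and> b < k}"
    have "card P = k * (k - 1) div 2" by (simp add: P_def card_pairs)
    then show ?thesis
      unfolding vandermonde_pairs P_def[symmetric] case_prod_beta prod.distrib by simp
  qed
  finally have "(of_int (sign (reversal k)) :: complex mpoly) = of_int ((- 1) ^ (k * (k - 1) div 2))"
    using vandermonde_mpvar_nonzero[of k, where 'a = complex] by simp
  then show ?thesis by (simp only: of_int_eq_iff)
qed

lemma sum_permutations_compose_left:
  assumes q: "q permutes S"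
  shows "sum f {p. p permutes S} = sum (\<lambda>p. f (q \<circ> p)) {p. p permutes S}"
  by (rule sum.reindex_bij_witness[where i = "\<lambda>p. q \<circ> p" and j = "\<lambda>p. inv_into UNIV q \<circ> p"])
     (auto simp: o_assoc permutes_inv_o[OF q] intro: permutes_compose permutes_inv[OF q] q)

abbreviation rsgn :: "nat \<Rightarrow> symf" where
  "rsgn k \<equiv> of_int (sign (reversal k))"

lemma sign_permutes:
  assumes "p permutes {..<k}" "q permutes {..<k}"
  shows "signof (p \<circ> q) = (signof p * signof q :: 'a::comm_ring_1)" "signof (inv_into UNIV p) = (signof p :: 'a)"
proof -
  have "permutation p" "permutation q"
    using assms by (auto intro: permutes_imp_permutation[rotated])
  then show "signof (p \<circ> q) = (signof p * signof q :: 'a)" "signof (inv_into UNIV p) = (signof p :: 'a)"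
    by (simp_all add: sign_compose sign_inverse)
qed

text \<open>The Leibniz expansion of the Vandermonde determinant, with decreasing exponents \<open>k - 1 - j\<close>, becomes the one of
the Jacobi-Trudi determinant, with increasing indices: this is where the sign of the theorem arises.\<close>

lemma act_vandermonde_h:
  "act (vandermonde k mpvar) (\<lambda>\<delta>. \<Prod>i<k. hf (\<delta> i)) \<gamma> = rsgn k * jtdet k \<gamma>"
proof -
  let ?P = "{p. p permutes {..<k}}"
  let ?f = "\<lambda>p. signof p * (\<Prod>i<k. hf (\<gamma> i + int (k - 1 - p i)))"
  have "act (vandermonde k mpvar) (\<lambda>\<delta>. \<Prod>i<k. hf (\<delta> i)) \<gamma>
    = (\<Sum>p\<in>?P. signof p * (\<Prod>i<k. hf (\<gamma> i + int (k - 1 - inv_into UNIV p i))))"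
    unfolding vandermonde_alternant act_alternant
    by (intro sum.cong refl arg_cong2[where f = "(*)"] prod.cong) auto
  also have "\<dots> = (\<Sum>p\<in>?P. ?f (inv_into UNIV p))"
    by (intro sum.cong refl) (simp add: sign_permutes(2))
  also have "\<dots> = (\<Sum>p\<in>?P. ?f p)"
    by (rule sum_permutations_inverse[symmetric])
  also have "\<dots> = (\<Sum>p\<in>?P. ?f (reversal k \<circ> p))"
    by (rule sum_permutations_compose_left[OF reversal_permutes])
  also have "\<dots> = (\<Sum>p\<in>?P. rsgn k * (signof p * (\<Prod>i<k. hf (\<gamma> i + int (p i)))))"
  proof (intro sum.cong refl)
    fix p assume p: "p \<in> ?P"
    have "(\<Prod>i<k. hf (\<gamma> i + int (k - 1 - (reversal k \<circ> p) i))) = (\<Prod>i<k. hf (\<gamma> i + int (p i)))"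
    proof (rule prod.cong[OF refl])
      fix i assume "i \<in> {..<k}"
      then have "p i < k" using p permutes_in_image[of p "{..<k}" i] by simp
      then have "k - 1 - (reversal k \<circ> p) i = p i" by (simp add: reversal_def)
      then show "hf (\<gamma> i + int (k - 1 - (reversal k \<circ> p) i)) = hf (\<gamma> i + int (p i))"
        by (simp only:)
    qed
    then show "?f (reversal k \<circ> p) = rsgn k * (signof p * (\<Prod>i<k. hf (\<gamma> i + int (p i))))"
      unfolding sign_permutes(1)[OF reversal_permutes p[simplified]] by (simp only: mult.assoc)
  qed
  also have "\<dots> = rsgn k * jtdet k \<gamma>" by (simp add: jtdet_expand sum_distrib_left)
  finally show ?thesis .
qed

lemma act_alternant_jtdet:
  "act (alternant k mpvar e) (\<lambda>\<gamma>. rsgn k * jtdet k \<gamma>) \<gamma> =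
    rsgn k * (\<Sum>p | p permutes {..<k}. signof p * jtdet k (\<lambda>i. \<gamma> i + int (e (inv_into UNIV p i))))"
proof -
  have "jtdet k (\<lambda>i. \<gamma> i + (if i < k then int (e (inv_into UNIV p i)) else 0)) = jtdet k (\<lambda>i. \<gamma> i + int (e (inv_into UNIV p i)))" for p
    by (rule jtdet_cong) simp
  then show ?thesis
    unfolding act_alternant sum_distrib_left by (simp only: mult.left_commute)
qed

text \<open>Of the two Vandermonde factors of the word, the first was used for the Jacobi-Trudi determinant; the signs of the
second one cancel against those from reordering the rows.\<close>

lemma word_symf_jtdet:
  "word_symf k (\<lambda>i. \<mu> i - int (k - 1)) = rsgn k * (\<Sum>p | p permutes {..<k}. jtdet k (\<lambda>i. \<mu> (p i) - int i))"
proof -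
  have "word_symf k (\<lambda>i. \<mu> i - int (k - 1)) =
     act (vandermonde k mpvar) (\<lambda>\<gamma>. rsgn k * jtdet k \<gamma>) (\<lambda>i. \<mu> i - int (k - 1))"
    unfolding word_symf_def vandermonde_sq_eq act_mult
    by (rule arg_cong[where f = "\<lambda>F. act _ F _"]) (intro ext act_vandermonde_h)
  also have "\<dots> = rsgn k * (\<Sum>p | p permutes {..<k}. signof p * jtdet k (\<lambda>i. \<mu> i - int (k - 1) + int (k - 1 - inv_into UNIV p i)))"
    unfolding vandermonde_alternant act_alternant_jtdet ..
  also have "(\<Sum>p | p permutes {..<k}. signof p * jtdet k (\<lambda>i. \<mu> i - int (k - 1) + int (k - 1 - inv_into UNIV p i)))
     = (\<Sum>p | p permutes {..<k}. jtdet k (\<lambda>i. \<mu> (p i) - int i))"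
  proof (rule sum.cong[OF refl])
    fix p assume "p \<in> {p. p permutes {..<k}}"
    then have p: "p permutes {..<k}" by simp
    have "jtdet k (\<lambda>i. \<mu> i - int (k - 1) + int (k - 1 - inv_into UNIV p i)) = jtdet k (\<lambda>i. (\<lambda>i. \<mu> (p i) - int i) (inv_into UNIV p i))"
    proof (rule jtdet_cong)
      fix i assume "i < k"
      then have "inv_into UNIV p i < k" using permutes_in_image[OF permutes_inv[OF p], of i] by simp
      then show "\<mu> i - int (k - 1) + int (k - 1 - inv_into UNIV p i) = \<mu> (p (inv_into UNIV p i)) - int (inv_into UNIV p i)"
        using permutes_inverses[OF p] by simp
    qed
    also have "\<dots> = signof p * jtdet k (\<lambda>i. \<mu> (p i) - int i)"
      by (subst jtdet_permute[OF permutes_inv[OF p]]) (simp add: sign_permutes(2)[OF p p])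
    finally show "signof p * jtdet k (\<lambda>i. \<mu> i - int (k - 1) + int (k - 1 - inv_into UNIV p i)) = jtdet k (\<lambda>i. \<mu> (p i) - int i)"
      by (simp add: mult.assoc[symmetric] signof_square)
  qed
  finally show ?thesis .
qed

lemma word_symf_permute:
  assumes "q permutes {..<k}"
  shows "word_symf k (\<lambda>i. \<mu> (q i) - int (k - 1)) = word_symf k (\<lambda>i. \<mu> i - int (k - 1))"
proof -
  have "(\<Sum>p | p permutes {..<k}. jtdet k (\<lambda>i. \<mu> (p i) - int i)) = (\<Sum>p | p permutes {..<k}. jtdet k (\<lambda>i. \<mu> ((q \<circ> p) i) - int i))"
    by (rule sum_permutations_compose_left[OF assms])
  then show ?thesis unfolding word_symf_jtdet[of k \<mu>] word_symf_jtdet[of k "\<lambda>i. \<mu> (q i)"] by simp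
qed

lemma rsgn_square: "rsgn k * rsgn k = 1"
  by (rule signof_square)

text \<open>The sum over tableaux is the action of the Schur polynomial \<open>s\<^sub>\<nu>(x)\<close>, which combines with one Vandermonde factor to
the alternant with exponents \<open>\<nu>\<^sub>j + k - 1 - j\<close>.  All \<open>k!\<close> terms of that alternant contribute equally, because
the Jacobi-Trudi determinant is alternating too.\<close>

lemma sum_ssyt_word_symf:
  assumes dec: "\<And>j. Suc j < k \<Longrightarrow> \<nu> (Suc j) \<le> \<nu> j"
  shows "(\<Sum>T\<in>ssyt k \<nu>. word_symf k (\<lambda>i. int (lookup (content k \<nu> T) i) - int (k - 1)))
     = rsgn k * (fact k * jtdet k (\<lambda>i. int (\<nu> i) - int i))"
proof -
  let ?\<gamma>0 = "\<lambda>i::nat. - int (k - 1)"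
  let ?V = "vandermonde k mpvar :: complex mpoly"
  let ?e = "\<lambda>j. \<nu> j + (k - 1 - j)"
  have "(\<Sum>T\<in>ssyt k \<nu>. word_symf k (\<lambda>i. int (lookup (content k \<nu> T) i) - int (k - 1)))
     = (\<Sum>T\<in>ssyt k \<nu>. act (single (content k \<nu> T) 1) (word_symf k) ?\<gamma>0)"
    by (simp add: act_single algebra_simps)
  also have "\<dots> = act (gt_sum k mpvar \<nu>) (word_symf k) ?\<gamma>0"
    unfolding act_sum[symmetric] by (subst gt_sum_content) (use dec in auto)
  also have "\<dots> = act (gt_sum k mpvar \<nu> * ?V) (act ?V (\<lambda>\<delta>. \<Prod>i<k. hf (\<delta> i))) ?\<gamma>0"
    unfolding word_symf_def vandermonde_sq_eq by (simp only: act_mult[symmetric] mult.assoc)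
  also have "gt_sum k mpvar \<nu> * ?V = alternant k mpvar ?e"
    by (rule bialternant[symmetric]) (rule dec)
  also have "act ?V (\<lambda>\<delta>. \<Prod>i<k. hf (\<delta> i)) = (\<lambda>\<gamma>. rsgn k * jtdet k \<gamma>)"
    by (intro ext act_vandermonde_h)
  also have "act (alternant k mpvar ?e) (\<lambda>\<gamma>. rsgn k * jtdet k \<gamma>) ?\<gamma>0
     = rsgn k * (\<Sum>p | p permutes {..<k}. signof p * jtdet k (\<lambda>i. - int (k - 1) + int (?e (inv_into UNIV p i))))"
    by (rule act_alternant_jtdet)
  also have "(\<Sum>p | p permutes {..<k}. signof p * jtdet k (\<lambda>i. - int (k - 1) + int (?e (inv_into UNIV p i))))
     = (\<Sum>p | p permutes {..<k}. jtdet k (\<lambda>i. int (\<nu> i) - int i))"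
  proof (rule sum.cong[OF refl])
    fix p assume "p \<in> {p. p permutes {..<k}}"
    then have p: "p permutes {..<k}" by simp
    have "jtdet k (\<lambda>i. - int (k - 1) + int (?e (inv_into UNIV p i))) = signof p * jtdet k (\<lambda>i. - int (k - 1) + int (?e i))"
      using jtdet_permute[OF permutes_inv[OF p], of "\<lambda>i. - int (k - 1) + int (?e i)"] sign_permutes(2)[OF p p, where 'a = symf]
      by simp
    also have "jtdet k (\<lambda>i. - int (k - 1) + int (?e i)) = jtdet k (\<lambda>i. int (\<nu> i) - int i)"
      by (rule jtdet_cong) auto
    finally show "signof p * jtdet k (\<lambda>i. - int (k - 1) + int (?e (inv_into UNIV p i))) = jtdet k (\<lambda>i. int (\<nu> i) - int i)"
      by (simp only: mult.assoc[symmetric] signof_square mult_1_left)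
  qed
  also have "\<dots> = fact k * jtdet k (\<lambda>i. int (\<nu> i) - int i)"
    by (simp add: card_permutations)
  finally show ?thesis .
qed

section \<open>Schur functions as sums of words\<close>

definition rect :: "nat \<Rightarrow> nat \<Rightarrow> nat list set" where
  "rect k c = {l. length l = k \<and> sorted_wrt (\<ge>) l \<and> (\<forall>x\<in>set l. x \<le> c)}"

lemma in_square_rect: "in_square k = rect k k"
  by (simp add: in_square_def rect_def)

lemma finite_rect [simp]: "finite (rect k c)"
proof (rule finite_subset)
  show "rect k c \<subseteq> {xs. set xs \<subseteq> {..c} \<and> length xs = k}" by (auto simp: rect_def)
qed (simp add: finite_lists_length_eq)

lemma rect_decreasing: "l \<in> rect k c \<Longrightarrow> Suc j < k \<Longrightarrow> l ! Suc j \<le> l ! j"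
  by (auto simp: rect_def sorted_wrt_iff_nth_less)

text \<open>A content with \<open>k\<close> parts forbids entries above \<open>k\<close>, so the bound in \<^const>\<open>ssyt\<close> is automatic.\<close>

lemma kostka_weight_count:
  assumes "length l = k" "length m = k"
  shows "kostka l m = weight_count k (\<lambda>i. l ! i) (\<lambda>i. m ! i)"
proof -
  have cells: "cells l = diagram k (\<lambda>i. l ! i)"
    using assms by (auto simp: cells_def diagram_def)
  let ?D = "diagram k (\<lambda>i. l ! i)"
  have "{T \<in> semistandard l. \<forall>i\<ge>1. card {c \<in> cells l. T c = i} = (if i \<le> length m then m ! (i - 1) else 0)}
    = {T\<in>ssyt k (\<lambda>i. l ! i). \<forall>i<k. card {c\<in>?D. T c = Suc i} = m ! i}"
    (is "?A = ?B")
  proof (rule subset_antisym; rule subsetI)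
    fix T assume T: "T \<in> ?A"
    have "T c \<le> k" if "c \<in> ?D" for c
    proof (rule ccontr)
      assume "\<not> T c \<le> k"
      then have "card {c' \<in> ?D. T c' = T c} = 0" using T assms by (auto simp: cells)
      then have "{c' \<in> ?D. T c' = T c} = {}" by (subst (asm) card_0_eq) auto
      then show False using that by blast
    qed
    moreover have "(i, j) \<in> ?D" if "(i, Suc j) \<in> ?D" for i j using that by (auto simp: diagram_def)
    moreover have "T (i, j) < T (Suc i, j)" if "(Suc i, j) \<in> ?D" for i j
      using T that by (cases "(i, j) \<in> ?D") (auto simp: semistandard_def cells Suc_le_eq)
    ultimately show "T \<in> ?B" using T assms by (auto simp: semistandard_def ssyt_def cells)
  next
    fix T assume T: "T \<in> ?B"
    have "card {c \<in> ?D. T c = i} = 0" if "i > k" for i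
    proof -
      have "{c \<in> ?D. T c = i} = {}" using T that by (force simp: ssyt_def)
      then show ?thesis by (simp only: card.empty)
    qed
    moreover have "card {c \<in> ?D. T c = i} = m ! (i - 1)" if "1 \<le> i" "i \<le> k" for i
      using T that by (cases i) auto
    moreover have "T \<in> semistandard l" using T by (auto simp: semistandard_def ssyt_def cells)
    ultimately show "T \<in> ?A" using assms by (auto simp: cells not_le)
  qed
  then show ?thesis by (simp add: kostka_def weight_count_def)
qed

lemma ssyt_column_strict:
  assumes T: "T \<in> ssyt k \<nu>" and dec: "\<And>j. Suc j < k \<Longrightarrow> \<nu> (Suc j) \<le> \<nu> j"
    and ab: "a < b" "b < k" "j < \<nu> b"
  shows "T (a, j) < T (b, j)"
  using ab
proof (induction b)
  case (Suc b)
  have 1: "T (b, j) < T (Suc b, j)" using T Suc.prems by (auto simp: ssyt_def diagram_def)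
  have "j < \<nu> b" using dec[of b] Suc.prems by auto
  then show ?case using 1 Suc by (cases "a = b") auto
qed simp

text \<open>Equal entries lie in different columns, of which there are at most \<open>c\<close>.\<close>

lemma content_le:
  assumes T: "T \<in> ssyt k \<nu>" and dec: "\<And>j. Suc j < k \<Longrightarrow> \<nu> (Suc j) \<le> \<nu> j"
    and c: "\<And>j. j < k \<Longrightarrow> \<nu> j \<le> c"
  shows "lookup (content k \<nu> T) i \<le> c"
proof -
  let ?S = "{x\<in>diagram k \<nu>. T x = Suc i}"
  have "inj_on snd ?S"
  proof (rule inj_onI)
    fix x y assume x: "x \<in> ?S" and y: "y \<in> ?S" and "snd x = snd y"
    then obtain a b j where xy: "x = (a, j)" "y = (b, j)" by (metis prod.collapse)
    have "a = b"
    proof (rule linorder_cases[of a b])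
      assume "a < b"
      then have "T (a, j) < T (b, j)"
        using x y xy dec by (intro ssyt_column_strict[OF T]) (auto simp: diagram_def)
      then show ?thesis using x y xy by simp
    next
      assume "b < a"
      then have "T (b, j) < T (a, j)"
        using x y xy dec by (intro ssyt_column_strict[OF T]) (auto simp: diagram_def)
      then show ?thesis using x y xy by simp
    qed
    then show "x = y" by (simp add: xy)
  qed
  moreover have "snd ` ?S \<subseteq> {..<c}" using c by (force simp: diagram_def)
  ultimately have "card ?S \<le> card {..<c}" by (intro card_inj_on_le) auto
  then show ?thesis by (simp add: lookup_content[OF T])
qed

text \<open>A partition \<open>\<mu>\<close> of the rectangle has \<open>k! / \<Prod>\<^sub>j r\<^sub>j!\<close> distinct rearrangements.\<close>

lemma sum_over_rect:
  fixes F :: "nat list \<Rightarrow> symf"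
  assumes "\<And>xs ys. mset xs = mset ys \<Longrightarrow> F xs = F ys"
  shows "(\<Sum>\<beta>\<in>{xs. set xs \<subseteq> {..c} \<and> length xs = k}. F \<beta>) =
     (\<Sum>\<mu>\<in>rect k c. cmul (fact k / (\<Prod>j\<le>c. fact (count_list \<mu> j))) (F \<mu>))"
proof -
  let ?B = "{xs. set xs \<subseteq> {..c} \<and> length xs = k}"
  have "(\<Sum>\<beta>\<in>?B. F \<beta>) = (\<Sum>\<mu>\<in>rect k c. \<Sum>\<beta>\<in>{\<beta>. \<beta> \<in> ?B \<and> rev (sort \<beta>) = \<mu>}. F \<beta>)"
    by (rule sum.group[symmetric])
       (simp add: finite_lists_length_eq, simp, auto simp: rect_def sorted_wrt_rev)
  also have "\<dots> = (\<Sum>\<mu>\<in>rect k c. cmul (fact k / (\<Prod>j\<le>c. fact (count_list \<mu> j))) (F \<mu>))"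
  proof (rule sum.cong[OF refl])
    fix \<mu> assume \<mu>: "\<mu> \<in> rect k c"
    have srt: "rev (sort \<beta>) = \<mu> \<longleftrightarrow> mset \<beta> = mset \<mu>" for \<beta>
    proof
      assume *: "mset \<beta> = mset \<mu>"
      have "sorted (rev \<mu>)" using \<mu> by (simp add: rect_def sorted_wrt_rev)
      then have "sort \<beta> = rev \<mu>" using * by (intro properties_for_sort) auto
      then show "rev (sort \<beta>) = \<mu>" by simp
    qed (metis mset_rev mset_sort)
    have "{\<beta>. \<beta> \<in> ?B \<and> rev (sort \<beta>) = \<mu>} = permutations_of_multiset (mset \<mu>)"
      unfolding srt permutations_of_multiset_def using \<mu>
      by (auto simp: rect_def dest: mset_eq_setD mset_eq_length)
    then have "(\<Sum>\<beta>\<in>{\<beta>. \<beta> \<in> ?B \<and> rev (sort \<beta>) = \<mu>}. F \<beta>) = (\<Sum>\<beta>\<in>permutations_of_multiset (mset \<mu>). F \<mu>)"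
      by (intro sum.cong assms) (auto simp: permutations_of_multiset_def)
    also have "\<dots> = cmul (of_nat (card (permutations_of_multiset (mset \<mu>)))) (F \<mu>)"
      by (simp add: cmul_of_nat)
    also have "(of_nat (card (permutations_of_multiset (mset \<mu>))) :: complex) = fact k / (\<Prod>j\<le>c. fact (count_list \<mu> j))"
    proof -
      have "(\<Prod>j\<le>c. fact (count_list \<mu> j) :: nat) = (\<Prod>j\<in>set \<mu>. fact (count_list \<mu> j))"
        using \<mu> by (intro prod.mono_neutral_right) (auto simp: rect_def count_list_0_iff)
      also have "\<dots> = (\<Prod>x\<in>set_mset (mset \<mu>). fact (count (mset \<mu>) x))"
        by (simp add: count_mset)
      finally have "card (permutations_of_multiset (mset \<mu>)) * (\<Prod>j\<le>c. fact (count_list \<mu> j)) = fact k"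
        using card_permutations_of_multiset_aux[of "mset \<mu>"] \<mu> by (simp add: rect_def)
      then have "(of_nat (card (permutations_of_multiset (mset \<mu>)) * (\<Prod>j\<le>c. fact (count_list \<mu> j))) :: complex) = of_nat (fact k)"
        by (simp only:)
      then show ?thesis by (simp add: field_simps)
    qed
    finally show "(\<Sum>\<beta>\<in>{\<beta>. \<beta> \<in> ?B \<and> rev (sort \<beta>) = \<mu>}. F \<beta>) = cmul (fact k / (\<Prod>j\<le>c. fact (count_list \<mu> j))) (F \<mu>)" .
  qed
  finally show ?thesis .
qed

text \<open>The Schur function in terms of words, by collecting the tableaux in \<open>sum_ssyt_word_symf\<close> according to their sorted
content.  Rows and columns are bounded separately, which serves the nonzero charges.\<close>

lemma schur_word_symf:
  assumes \<nu>: "\<nu> \<in> rect k c"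
  shows "schur \<nu> = cmul ((- 1) ^ (k * (k - 1) div 2))
     (\<Sum>\<mu>\<in>rect k c. cmul (of_nat (kostka \<nu> \<mu>) / (\<Prod>j\<le>c. fact (count_list \<mu> j)))
        (word_symf k (\<lambda>i. int (\<mu> ! i) - int (k - 1))))"
proof -
  let ?n = "\<lambda>i. \<nu> ! i"
  let ?B = "{xs. set xs \<subseteq> {..c} \<and> length xs = k}"
  let ?E = "\<lambda>\<beta>. word_symf k (\<lambda>i. int (\<beta> ! i) - int (k - 1))"
  let ?K = "\<lambda>\<beta>. weight_count k ?n (\<lambda>i. \<beta> ! i)"
  have dec: "\<nu> ! Suc j \<le> \<nu> ! j" if "Suc j < k" for j using rect_decreasing[OF \<nu> that] .
  have len: "length \<nu> = k" using \<nu> by (simp add: rect_def)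
  have bound: "\<nu> ! j \<le> c" if "j < k" for j using \<nu> that by (auto simp: rect_def)
  define w where "w T = map (lookup (content k ?n T)) [0..<k]" for T
  have w: "w ` ssyt k ?n \<subseteq> ?B"
  proof -
    have "lookup (content k ?n T) i \<le> c" if "T \<in> ssyt k ?n" for T i
      using dec bound by (intro content_le[OF that]) auto
    then show ?thesis by (auto simp: w_def)
  qed
  have fib: "card {T \<in> ssyt k ?n. w T = \<beta>} = ?K \<beta>" if "length \<beta> = k" for \<beta>
  proof -
    have "w T = \<beta> \<longleftrightarrow> (\<forall>i<k. card {x\<in>diagram k ?n. T x = Suc i} = \<beta> ! i)" if "T \<in> ssyt k ?n" for T
      using \<open>length \<beta> = k\<close> by (auto simp: w_def list_eq_iff_nth_eq lookup_content[OF that])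
    then show ?thesis unfolding weight_count_def by (intro arg_cong[where f = card]) auto
  qed
  have "rsgn k * (fact k * schur \<nu>) = (\<Sum>T\<in>ssyt k ?n. word_symf k (\<lambda>i. int (lookup (content k ?n T) i) - int (k - 1)))"
    unfolding schur_jtdet len by (rule sum_ssyt_word_symf[symmetric]) (rule dec)
  also have "\<dots> = (\<Sum>T\<in>ssyt k ?n. ?E (w T))"
    by (intro sum.cong refl word_symf_cong) (simp add: w_def)
  also have "\<dots> = (\<Sum>\<beta>\<in>?B. \<Sum>T\<in>{T. T \<in> ssyt k ?n \<and> w T = \<beta>}. ?E (w T))"
    by (rule sum.group[symmetric]) (use w in \<open>auto simp: finite_lists_length_eq\<close>)
  also have "\<dots> = (\<Sum>\<beta>\<in>?B. cmul (of_nat (?K \<beta>)) (?E \<beta>))"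
  proof (rule sum.cong[OF refl])
    fix \<beta> assume "\<beta> \<in> ?B"
    then have "card {T \<in> ssyt k ?n. w T = \<beta>} = ?K \<beta>" using fib by auto
    moreover have "(\<Sum>T\<in>{T. T \<in> ssyt k ?n \<and> w T = \<beta>}. ?E (w T)) = (\<Sum>T\<in>{T. T \<in> ssyt k ?n \<and> w T = \<beta>}. ?E \<beta>)"
      by (rule sum.cong) auto
    ultimately show "(\<Sum>T\<in>{T. T \<in> ssyt k ?n \<and> w T = \<beta>}. ?E (w T)) = cmul (of_nat (?K \<beta>)) (?E \<beta>)"
      by (simp add: cmul_of_nat)
  qed
  also have "\<dots> = (\<Sum>\<beta>\<in>?B. if length \<beta> = k then cmul (of_nat (?K \<beta>)) (?E \<beta>) else 0)"
    by (rule sum.cong) auto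
  also have "\<dots> = (\<Sum>\<mu>\<in>rect k c. cmul (fact k / (\<Prod>j\<le>c. fact (count_list \<mu> j))) (if length \<mu> = k then cmul (of_nat (?K \<mu>)) (?E \<mu>) else 0))"
  proof (rule sum_over_rect)
    fix xs ys :: "nat list" assume m: "mset xs = mset ys"
    then have l: "length xs = length ys" by (rule mset_eq_length)
    obtain p where p: "p permutes {..<length ys}" "permute_list p ys = xs" using mset_eq_permutation[OF m] .
    have nth: "xs ! i = ys ! p i" if "i < length ys" for i using p that by (auto simp: permute_list_nth)
    show "(if length xs = k then cmul (of_nat (?K xs)) (?E xs) else 0) = (if length ys = k then cmul (of_nat (?K ys)) (?E ys) else 0)"
    proof (cases "length ys = k")
      case True
      have "?K xs = weight_count k ?n (\<lambda>i. (\<lambda>i. ys ! i) (p i))" by (rule weight_count_cong) (simp add: nth True)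
      also have "\<dots> = ?K ys" by (rule weight_count_permute) (use p dec True in auto)
      finally have "?K xs = ?K ys" .
      moreover have "?E xs = word_symf k (\<lambda>i. (\<lambda>i. int (ys ! i)) (p i) - int (k - 1))" by (rule word_symf_cong) (simp add: nth True)
      then have "?E xs = ?E ys" using word_symf_permute[of p k "\<lambda>i. int (ys ! i)"] p True by simp
      ultimately show ?thesis by (simp add: l)
    qed (simp add: l)
  qed
  also have "\<dots> = (\<Sum>\<mu>\<in>rect k c. cmul (fact k) (cmul (of_nat (kostka \<nu> \<mu>) / (\<Prod>j\<le>c. fact (count_list \<mu> j))) (?E \<mu>)))"
    by (intro sum.cong refl) (auto simp: rect_def kostka_weight_count[OF len])
  also have "\<dots> = cmul (fact k) (\<Sum>\<mu>\<in>rect k c. cmul (of_nat (kostka \<nu> \<mu>) / (\<Prod>j\<le>c. fact (count_list \<mu> j))) (?E \<mu>))"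
    (is "_ = cmul _ ?S") by (simp only: CV.scale_sum_right)
  finally have "rsgn k * (fact k * schur \<nu>) = cmul (fact k) ?S" .
  then have "cmul (fact k) (rsgn k * schur \<nu>) = cmul (fact k) ?S"
    using cmul_of_nat[of "fact k" "rsgn k * schur \<nu>"] by (simp add: mult.left_commute)
  then have "rsgn k * schur \<nu> = ?S" by (simp add: CV.scale_left_imp_eq)
  then have "rsgn k * (rsgn k * schur \<nu>) = rsgn k * ?S" by simp
  then have "schur \<nu> = rsgn k * ?S" by (simp only: mult.assoc[symmetric] rsgn_square mult_1_left)
  also have "rsgn k * ?S = cmul (of_int (sign (reversal k))) ?S" by (simp only: cmul_of_int)
  finally show ?thesis by (simp add: sign_reversal)
qed

section \<open>Schur functions span the symmetric functions\<close>

lemma sorted_wrt_ge_nth: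
  fixes xs :: "int list"
  assumes "sorted_wrt (>) xs" "i \<le> j" "j < length xs"
  shows "xs ! j + int (j - i) \<le> xs ! i"
  using assms(2,3)
proof (induction j rule: dec_induct)
  case (step m)
  have "xs ! Suc m < xs ! m" using assms(1) step by (auto simp: sorted_wrt_iff_nth_less)
  then show ?case using step by auto
qed simp

lemma jtdet_equal_rows: "i < k \<Longrightarrow> j < k \<Longrightarrow> i \<noteq> j \<Longrightarrow> g i = g j \<Longrightarrow> jtdet k g = 0"
  unfolding jtdet_def by (rule det_identical_rows[of _ k i j]) (auto intro!: eq_vecI)

lemma jtdet_negative_row:
  assumes "i < k" "g i + int (k - 1) < 0"
  shows "jtdet k g = 0"
proof -
  have zero: "(\<Prod>i<k. hf (g i + int (p i))) = 0" if "p permutes {..<k}" for p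
  proof (rule prod_zero)
    have "p i < k" using permutes_in_image[OF that, of i] assms by simp
    then have "hf (g i + int (p i)) = 0" using assms by (intro complete_h_neg) auto
    then show "\<exists>a\<in>{..<k}. hf (g a + int (p a)) = 0" using assms by auto
  qed simp
  show ?thesis
    unfolding jtdet_expand by (rule sum.neutral) (auto simp only: mem_Collect_eq zero mult_zero_right)
qed

text \<open>Straightening: sorting the rows gives \<open>\<plusminus>\<close> a Schur function unless two rows agree or a row vanishes.  A strictly
decreasing sequence of \<open>k\<close> integers that starts at most at \<open>c\<close> and ends at least at \<open>-(k-1)\<close> comes
from a partition in the \<open>k \<times> c\<close> rectangle.\<close>

lemma jtdet_in_schur_span:
  assumes le: "\<And>i. i < k \<Longrightarrow> g i \<le> int c"
  shows "jtdet k g \<in> CV.span (schur ` rect k c)"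
proof (cases "(\<exists>i<k. g i + int (k - 1) < 0) \<or> (\<exists>i<k. \<exists>j<k. i \<noteq> j \<and> g i = g j)")
  case True
  then have "jtdet k g = 0" using jtdet_negative_row jtdet_equal_rows by blast
  then show ?thesis by (simp add: CV.span_zero)
next
  case False
  then have low: "- int (k - 1) \<le> g i" if "i < k" for i using that by fastforce
  have inj: "inj_on g {..<k}" using False by (auto simp: inj_on_def)
  define xs where "xs = rev (sort (map g [0..<k]))"
  have len: "length xs = k" by (simp add: xs_def)
  have "distinct (map g [0..<k])" using inj by (simp add: distinct_map atLeast0LessThan)
  then have dec: "sorted_wrt (>) xs"
    unfolding xs_def sorted_wrt_rev using strict_sorted_iff[of "sort (map g [0..<k])"] by simp
  have setxs: "set xs = g ` {..<k}" by (simp add: xs_def atLeast0LessThan)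
  obtain p where p: "p permutes {..<length (map g [0..<k])}" "permute_list p (map g [0..<k]) = xs"
    using mset_eq_permutation[of xs "map g [0..<k]"] by (auto simp: xs_def)
  have pk: "p permutes {..<k}" using p(1) by simp
  have nth: "xs ! i = g (p i)" if "i < k" for i
    using that permute_list_nth[OF p(1), of i] p(2) permutes_in_image[OF pk, of i] by simp
  have nonneg: "0 \<le> xs ! i + int i" if "i < k" for i
  proof -
    have "xs ! (k - 1) \<ge> - int (k - 1)" using nth[of "k - 1"] low[of "p (k - 1)"] permutes_in_image[OF pk, of "k - 1"] that by simp
    moreover have "xs ! (k - 1) + int (k - 1 - i) \<le> xs ! i" using that by (intro sorted_wrt_ge_nth[OF dec]) (auto simp: len)
    ultimately show ?thesis using that by simp
  qed
  define l where "l = map (\<lambda>i. nat (xs ! i + int i)) [0..<k]"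
  have l_nth: "int (l ! i) = xs ! i + int i" if "i < k" for i using that nonneg[OF that] by (simp add: l_def)
  have "l ! j \<le> l ! i" if "i < j" "j < k" for i j
  proof -
    have "int (l ! j) \<le> int (l ! i)"
      using sorted_wrt_ge_nth[OF dec, of i j] that by (simp add: l_nth len)
    then show ?thesis by simp
  qed
  moreover have "l ! i \<le> c" if "i < k" for i
  proof -
    have "xs ! i + int (i - 0) \<le> xs ! 0" using that by (intro sorted_wrt_ge_nth[OF dec]) (auto simp: len)
    also have "xs ! 0 \<le> int c" using nth[of 0] le[of "p 0"] permutes_in_image[OF pk, of 0] that by simp
    finally show ?thesis using l_nth[OF that] by simp
  qed
  ultimately have "l \<in> rect k c"
    by (auto simp: rect_def sorted_wrt_iff_nth_less l_def set_conv_nth)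
  moreover have "jtdet k g = cmul (of_int (sign p)) (schur l)"
  proof -
    have "schur l = jtdet k (\<lambda>i. int (l ! i) - int i)" by (simp add: schur_jtdet l_def)
    also have "\<dots> = jtdet k (\<lambda>i. g (p i))" by (rule jtdet_cong) (simp add: l_nth nth)
    also have "\<dots> = signof p * jtdet k g" by (rule jtdet_permute[OF pk])
    finally have "signof p * schur l = signof p * signof p * jtdet k g" by (simp add: mult.assoc)
    then show ?thesis by (simp add: signof_square cmul_of_int)
  qed
  ultimately show ?thesis by (auto intro: CV.span_scale CV.span_base)
qed

text \<open>The rearrangement inequality, from \<open>\<Sum>\<^sub>i (i - p(i))\<^sup>2 > 0\<close>.\<close>

lemma permutation_moment:
  assumes p: "p permutes {..<k}" "p \<noteq> id"
  shows "(\<Sum>i<k. int i * int (p i)) < (\<Sum>i<k. int i * int i)"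
proof -
  obtain j where j: "p j \<noteq> j" using p(2) by (auto simp: fun_eq_iff)
  then have "j < k" using permutes_not_in[OF p(1), of j] by auto
  have "0 < (\<Sum>i<k. (int i - int (p i))\<^sup>2)"
    using j \<open>j < k\<close> by (intro sum_pos2[of _ j]) auto
  also have "\<dots> = (\<Sum>i<k. int i * int i) + (\<Sum>i<k. int (p i) * int (p i)) - 2 * (\<Sum>i<k. int i * int (p i))"
    unfolding sum_distrib_left sum.distrib[symmetric] sum_subtractf[symmetric]
    by (intro sum.cong refl) (simp add: power2_eq_square algebra_simps)
  also have "(\<Sum>i<k. int (p i) * int (p i)) = (\<Sum>i<k. int i * int i)"
    using sum.permute[OF p(1), of "\<lambda>i. int i * int i"] by (simp add: o_def)
  finally show ?thesis by simp
qed

text \<open>The Jacobi-Trudi determinant is unitriangular: its other terms have the same total degree and, by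
\<open>permutation_moment\<close>, a smaller value of \<open>\<Sum>\<^sub>i i \<beta>\<^sub>i\<close>.\<close>

lemma h_product_in_schur_span:
  assumes "\<And>i. i < k \<Longrightarrow> 0 \<le> \<beta> i" "(\<Sum>i<k. \<beta> i) = int c"
  shows "(\<Prod>i<k. hf (\<beta> i)) \<in> CV.span (schur ` rect k c)"
  using assms
proof (induction "nat (\<Sum>i<k. int i * \<beta> i)" arbitrary: \<beta> rule: less_induct)
  case less
  let ?S = "CV.span (schur ` rect k c)"
  let ?P = "{p. p permutes {..<k}}"
  let ?t = "\<lambda>p. signof p * (\<Prod>i<k. hf (\<beta> i - int i + int (p i)))"
  have fin: "finite ?P" by (rule finite_permutations) simp
  have le: "\<beta> i \<le> int c" if "i < k" for i
    using member_le_sum[of i "{..<k}" \<beta>] less.prems that by auto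
  have "jtdet k (\<lambda>i. \<beta> i - int i) \<in> ?S" (is "?J \<in> _")
    by (rule jtdet_in_schur_span) (use le in force)
  moreover have J: "?J = ?t id + (\<Sum>p\<in>?P - {id}. ?t p)"
    unfolding jtdet_expand using fin by (subst sum.remove[of _ id]) (auto simp: permutes_id)
  moreover have "(\<Sum>p\<in>?P - {id}. ?t p) \<in> ?S"
  proof (rule CV.span_sum)
    fix p assume "p \<in> ?P - {id}"
    then have p: "p permutes {..<k}" "p \<noteq> id" by auto
    let ?\<beta> = "\<lambda>i. \<beta> i - int i + int (p i)"
    have "(\<Prod>i<k. hf (?\<beta> i)) \<in> ?S"
    proof (cases "\<exists>i<k. ?\<beta> i < 0")
      case True
      then obtain i where i: "i < k" "?\<beta> i < 0" by blast
      then have "hf (?\<beta> i) = 0" by (intro complete_h_neg)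
      then have "(\<Prod>i<k. hf (?\<beta> i)) = 0" using i(1) by (intro prod_zero) (auto intro: bexI[of _ i])
      then show ?thesis by (simp only: CV.span_zero)
    next
      case False
      then have nn: "0 \<le> ?\<beta> i" if "i < k" for i using that by (meson not_le)
      have "(\<Sum>i<k. int (p i)) = (\<Sum>i<k. int i)"
        using sum.permute[OF p(1), of int] by (simp add: o_def)
      then have tot: "(\<Sum>i<k. ?\<beta> i) = int c" using less.prems(2) by (simp add: sum.distrib sum_subtractf)
      have "(\<Sum>i<k. int i * ?\<beta> i) = (\<Sum>i<k. int i * \<beta> i) - (\<Sum>i<k. int i * int i) + (\<Sum>i<k. int i * int (p i))"
        unfolding sum.distrib[symmetric] sum_subtractf[symmetric] by (intro sum.cong refl) (simp add: algebra_simps)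
      then have "(\<Sum>i<k. int i * ?\<beta> i) < (\<Sum>i<k. int i * \<beta> i)" using permutation_moment[OF p] by simp
      moreover have "0 \<le> (\<Sum>i<k. int i * ?\<beta> i)" by (rule sum_nonneg) (simp add: nn)
      ultimately show ?thesis by (intro less.hyps nn tot) auto
    qed
    then show "?t p \<in> ?S" unfolding cmul_of_int[symmetric] by (rule CV.span_scale)
  qed
  ultimately have "?J - (\<Sum>p\<in>?P - {id}. ?t p) \<in> ?S" by (intro CV.span_diff)
  then show ?case unfolding J by simp
qed

definition h_list :: "nat list \<Rightarrow> symf" where
  "h_list rs = prod_list (map (\<lambda>r. hf (int r)) rs)"

definition h_span :: "symf set" where
  "h_span = CV.span (range h_list)"

lemma h_list_mult: "f \<in> h_span \<Longrightarrow> hf (int r) * f \<in> h_span"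
  unfolding h_span_def
proof (induction rule: CV.span_induct_alt)
  case base then show ?case by (simp add: CV.span_zero)
next
  case (step c x y)
  then obtain rs where "x = h_list rs" by auto
  then have "hf (int r) * x = h_list (r # rs)" by (simp add: h_list_def)
  then show ?case using step(2)
    by (simp add: distrib_left cmul_mult_right CV.span_add CV.span_scale CV.span_base)
qed

text \<open>Newton's identity expresses \<open>p\<^sub>j\<close> by \<open>h\<close> and earlier power sums.\<close>

lemma psum_mult_h_span: "j \<ge> 1 \<Longrightarrow> f \<in> h_span \<Longrightarrow> psum j * f \<in> h_span"
proof (induction j arbitrary: f rule: less_induct)
  case (less j)
  have "of_nat j * hf (int j) = (\<Sum>i\<in>{1..<j}. psum i * hf (int (j - i))) + psum j"
  proof -
    have "of_nat j * hf (int j) = (\<Sum>i\<in>insert j {1..<j}. psum i * hf (int j - int i))"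
      unfolding newton_identity using less.prems(1) by (intro sum.cong) auto
    also have "\<dots> = (\<Sum>i\<in>{1..<j}. psum i * hf (int j - int i)) + psum j" by simp
    also have "(\<Sum>i\<in>{1..<j}. psum i * hf (int j - int i)) = (\<Sum>i\<in>{1..<j}. psum i * hf (int (j - i)))"
      by (intro sum.cong refl) (simp add: of_nat_diff)
    finally show ?thesis .
  qed
  then have "psum j = of_nat j * hf (int j) - (\<Sum>i\<in>{1..<j}. psum i * hf (int (j - i)))" by simp
  then have "psum j * f = cmul (of_nat j) (hf (int j) * f) - (\<Sum>i\<in>{1..<j}. psum i * (hf (int (j - i)) * f))"
    by (simp add: left_diff_distrib sum_distrib_right mult.assoc cmul_of_nat)
  moreover have "(\<Sum>i\<in>{1..<j}. psum i * (hf (int (j - i)) * f)) \<in> h_span"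
    unfolding h_span_def
  proof (rule CV.span_sum)
    fix i assume "i \<in> {1..<j}"
    then show "psum i * (hf (int (j - i)) * f) \<in> CV.span (range h_list)"
      using less.IH[of i, OF _ _ h_list_mult[OF less.prems(2), of "j - i"]] unfolding h_span_def by simp
  qed
  moreover have "cmul (of_nat j) (hf (int j) * f) \<in> h_span"
    using h_list_mult[OF less.prems(2)] unfolding h_span_def by (rule CV.span_scale)
  ultimately show ?case unfolding h_span_def by (simp add: CV.span_diff)
qed

lemma h_span_UNIV: "f \<in> h_span"
proof -
  have one: "1 \<in> h_span"
    unfolding h_span_def by (rule CV.span_base) (auto simp: h_list_def intro: image_eqI[of _ _ "[]"])
  have pow: "psum (Suc i) ^ m * g \<in> h_span" if "g \<in> h_span" for i m g
    using that by (induction m) (auto simp: mult.assoc intro: psum_mult_h_span)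
  have single_pow: "single (single i m) 1 = psum (Suc i) ^ m" for i m
    using mpvar_power[of i m, where 'a = complex] by (simp add: psum_def mpvar_def)
  have mono: "single (\<Sum>i\<in>I. single i (a i)) 1 \<in> h_span" for I and a :: "nat \<Rightarrow> nat"
  proof (induction I rule: infinite_finite_induct)
    case (insert i I)
    have "single (\<Sum>i\<in>insert i I. single i (a i)) 1 =
       psum (Suc i) ^ a i * single (\<Sum>i\<in>I. single i (a i)) (1::complex)"
      using insert.hyps by (simp add: single_pow[symmetric] mult_single)
    then show ?case using pow[OF insert.IH] by simp
  qed (simp_all add: one)
  have "single \<alpha> c \<in> h_span" for \<alpha> c
  proof -
    have "single \<alpha> 1 \<in> h_span" using mono[of "lookup \<alpha>" "keys \<alpha>"] poly_mapping_sum_single[of \<alpha>] by simp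
    then have "cmul c (single \<alpha> 1) \<in> h_span" unfolding h_span_def by (rule CV.span_scale)
    then show ?thesis by (simp add: cmul_single)
  qed
  then have "(\<Sum>\<alpha>\<in>keys f. single \<alpha> (lookup f \<alpha>)) \<in> h_span"
    unfolding h_span_def by (intro CV.span_sum) simp
  then show ?thesis using poly_mapping_sum_single[of f] by simp
qed

lemma h_list_in_schur_span:
  assumes "length rs \<le> k" "sum_list rs \<le> c"
  shows "h_list rs \<in> CV.span (schur ` rect k c)"
proof -
  let ?\<beta> = "\<lambda>i. if i < length rs then int (rs ! i) else 0"
  have "(\<Prod>i<k. hf (?\<beta> i)) = (\<Prod>i<length rs. hf (int (rs ! i)))"
    using assms by (intro prod.mono_neutral_cong_right) auto
  also have "\<dots> = h_list rs"
    unfolding h_list_def by (subst prod.list_conv_set_nth) (simp add: atLeast0LessThan)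
  finally have eq: "(\<Prod>i<k. hf (?\<beta> i)) = h_list rs" .
  have "(\<Sum>i<k. ?\<beta> i) = (\<Sum>i<length rs. int (rs ! i))"
    using assms by (intro sum.mono_neutral_cong_right) auto
  also have "\<dots> = int (sum_list rs)"
    by (simp add: sum_list_sum_nth atLeast0LessThan)
  finally have "(\<Prod>i<k. hf (?\<beta> i)) \<in> CV.span (schur ` rect k (sum_list rs))"
    by (intro h_product_in_schur_span) auto
  moreover have "rect k (sum_list rs) \<subseteq> rect k c" using assms by (auto simp: rect_def)
  ultimately show ?thesis unfolding eq by (meson CV.span_mono image_mono subsetD)
qed

section \<open>The filtration of the Fock space\<close>

lemma fmul_single: "fmul c (single a g) = single a (cmul c g)"
  by (rule poly_mapping_eqI) (simp add: lookup_fmul lookup_single when_def)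

lemma foldr_e_op: "foldr (\<lambda>j. e_op (- int j)) js v = foldr (\<lambda>m. e_op (- m)) (map int js) v"
  by (induction js) simp_all

text \<open>With \<open>k + c = 2n\<close> the index shift of \<open>e_word\<close> is just the one in \<open>word_symf_jtdet\<close>.  Reversing the
letters is harmless because words are symmetric.\<close>

lemma rect_e_word:
  assumes \<mu>: "\<mu> \<in> rect k c" and n: "k + c = 2 * n"
  shows "foldr (\<lambda>m. e_op (- (int c - int m))) \<mu> (vac (- int n)) =
     single (int k - int n) (word_symf k (\<lambda>i. int (\<mu> ! i) - int (k - 1)))"
proof -
  have len: "length \<mu> = k" using \<mu> by (simp add: rect_def)
  have "foldr (\<lambda>m. e_op (- (int c - int m))) \<mu> (vac (- int n)) = foldr (\<lambda>m. e_op (- m)) (map (\<lambda>m. int c - int m) \<mu>) (vac (- int n))"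
    by (simp add: foldr_map o_def)
  also have "\<dots> = single (int k - int n)
     (word_symf k (\<lambda>i. 1 - rev (map (\<lambda>m. int c - int m) \<mu>) ! i + 2 * (int n - int k)))"
    unfolding e_word by (simp add: len)
  also have "word_symf k (\<lambda>i. 1 - rev (map (\<lambda>m. int c - int m) \<mu>) ! i + 2 * (int n - int k)) = word_symf k (\<lambda>i. (\<lambda>i. int (\<mu> ! i)) (reversal k i) - int (k - 1))"
    using n by (intro word_symf_cong) (auto simp: rev_nth len reversal_def of_nat_diff)
  also have "\<dots> = word_symf k (\<lambda>i. int (\<mu> ! i) - int (k - 1))"
    by (rule word_symf_permute[OF reversal_permutes])
  finally show ?thesis .
qed

lemma rect_e_word_fusion:
  assumes \<mu>: "\<mu> \<in> rect k c" and n: "k + c = 2 * n"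
  shows "single (int k - int n) (word_symf k (\<lambda>i. int (\<mu> ! i) - int (k - 1))) \<in> fusion n"
proof -
  let ?js = "map (\<lambda>m. c - m) \<mu>"
  have "foldr (\<lambda>j. e_op (- int j)) ?js (vac (- int n)) = foldr (\<lambda>m. e_op (- (int c - int m))) \<mu> (vac (- int n))"
    unfolding foldr_map using \<mu> by (intro foldr_cong) (auto simp: rect_def of_nat_diff)
  moreover have "set ?js \<subseteq> {..<2 * n}"
  proof
    fix j assume j: "j \<in> set ?js"
    then have "j \<le> c" "length \<mu> > 0" by auto
    moreover from this have "k > 0" using \<mu> by (auto simp: rect_def)
    ultimately show "j \<in> {..<2 * n}" using n by simp
  qed
  ultimately show ?thesis
    unfolding fusion_def rect_e_word[OF assms, symmetric] by (intro FV.span_base) (metis (mono_tags, lifting) mem_Collect_eq)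
qed

lemma single_sum: "single a (\<Sum>i\<in>I. f i) = (\<Sum>i\<in>I. single a (f i))"
  by (induction I rule: infinite_finite_induct) (simp_all add: single_add)

lemma schur_in_fusion:
  assumes "\<nu> \<in> rect k c" and n: "k + c = 2 * n"
  shows "single (int k - int n) (schur \<nu>) \<in> fusion n"
proof -
  have "single (int k - int n) (cmul a (\<Sum>\<mu>\<in>rect k c. cmul (b \<mu>) (word_symf k (\<lambda>i. int (\<mu> ! i) - int (k - 1))))) \<in> fusion n" for a b
    unfolding fmul_single[symmetric] single_sum fusion_def
    by (intro FV.span_scale FV.span_sum rect_e_word_fusion[OF _ n, unfolded fusion_def])
  then show ?thesis by (subst schur_word_symf[OF assms(1)])
qed

lemma schur_span_in_fusion:
  assumes "g \<in> CV.span (schur ` rect k c)" and n: "k + c = 2 * n"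
  shows "single (int k - int n) g \<in> fusion n"
  using assms(1)
proof (induction rule: CV.span_induct_alt)
  case base then show ?case by (simp add: fusion_def FV.span_zero)
next
  case (step b x y)
  then have "single (int k - int n) x \<in> fusion n" using schur_in_fusion[OF _ n] by auto
  then show ?case using step(2)
    unfolding single_add fmul_single[symmetric] fusion_def by (intro FV.span_add FV.span_scale)
qed

text \<open>Only words of \<open>n\<close> letters reach charge zero.  Letters \<open>e\<^bsub>-j\<^esub>\<close> with \<open>j > n\<close> give negative entries \<open>n - j\<close>, which the
straightening copes with.\<close>

lemma charge0_fusion:
  assumes "v \<in> fusion n"
  shows "lookup v 0 \<in> CV.span (schur ` rect n n)"
  using assms unfolding fusion_def
proof (induction rule: FV.span_induct_alt)
  case base then show ?case by (simp add: CV.span_zero)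
next
  case (step b x y)
  then obtain js where x: "x = foldr (\<lambda>j. e_op (- int j)) js (vac (- int n))" and js: "set js \<subseteq> {..<2 * n}" by auto
  have "lookup x 0 \<in> CV.span (schur ` rect n n)"
  proof (cases "length js = n")
    case True
    let ?\<mu> = "\<lambda>i. int n - int (rev js ! i)"
    have "x = single 0 (word_symf n (\<lambda>i. 1 - rev (map int js) ! i + 2 * (int n - int n)))"
      unfolding x foldr_e_op e_word using True by simp
    also have "word_symf n (\<lambda>i. 1 - rev (map int js) ! i + 2 * (int n - int n)) = word_symf n (\<lambda>i. ?\<mu> i - int (n - 1))"
      by (rule word_symf_cong) (auto simp: rev_nth True of_nat_diff)
    also have "\<dots> = rsgn n * (\<Sum>p | p permutes {..<n}. jtdet n (\<lambda>i. ?\<mu> (p i) - int i))"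
      by (rule word_symf_jtdet)
    finally have "lookup x 0 = cmul (of_int (sign (reversal n))) (\<Sum>p | p permutes {..<n}. jtdet n (\<lambda>i. ?\<mu> (p i) - int i))"
      by (simp add: cmul_of_int)
    also have "\<dots> \<in> CV.span (schur ` rect n n)"
      by (intro CV.span_scale CV.span_sum jtdet_in_schur_span) auto
    finally show ?thesis .
  next
    case False
    then show ?thesis
      unfolding x foldr_e_op e_word by (simp add: lookup_single when_def CV.span_zero)
  qed
  then show ?case using step(2) by (simp add: lookup_add lookup_fmul CV.span_add CV.span_scale)
qed

lemma e_op_vac: "e_op (- int (2 * n + 1)) (vac (- int (Suc n))) = vac (- int n)"
proof -
  have "foldr (\<lambda>m. e_op (- m)) [int (2 * n + 1)] (vac (- int (Suc n))) =
    single (- int n) (word_symf 1 (\<lambda>i. 1 - [int (2 * n + 1)] ! i + 2 * (int (Suc n) - 1)))"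
    unfolding e_word by simp
  also have "word_symf 1 (\<lambda>i. 1 - [int (2 * n + 1)] ! i + 2 * (int (Suc n) - 1)) = word_symf 1 (\<lambda>i. 0)"
    by (rule word_symf_cong) simp
  also have "word_symf 1 (\<lambda>i. 0) = 1" by (simp add: word_symf_def vandermonde_sq_eq vandermonde_def)
  finally show ?thesis by (simp add: vac_def)
qed

lemma fusion_Suc: "fusion n \<subseteq> fusion (Suc n)"
  unfolding fusion_def
proof (rule FV.span_mono, rule subsetI)
  fix v assume "v \<in> {foldr (\<lambda>j. e_op (- int j)) js (vac (- int n)) | js. set js \<subseteq> {..<2 * n}}"
  then obtain js where js: "v = foldr (\<lambda>j. e_op (- int j)) js (vac (- int n))" "set js \<subseteq> {..<2 * n}" by auto
  have "v = foldr (\<lambda>j. e_op (- int j)) (js @ [2 * n + 1]) (vac (- int (Suc n)))"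
    by (simp only: js(1) foldr_append foldr.simps comp_apply id_apply e_op_vac)
  moreover have "set (js @ [2 * n + 1]) \<subseteq> {..<2 * Suc n}" using js(2) by auto
  ultimately show "v \<in> {foldr (\<lambda>j. e_op (- int j)) js (vac (- int (Suc n))) | js. set js \<subseteq> {..<2 * Suc n}}" by blast
qed

lemma fusion_mono: "m \<le> n \<Longrightarrow> fusion m \<subseteq> fusion n"
  by (rule lift_Suc_mono_le[of fusion]) (use fusion_Suc in auto)

text \<open>In charge \<open>a\<close> the rectangles have \<open>n + a\<close> rows and \<open>n - a\<close> columns; both grow with \<open>n\<close>, so they finally contain every
diagram.\<close>

lemma fusion_exhausts: "\<exists>n. v \<in> fusion n"
proof -
  have hl: "\<exists>n. single a (h_list rs) \<in> fusion n" for a rs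
  proof -
    define n where "n = nat \<bar>a\<bar> + length rs + sum_list rs"
    have nn: "0 \<le> int n + a" "0 \<le> int n - a" by (auto simp: n_def)
    define k c where "k = nat (int n + a)" and "c = nat (int n - a)"
    have "k + c = 2 * n" "int k - int n = a" using nn by (auto simp: k_def c_def)
    moreover have "length rs \<le> k" "sum_list rs \<le> c" by (auto simp: k_def c_def n_def)
    ultimately show ?thesis using schur_span_in_fusion[OF h_list_in_schur_span] by metis
  qed
  have add: "\<exists>n. v + w \<in> fusion n" if "\<exists>n. v \<in> fusion n" "\<exists>n. w \<in> fusion n" for v w
  proof -
    from that obtain m n where "v \<in> fusion m" "w \<in> fusion n" by blast
    then have "v \<in> fusion (max m n)" "w \<in> fusion (max m n)" using fusion_mono by (meson max.cobounded1 max.cobounded2 subsetD)+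
    then show ?thesis unfolding fusion_def using FV.span_add by blast
  qed
  have single: "\<exists>n. single a g \<in> fusion n" for a g
    using h_span_UNIV[of g] unfolding h_span_def
  proof (induction rule: CV.span_induct_alt)
    case base then show ?case by (simp add: fusion_def FV.span_zero)
  next
    case (step c x y)
    from step(1) obtain rs where x: "x = h_list rs" by auto
    obtain n where "single a x \<in> fusion n" using hl unfolding x by blast
    then have "fmul c (single a x) \<in> fusion n" unfolding fusion_def by (rule FV.span_scale)
    then have "\<exists>n. fmul c (single a x) \<in> fusion n" by blast
    then show ?case using add step(2) by (simp add: single_add fmul_single)
  qed
  have "v = (\<Sum>a\<in>keys v. single a (lookup v a))"
    by (rule poly_mapping_eqI) (simp add: lookup_sum lookup_single when_def in_keys_iff)
  moreover have "\<exists>n. (\<Sum>a\<in>A. single a (lookup v a)) \<in> fusion n" for A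
    by (induction A rule: infinite_finite_induct) (auto simp: fusion_def FV.span_zero intro: add[unfolded fusion_def] single[unfolded fusion_def])
  ultimately show ?thesis by metis
qed

section \<open>The grading\<close>

definition hom_deg :: "int \<Rightarrow> symf \<Rightarrow> bool" where
  "hom_deg d g \<longleftrightarrow> (\<forall>\<alpha>\<in>keys g. int (part_size \<alpha>) = d)"

lemma part_size_superset:
  "finite A \<Longrightarrow> keys \<alpha> \<subseteq> A \<Longrightarrow> part_size \<alpha> = (\<Sum>i\<in>A. (i + 1) * lookup \<alpha> i)"
  unfolding part_size_def by (rule sum.mono_neutral_left) (auto simp: in_keys_iff)

lemma part_size_add: "part_size (\<alpha> + \<beta>) = part_size \<alpha> + part_size \<beta>"
proof -
  let ?A = "keys \<alpha> \<union> keys \<beta>"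
  show ?thesis
    using part_size_superset[of ?A \<alpha>] part_size_superset[of ?A \<beta>] part_size_superset[of ?A "\<alpha> + \<beta>"]
      Poly_Mapping.keys_add[of \<alpha> \<beta>]
    by (simp add: lookup_add distrib_left sum.distrib)
qed

lemma hom_deg_zero [simp]: "hom_deg d 0"
  by (simp add: hom_deg_def)

lemma hom_deg_one: "hom_deg 0 1"
  by (simp add: hom_deg_def part_size_def)

lemma hom_deg_add: "hom_deg d f \<Longrightarrow> hom_deg d g \<Longrightarrow> hom_deg d (f + g)"
  using Poly_Mapping.keys_add[of f g] by (auto simp: hom_deg_def)

lemma hom_deg_sum: "(\<And>i. i \<in> I \<Longrightarrow> hom_deg d (f i)) \<Longrightarrow> hom_deg d (\<Sum>i\<in>I. f i)"
  by (induction I rule: infinite_finite_induct) (auto intro: hom_deg_add)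

lemma hom_deg_cmul: "hom_deg d f \<Longrightarrow> hom_deg d (cmul c f)"
  by (auto simp: hom_deg_def in_keys_iff lookup_cmul)

lemma hom_deg_mult: "hom_deg d f \<Longrightarrow> hom_deg e g \<Longrightarrow> hom_deg (d + e) (f * g)"
  using Poly_Mapping.keys_mult[of f g] by (force simp: hom_deg_def part_size_add)

lemma hom_deg_prod: "(\<And>i. i \<in> I \<Longrightarrow> hom_deg (d i) (f i)) \<Longrightarrow> hom_deg (\<Sum>i\<in>I. d i) (\<Prod>i\<in>I. f i)"
  by (induction I rule: infinite_finite_induct) (auto intro: hom_deg_mult hom_deg_one)

lemma hom_deg_complete_h: "hom_deg r (hf r)"
proof (cases "r < 0")
  case False
  have "hom_deg (int n) (hf (int n))" for n
  proof (induction n rule: less_induct)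
    case (less n)
    show ?case
    proof (cases "n = 0")
      case False
      have "hom_deg (int n) (\<Sum>j\<in>{1..n}. psum j * hf (int n - int j))"
      proof (rule hom_deg_sum)
        fix j assume j: "j \<in> {1..n}"
        have "hom_deg (int j) (psum j)" using j by (simp add: hom_deg_def psum_def part_size_def)
        moreover have "hom_deg (int n - int j) (hf (int n - int j))"
          using less[of "n - j"] j by (simp add: of_nat_diff)
        ultimately have "hom_deg (int j + (int n - int j)) (psum j * hf (int n - int j))" by (rule hom_deg_mult)
        then show "hom_deg (int n) (psum j * hf (int n - int j))" by simp
      qed
      then have "hom_deg (int n) (cmul (1 / of_nat n) (cmul (of_nat n) (hf (int n))))"
        unfolding cmul_of_nat newton_identity by (rule hom_deg_cmul)
      then show ?thesis using False by simp
    qed (simp add: hom_deg_one)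
  qed
  from this[of "nat r"] show ?thesis using False by simp
qed simp

lemma hom_deg_schur: "hom_deg (int (sum_list l)) (schur l)"
  unfolding schur_jtdet jtdet_expand
proof (rule hom_deg_sum)
  let ?k = "length l"
  fix p assume "p \<in> {p. p permutes {..<?k}}"
  then have p: "p permutes {..<?k}" by simp
  have "(\<Sum>i<?k. int (p i)) = (\<Sum>i<?k. int i)"
    using sum.permute[OF p, of int] by (simp add: o_def)
  then have "(\<Sum>i<?k. int (l ! i) - int i + int (p i)) = int (sum_list l)"
    by (simp add: sum.distrib sum_subtractf sum_list_sum_nth atLeast0LessThan)
  moreover have "hom_deg (\<Sum>i<?k. int (l ! i) - int i + int (p i)) (\<Prod>i<?k. hf (int (l ! i) - int i + int (p i)))"
    by (intro hom_deg_prod hom_deg_complete_h)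
  ultimately show "hom_deg (int (sum_list l)) (signof p * (\<Prod>i<?k. hf (int (l ! i) - int i + int (p i))))"
    unfolding cmul_of_int[symmetric] by (intro hom_deg_cmul) simp
qed

lemma homogeneous_charge0: "hom_deg d g \<Longrightarrow> homogeneous d (charge0 g)"
  by (auto simp: homogeneous_def hom_deg_def charge0_def lookup_single when_def split: if_splits)

lemma charge0_add: "charge0 (f + g) = charge0 f + charge0 g"
  by (simp add: charge0_def single_add)

lemma charge0_cmul: "charge0 (cmul c f) = fmul c (charge0 f)"
  by (simp add: charge0_def fmul_single)

section \<open>Finite and infinite tableaux\<close>

lemma tableaux_card_le:
  assumes S: "S \<in> tableaux (2 * n)"
  shows "card S \<le> n"
proof (cases "S = {}")
  case False
  have sub: "S \<subseteq> {1..2 * n}" and st: "standard S" using S by (auto simp: tableaux_def)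
  have fin: "finite S" using sub by (rule finite_subset) simp
  let ?b = "Max S"
  have b: "?b \<in> S" using fin False by simp
  have "{x \<in> S. x \<le> ?b} = S" using fin by auto
  then have "card S \<le> card {x. 1 \<le> x \<and> x < ?b \<and> x \<notin> S}" using st b by (auto simp: standard_def)
  also have "\<dots> \<le> card ({1..2 * n} - S)" using b sub by (intro card_mono) auto
  also have "\<dots> = 2 * n - card S" using fin sub by (simp add: card_Diff_subset)
  finally show ?thesis by simp
qed simp

text \<open>Beyond \<open>2n\<close> both tableaux have exactly the even numbers in the second row, and the tail adds to the two rows
alternately, so that the row condition reduces to \<open>card S \<le> n\<close>.\<close>

lemma extend_in_inf_tableaux:
  assumes S: "S \<in> tableaux (2 * n)"
  shows "extend (2 * n) S \<in> inf_tableaux (n - card S)"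
proof -
  let ?t = "extend (2 * n) S"
  have sub: "S \<subseteq> {1..2 * n}" and st: "standard S" using S by (auto simp: tableaux_def)
  have fin: "finite S" using sub by (rule finite_subset) simp
  have le: "card S \<le> n" by (rule tableaux_card_le[OF S])
  have mem: "x \<in> ?t \<longleftrightarrow> x \<in> S \<or> (x > 2 * n \<and> even x)" for x
  proof -
    have "(\<exists>i. x = 2 * n + 2 + 2 * i) \<longleftrightarrow> x > 2 * n \<and> even x" by presburger
    then show ?thesis by (auto simp: extend_def)
  qed
  have tail: "{x \<in> ?t. x \<le> 2 * m} = S \<union> (\<lambda>i. 2 * n + 2 + 2 * i) ` {..<m - n}" if "m \<ge> n" for m
  proof -
    have "x \<in> (\<lambda>i. 2 * n + 2 + 2 * i) ` {..<m - n} \<longleftrightarrow> x > 2 * n \<and> even x \<and> x \<le> 2 * m" for x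
    proof
      assume "x > 2 * n \<and> even x \<and> x \<le> 2 * m"
      then obtain y where "x = 2 * y" "n < y" "y \<le> m" by (auto elim!: evenE)
      then have "x = 2 * n + 2 + 2 * (y - n - 1)" "y - n - 1 \<in> {..<m - n}" by auto
      then show "x \<in> (\<lambda>i. 2 * n + 2 + 2 * i) ` {..<m - n}" by blast
    qed auto
    then show ?thesis using mem sub that by fastforce
  qed
  have card: "card {x \<in> ?t. x \<le> 2 * m} = card S + (m - n)" if "m \<ge> n" for m
  proof -
    have "inj_on (\<lambda>i. 2 * n + 2 + 2 * i) {..<m - n}" by (auto simp: inj_on_def)
    then show ?thesis unfolding tail[OF that] using sub fin
      by (subst card_Un_disjoint) (auto simp: card_image)
  qed
  have pos: "0 \<notin> ?t" using mem sub by fastforce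
  have "standard ?t" unfolding standard_def
  proof (intro conjI ballI pos)
    fix b assume b: "b \<in> ?t"
    show "card {x \<in> ?t. x \<le> b} \<le> card {x. 1 \<le> x \<and> x < b \<and> x \<notin> ?t}"
    proof (cases "b \<le> 2 * n")
      case True
      then have "{x \<in> ?t. x \<le> b} = {x \<in> S. x \<le> b}" "{x. 1 \<le> x \<and> x < b \<and> x \<notin> ?t} = {x. 1 \<le> x \<and> x < b \<and> x \<notin> S}" "b \<in> S"
        using mem b by auto
      then show ?thesis using st by (simp add: standard_def)
    next
      case False
      then have "even b" "b > 2 * n" using mem b sub by auto
      then obtain m where m: "b = 2 * m" "m > n" by auto
      have "{x. 1 \<le> x \<and> x < b \<and> x \<notin> ?t} = {1..2 * m} - {x \<in> ?t. x \<le> 2 * m}"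
        using b m by (auto simp: le_less)
      also have "card \<dots> = 2 * m - card {x \<in> ?t. x \<le> 2 * m}"
      proof (subst card_Diff_subset)
        show "finite {x \<in> ?t. x \<le> 2 * m}" by simp
        show "{x \<in> ?t. x \<le> 2 * m} \<subseteq> {1..2 * m}" using pos by (auto simp: Suc_le_eq intro: gr0I)
      qed simp
      finally show ?thesis using card[of m] m le by simp
    qed
  qed
  moreover have "finite {i. (i \<in> ?t) \<noteq> (i \<in> principal_tableau (n - card S))}"
  proof (rule finite_subset)
    show "{i. (i \<in> ?t) \<noteq> (i \<in> principal_tableau (n - card S))} \<subseteq> {..4 * n + 2}"
    proof (rule subsetI, rule ccontr)
      fix i assume i: "i \<in> {i. (i \<in> ?t) \<noteq> (i \<in> principal_tableau (n - card S))}" "i \<notin> {..4 * n + 2}"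
      have "i \<in> ?t \<longleftrightarrow> even i" using mem[of i] i(2) sub by auto
      moreover have "i \<in> principal_tableau (n - card S) \<longleftrightarrow> even i"
      proof
        assume "even i"
        then obtain j where "i = 2 * j" by auto
        then have "i = 2 * (n - card S) + 2 + 2 * (j - (n - card S) - 1)" using i(2) by auto
        then show "i \<in> principal_tableau (n - card S)" unfolding principal_tableau_def by blast
      qed (auto simp: principal_tableau_def)
      ultimately show False using i(1) by simp
    qed
  qed simp
  moreover have "card (?t \<inter> {1..2 * m}) + (n - card S) = m" if "m \<ge> n" for m
  proof -
    have "?t \<inter> {1..2 * m} = {x \<in> ?t. x \<le> 2 * m}" using pos by (auto simp: Suc_le_eq intro: gr0I)
    then show ?thesis using card[OF that] le that by simp
  qed
  ultimately show ?thesis unfolding inf_tableaux_def by blast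
qed

lemma inf_tableaux_unique: "t \<in> inf_tableaux k \<Longrightarrow> t \<in> inf_tableaux l \<Longrightarrow> k = l"
proof -
  assume "t \<in> inf_tableaux k" "t \<in> inf_tableaux l"
  then obtain a b where "\<forall>n\<ge>a. card (t \<inter> {1..2 * n}) + k = n" "\<forall>n\<ge>b. card (t \<inter> {1..2 * n}) + l = n"
    by (auto simp: inf_tableaux_def)
  then have "card (t \<inter> {1..2 * max a b}) + k = max a b" "card (t \<inter> {1..2 * max a b}) + l = max a b" by auto
  then show "k = l" by linarith
qed

lemma the_inf_tableaux: "S \<in> tableaux (2 * n) \<Longrightarrow> (THE k. extend (2 * n) S \<in> inf_tableaux k) = n - card S"
  using extend_in_inf_tableaux inf_tableaux_unique by (intro the_equality) blast+

lemma extend_inj: "inj_on (extend (2 * n)) (tableaux (2 * n))"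
proof (rule inj_on_inverseI)
  fix S assume "S \<in> tableaux (2 * n)"
  then show "extend (2 * n) S \<inter> {1..2 * n} = S" by (auto simp: extend_def tableaux_def)
qed

text \<open>The smallest entry \<open>b\<close> of the second row satisfies \<open>b > 1\<close> and contributes \<open>b - 1\<close>.\<close>

lemma maj_zero:
  assumes S: "S \<in> tableaux N" and "maj N S = 0"
  shows "S = {}"
proof (rule ccontr)
  assume ne: "S \<noteq> {}"
  have sub: "S \<subseteq> {1..N}" and st: "standard S" using S by (auto simp: tableaux_def)
  have fin: "finite S" using sub by (rule finite_subset) simp
  let ?b = "Min S"
  have b: "?b \<in> S" using fin ne by simp
  have "{x \<in> S. x \<le> ?b} = {?b}" using fin b by (auto intro: antisym)
  moreover have "card {x \<in> S. x \<le> ?b} \<le> card {x. 1 \<le> x \<and> x < ?b \<and> x \<notin> S}" using st b by (simp add: standard_def)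
  ultimately have "0 < card {x. 1 \<le> x \<and> x < ?b \<and> x \<notin> S}" by simp
  then have "{x. 1 \<le> x \<and> x < ?b \<and> x \<notin> S} \<noteq> {}" by (metis card.empty less_numeral_extra(3))
  then have "?b > 1" by auto
  have "?b - 1 \<notin> S"
  proof
    assume "?b - 1 \<in> S"
    then have "?b \<le> ?b - 1" by (rule Min_le[OF fin])
    then show False using \<open>?b > 1\<close> by simp
  qed
  then have "?b - 1 \<in> {i. 1 \<le> i \<and> i + 1 \<le> N \<and> i \<notin> S \<and> i + 1 \<in> S}"
    using b sub \<open>?b > 1\<close> by auto
  moreover have "finite {i. 1 \<le> i \<and> i + 1 \<le> N \<and> i \<notin> S \<and> i + 1 \<in> S}" by (rule finite_subset[of _ "{..N}"]) auto
  ultimately have "?b - 1 \<le> maj N S" unfolding maj_def by (intro member_le_sum) auto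
  then show False using assms(2) \<open>?b > 1\<close> by simp
qed

lemma empty_tableaux [simp]: "{} \<in> tableaux N"
  by (simp add: tableaux_def standard_def)

lemma principal_tableau_extend: "principal_tableau k = extend (2 * k) {}"
  by (simp add: principal_tableau_def extend_def)

section \<open>Compatibility of the limit maps\<close>

text \<open>The common form of \<^const>\<open>tstep\<close> and \<^const>\<open>tlimit\<close>.\<close>

definition relabel :: "('a \<Rightarrow> 'b) \<Rightarrow> ('a \<Rightarrow>\<^sub>0 'c::comm_monoid_add) \<Rightarrow> ('b \<Rightarrow>\<^sub>0 'c)" where
  "relabel f x = (\<Sum>S\<in>keys x. single (f S) (lookup x S))"

lemma lookup_relabel:
  assumes "inj_on f A" "keys x \<subseteq> A" "S \<in> A"
  shows "lookup (relabel f x) (f S) = lookup x S"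
proof -
  have "lookup (relabel f x) (f S) = (\<Sum>S'\<in>keys x. if S' = S then lookup x S' else 0)"
    unfolding relabel_def lookup_sum lookup_single when_def using assms
    by (intro sum.cong refl) (auto dest: inj_onD)
  then show ?thesis by (simp add: in_keys_iff)
qed

lemma lookup_relabel_outside: "T \<notin> f ` keys x \<Longrightarrow> lookup (relabel f x) T = 0"
  unfolding relabel_def lookup_sum lookup_single when_def by (intro sum.neutral) auto

lemma keys_relabel:
  assumes "inj_on f (keys x)"
  shows "keys (relabel f x) = f ` keys x"
  using lookup_relabel[OF assms order_refl] lookup_relabel_outside[of _ f x]
  by (auto simp: in_keys_iff)

lemma relabel_relabel:
  assumes "inj_on f (keys x)"
  shows "relabel g (relabel f x) = relabel (g \<circ> f) x"
  unfolding relabel_def[of g] keys_relabel[OF assms] sum.reindex[OF assms]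
  by (simp add: relabel_def[of "g \<circ> f"] lookup_relabel[OF assms order_refl])

lemma relabel_single: "relabel f (single a x) = single (f a) x"
  by (cases "x = 0") (simp_all add: relabel_def)

lemma relabel_eqD:
  assumes "inj_on f A" "keys x \<subseteq> A" "keys y \<subseteq> A" "relabel f x = relabel f y"
  shows "x = y"
proof (rule poly_mapping_eqI)
  fix S
  show "lookup x S = lookup y S"
    using lookup_relabel[OF assms(1,2), of S] lookup_relabel[OF assms(1,3), of S] assms
  proof (cases "S \<in> A")
    case False
    then have "S \<notin> keys x" "S \<notin> keys y" using assms(2,3) by auto
    then show ?thesis by (simp add: in_keys_iff)
  qed simp
qed

lemma tstep_relabel: "tstep n = relabel (insert (2 * n + 2))"
  by (simp add: fun_eq_iff tstep_def relabel_def)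

lemma tlimit_relabel: "tlimit n = relabel (extend (2 * n))"
  by (simp add: fun_eq_iff tlimit_def relabel_def)

lemma tspace_keys: "x \<in> tspace n \<Longrightarrow> keys x \<subseteq> tableaux (2 * n)"
  by (auto simp: tspace_def)

lemma tlimit_tstep:
  assumes "x \<in> tspace n"
  shows "tlimit (Suc n) (tstep n x) = tlimit n x"
proof -
  have "inj_on (insert (2 * n + 2)) (tableaux (2 * n))"
  proof (rule inj_on_inverseI)
    fix S assume "S \<in> tableaux (2 * n)"
    then show "insert (2 * n + 2) S - {2 * n + 2} = S" by (auto simp: tableaux_def)
  qed
  then have inj: "inj_on (insert (2 * n + 2)) (keys x)"
    using tspace_keys[OF assms] by (rule inj_on_subset)
  have "extend (2 * Suc n) (insert (2 * n + 2) S) = extend (2 * n) S" for S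
  proof -
    have "(\<exists>i. x = 2 * n + 2 + 2 * i) \<longleftrightarrow> x = 2 * n + 2 \<or> (\<exists>i. x = 2 * Suc n + 2 + 2 * i)" for x by presburger
    then show ?thesis unfolding extend_def by blast
  qed
  then have "extend (2 * Suc n) \<circ> insert (2 * n + 2) = extend (2 * n)" by (intro ext) simp
  then show ?thesis unfolding tstep_relabel tlimit_relabel relabel_relabel[OF inj] by simp
qed

section \<open>Zero weight and zero charge\<close>

text \<open>The monomial \<open>x\<^sup>i\<close> has weight \<open>2 i - 2 m\<close>.\<close>

lemma irr_h_zero:
  assumes "irr_h (2 * m + 1) p = 0"
  shows "p = monom (coeff p m) m"
proof (rule poly_eqI)
  fix i
  have "coeff (irr_h (2 * m + 1) p) i = (2 * of_nat i - of_nat (2 * m)) * coeff p i"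
    unfolding irr_h_def by (cases i) (simp_all add: coeff_pderiv algebra_simps)
  then have "(2 * of_nat i - 2 * of_nat m) * coeff p i = 0" using assms by simp
  then have "i = m \<or> coeff p i = 0" by auto
  then show "coeff p i = coeff (monom (coeff p m) m) i" by auto
qed

lemma irr_h_monom: "irr_h (2 * m + 1) (monom c m) = 0"
  unfolding irr_h_def by (rule poly_eqI) (auto simp: coeff_pderiv coeff_pCons split: nat.splits)

lemma irr_e_monom: "irr_e d (monom c j) = monom ((of_nat (d - 1) - of_nat j) * c) (Suc j)"
  unfolding irr_e_def
  by (rule poly_eqI) (auto simp: coeff_pCons coeff_pderiv algebra_simps split: nat.splits)

lemma tact_lookup: "lookup (tact X n x) S =
    (if S \<in> keys x then X (irr_dim n S) (lookup x S) else 0)"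
  by (simp add: tact_def lookup_sum lookup_single when_def)

lemma tmul_lookup: "lookup (tmul c x) S = smult c (lookup x S)"
  by (simp add: tmul_def Poly_Mapping.map.rep_eq when_def)

lemma lookup_h0_op: "lookup (h0_op v) a = cmul (2 * of_int a) (lookup v a)"
  by (simp add: h0_op_def lookup_sum lookup_single when_def in_keys_iff)

lemma h0_op_fusion:
  assumes "v \<in> fusion n"
  shows "h0_op v \<in> fusion n"
  using assms unfolding fusion_def
proof (induction rule: FV.span_induct_alt)
  case base
  then show ?case by (simp add: h0_op_def FV.span_zero)
next
  case (step b x y)
  then obtain js where x: "x = foldr (\<lambda>j. e_op (- int j)) js (vac (- int n))" by auto
  then obtain a g where ag: "x = single a g" unfolding foldr_e_op e_word by blast
  have "h0_op (fmul b x + y) = fmul (b * (2 * of_int a)) x + h0_op y"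
    by (rule poly_mapping_eqI)
       (auto simp: lookup_h0_op lookup_add lookup_fmul ag lookup_single when_def CV.scale_right_distrib CV.scale_left_commute mult.commute)
  then show ?case using step by (simp add: FV.span_add FV.span_scale FV.span_base)
qed

lemma h0_op_charge0: "h0_op (charge0 g) = 0"
  by (rule poly_mapping_eqI) (simp add: lookup_h0_op charge0_def lookup_single when_def)

lemma h0_op_zeroD:
  assumes "h0_op v = 0"
  shows "v = charge0 (lookup v 0)"
proof (rule poly_mapping_eqI)
  fix a
  have "cmul (2 * of_int a) (lookup v a) = 0" using assms by (simp add: lookup_h0_op[symmetric])
  then have "a = 0 \<or> lookup v a = 0" by simp
  then show "lookup v a = lookup (charge0 (lookup v 0)) a"
    by (auto simp: charge0_def lookup_single when_def)
qed

text \<open>The lowest weight vector is a constant, and \<open>e\<close> multiplies \<open>x\<^sup>j\<close> by \<open>(2 m - j) x\<close>, which does not vanish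
for \<open>j < m\<close>.  Positivity of the inner product makes the normalization finite and nonzero.\<close>

lemma zero_weight_monom:
  assumes "unitary_inner (2 * m + 1) (ip (2 * m + 1))" and "lowest_weight_vector (2 * m + 1) (omega m)"
  shows "\<exists>b. b \<noteq> 0 \<and> zero_weight ip omega m = monom b m"
proof -
  let ?d = "2 * m + 1"
  have w: "omega m \<noteq> 0" "pderiv (omega m) = 0"
    using assms(2) by (auto simp: lowest_weight_vector_def irr_f_def)
  then obtain a where a: "omega m = monom a 0" "a \<noteq> 0"
    by (metis degree_0_id monom_0 pderiv_eq_0_iff pCons_eq_0_iff)
  have "\<exists>b. b \<noteq> 0 \<and> (irr_e ?d ^^ i) (omega m) = monom b i" if "i \<le> m" for i
    using that
  proof (induction i)
    case 0 then show ?case using a by auto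
  next
    case (Suc i)
    then obtain b where b: "b \<noteq> 0" "(irr_e ?d ^^ i) (omega m) = monom b i" by auto
    have "?d - 1 \<noteq> i" using Suc.prems by simp
    then have "of_nat (?d - 1) - of_nat i \<noteq> (0 :: complex)" by (simp only: right_minus_eq of_nat_eq_iff not_False_eq_True)
    then have "(of_nat (?d - 1) - of_nat i) * b \<noteq> 0" using b(1) by simp
    moreover have "(irr_e ?d ^^ Suc i) (omega m) = monom ((of_nat (?d - 1) - of_nat i) * b) (Suc i)"
      unfolding funpow.simps comp_apply b(2) by (rule irr_e_monom)
    ultimately show ?case by blast
  qed
  then obtain b where b: "b \<noteq> 0" "(irr_e ?d ^^ m) (omega m) = monom b m" by blast
  have "monom b m \<in> irr ?d" using degree_monom_le[of b m] by (simp add: irr_def)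
  then have "0 < Re (ip ?d (monom b m) (monom b m))"
  proof -
    have "\<forall>x\<in>irr ?d. x \<noteq> 0 \<longrightarrow> 0 < Re (ip ?d x x)" using assms(1) unfolding unitary_inner_def by blast
    then show ?thesis using \<open>monom b m \<in> irr ?d\<close> b(1) by (simp only: monom_eq_0_iff not_False_eq_True)
  qed
  then have "complex_of_real (1 / sqrt (Re (ip ?d (monom b m) (monom b m)))) * b \<noteq> 0" using b(1) by simp
  moreover have "zero_weight ip omega m = monom (complex_of_real (1 / sqrt (Re (ip ?d (monom b m) (monom b m)))) * b) m"
    unfolding zero_weight_def Let_def b(2) by (rule smult_monom)
  ultimately show ?thesis by blast
qed

lemma schur_e_words:
  assumes \<nu>: "\<nu> \<in> in_square k"
  shows "charge0 (schur \<nu>) = fmul ((- 1) ^ (k * (k - 1) div 2))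
     (\<Sum>\<mu>\<in>in_square k. fmul (of_nat (kostka \<nu> \<mu>) / (\<Prod>j\<le>k. fact (count_list \<mu> j)))
        (foldr (\<lambda>m. e_op (- (int k - int m))) \<mu> (vac (- int k))))"
proof -
  have E: "foldr (\<lambda>m. e_op (- (int k - int m))) \<mu> (vac (- int k)) = charge0 (word_symf k (\<lambda>i. int (\<mu> ! i) - int (k - 1)))"
    if "\<mu> \<in> in_square k" for \<mu>
    using rect_e_word[of \<mu> k k k] that by (simp add: in_square_rect charge0_def)
  have S: "(\<Sum>\<mu>\<in>in_square k. fmul (w \<mu>) (foldr (\<lambda>m. e_op (- (int k - int m))) \<mu> (vac (- int k))))
    = charge0 (\<Sum>\<mu>\<in>in_square k. cmul (w \<mu>) (word_symf k (\<lambda>i. int (\<mu> ! i) - int (k - 1))))" for w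
    unfolding charge0_def single_sum fmul_single[symmetric]
    by (rule sum.cong[OF refl]) (simp only: E charge0_def)
  show ?thesis
    unfolding S charge0_cmul[symmetric] unfolding in_square_rect
    by (subst schur_word_symf[OF \<nu>[unfolded in_square_rect]]) (rule refl)
qed

section \<open>The isomorphism \<open>\<Phi>\<close>\<close>

locale rho_setting =
  fixes ip :: "nat \<Rightarrow> complex poly \<Rightarrow> complex poly \<Rightarrow> complex"
    and omega :: "nat \<Rightarrow> complex poly"
    and rho :: "nat \<Rightarrow> fock \<Rightarrow> tabvec"
  assumes unitary: "\<And>d. d \<ge> 1 \<Longrightarrow> unitary_inner d (ip d)"
    and lowest: "\<And>k. lowest_weight_vector (2 * k + 1) (omega k)"
    and family: "rho_family ip rho"
begin

abbreviation (input) "\<Phi> \<equiv> Phi ip omega rho"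
abbreviation (input) "zw \<equiv> zero_weight ip omega"

lemma rho_bij: "bij_betw (rho n) (fusion n) (tspace n)"
  using family unfolding rho_family_def by (elim conjE) simp

lemma rho_add: "v \<in> fusion n \<Longrightarrow> w \<in> fusion n \<Longrightarrow> rho n (v + w) = rho n v + rho n w"
  using family unfolding rho_family_def by (elim conjE) simp

lemma rho_fmul: "v \<in> fusion n \<Longrightarrow> rho n (fmul c v) = tmul c (rho n v)"
  using family unfolding rho_family_def by blast

lemma rho_h0: "v \<in> fusion n \<Longrightarrow> rho n (h0_op v) = tact irr_h n (rho n v)"
  using family unfolding rho_family_def by blast

lemma rho_maj: "v \<in> fusion n \<Longrightarrow> homogeneous (int n ^ 2 - int i) v \<Longrightarrow>
    S \<in> keys (rho n v) \<Longrightarrow> maj (2 * n) S = i"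
  using family unfolding rho_family_def by blast

lemma rho_Suc: "v \<in> fusion n \<Longrightarrow> rho (Suc n) v = tstep n (rho n v)"
  using family unfolding rho_family_def by blast

lemma rho_inj: "v \<in> fusion n \<Longrightarrow> w \<in> fusion n \<Longrightarrow> rho n v = rho n w \<Longrightarrow> v = w"
  using rho_bij[of n] by (auto simp: bij_betw_def dest: inj_onD)

lemma rho_tspace: "v \<in> fusion n \<Longrightarrow> rho n v \<in> tspace n"
  using rho_bij[of n] by (auto simp: bij_betw_def)

lemma fusion_zero: "0 \<in> fusion n" unfolding fusion_def by (rule FV.span_zero)

lemma rho_zero: "rho n 0 = 0"
  using rho_add[OF fusion_zero fusion_zero, of n] by simp

lemma zero_weight: "\<exists>b. b \<noteq> 0 \<and> zw m = monom b m"
  by (rule zero_weight_monom, rule unitary, simp, rule lowest)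

lemma rho_limit_eq:
  assumes "v \<in> fusion n"
  shows "rho_limit rho v = tlimit n (rho n v)"
proof -
  define m where "m = (LEAST n. v \<in> fusion n)"
  have m: "v \<in> fusion m" unfolding m_def by (rule LeastI[of "\<lambda>n. v \<in> fusion n", OF assms])
  have "m \<le> n" unfolding m_def by (rule Least_le[of "\<lambda>n. v \<in> fusion n", OF assms])
  then have "tlimit n (rho n v) = tlimit m (rho m v)"
  proof (induction n rule: dec_induct)
    case (step l)
    have "v \<in> fusion l" using m fusion_mono[OF step(1)] by auto
    then show ?case using step tlimit_tstep[OF rho_tspace, of v l] by (simp add: rho_Suc)
  qed simp
  then show ?thesis by (simp add: rho_limit_def Let_def m_def)
qed

text \<open>Injectivity on the whole Fock space makes the inverse image in the definition of \<^const>\<open>Phi_tableau\<close> unique; it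
needs \<open>fusion_exhausts\<close>, since \<^const>\<open>rho_limit\<close> is arbitrary outside the union of the \<open>F\<^bsub>2n\<^esub>\<close>.\<close>

lemma rho_limit_inj: "inj (rho_limit rho)"
proof (rule injI)
  fix v w assume eq: "rho_limit rho v = rho_limit rho w"
  obtain a b where "v \<in> fusion a" "w \<in> fusion b" using fusion_exhausts by blast
  then have vw: "v \<in> fusion (max a b)" "w \<in> fusion (max a b)"
    using fusion_mono[of a "max a b"] fusion_mono[of b "max a b"] by auto
  have "relabel (extend (2 * max a b)) (rho (max a b) v) = relabel (extend (2 * max a b)) (rho (max a b) w)"
    using eq by (simp add: rho_limit_eq[OF vw(1)] rho_limit_eq[OF vw(2)] tlimit_relabel)
  then have "rho (max a b) v = rho (max a b) w"
    by (rule relabel_eqD[OF extend_inj tspace_keys tspace_keys, OF rho_tspace rho_tspace, OF vw])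
  then show "v = w" by (rule rho_inj[OF vw])
qed

definition zero_weight_at :: "nat \<Rightarrow> nat set \<Rightarrow> tabvec" where
  "zero_weight_at n S = single S (zw (n - card S))"

lemma Phi_tableau_fusion:
  assumes S: "S \<in> tableaux (2 * n)"
  defines "v \<equiv> Phi_tableau ip omega rho (extend (2 * n) S)"
  shows "v \<in> fusion n" "rho n v = zero_weight_at n S" "h0_op v = 0"
proof -
  obtain b where b: "b \<noteq> 0" "zw (n - card S) = monom b (n - card S)"
    using zero_weight by blast
  have "zero_weight_at n S \<in> tspace n"
    using S degree_monom_le[of b "n - card S"] by (auto simp: zero_weight_at_def tspace_def b irr_def irr_dim_def lookup_single split: if_splits)
  then obtain w where w: "w \<in> fusion n" "rho n w = zero_weight_at n S"
    using rho_bij[of n] unfolding bij_betw_def by (metis imageE)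
  have "rho_limit rho w = single (extend (2 * n) S) (zw (n - card S))"
    by (simp add: rho_limit_eq[OF w(1)] w(2) tlimit_relabel zero_weight_at_def relabel_single)
  then have "v = w"
    unfolding v_def Phi_tableau_def Let_def the_inf_tableaux[OF S] using rho_limit_inj by (metis inv_f_f)
  then show 1: "v \<in> fusion n" and 2: "rho n v = zero_weight_at n S" using w by auto
  have "rho n (h0_op v) = rho n 0"
    unfolding rho_h0[OF 1] rho_zero 2
  proof (rule poly_mapping_eqI)
    fix T
    have "irr_h (irr_dim n S) (monom b (n - card S)) = 0" unfolding irr_dim_def by (rule irr_h_monom)
    then show "lookup (tact irr_h n (zero_weight_at n S)) T = lookup 0 T"
      using b(1) by (auto simp: tact_lookup zero_weight_at_def b(2) lookup_single)
  qed
  then show "h0_op v = 0" by (rule rho_inj[OF h0_op_fusion[OF 1] fusion_zero])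
qed

lemma Phi_tableau_square:
  assumes "S \<in> tableaux (2 * n)"
  shows "\<exists>g\<in>square_span n. Phi_tableau ip omega rho (extend (2 * n) S) = charge0 g"
proof -
  note P = Phi_tableau_fusion[OF assms]
  show ?thesis
    using h0_op_zeroD[OF P(3)] charge0_fusion[OF P(1)] unfolding square_span_def in_square_rect by blast
qed

lemma charge0_square_fusion: "g \<in> square_span n \<Longrightarrow> charge0 g \<in> fusion n"
  using schur_span_in_fusion[of g n n n] by (simp add: square_span_def in_square_rect charge0_def)

text \<open>\<open>\<rho>\<close> commutes with \<open>h\<^sub>0\<close>, and the zero weight space of each \<open>M\<^sub>d\<close> is spanned by \<^const>\<open>zero_weight\<close>.\<close>

lemma rho_charge0:
  assumes "charge0 g \<in> fusion n"
  shows "\<exists>c. lookup (rho n (charge0 g)) S = smult c (zw (n - card S))"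
proof -
  let ?p = "lookup (rho n (charge0 g)) S"
  have "tact irr_h n (rho n (charge0 g)) = 0"
    using rho_h0[OF assms] by (simp add: h0_op_charge0 rho_zero)
  then have "lookup (tact irr_h n (rho n (charge0 g))) S = 0" by simp
  then have "irr_h (2 * (n - card S) + 1) ?p = 0"
    by (auto simp: tact_lookup irr_dim_def irr_h_def in_keys_iff split: if_splits)
  then have p: "?p = monom (coeff ?p (n - card S)) (n - card S)" by (rule irr_h_zero)
  obtain b where b: "b \<noteq> 0" "zw (n - card S) = monom b (n - card S)"
    using zero_weight by blast
  have "?p = smult (coeff ?p (n - card S) / b) (zw (n - card S))"
    using p b by (simp add: smult_monom)
  then show ?thesis by blast
qed

lemma Phi_superset:
  "finite A \<Longrightarrow> keys u \<subseteq> A \<Longrightarrow>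
    \<Phi> u = (\<Sum>\<tau>\<in>A. fmul (lookup u \<tau>) (Phi_tableau ip omega rho \<tau>))"
  unfolding Phi_def by (rule sum.mono_neutral_left) (auto simp: in_keys_iff)

lemma Phi_add: "\<Phi> (u + v) = \<Phi> u + \<Phi> v"
proof -
  let ?A = "keys u \<union> keys v"
  show ?thesis
    using Phi_superset[of ?A u] Phi_superset[of ?A v] Phi_superset[of ?A "u + v"] Poly_Mapping.keys_add[of u v]
    by (simp add: lookup_add FV.scale_left_distrib sum.distrib)
qed

lemma Phi_single: "\<Phi> (single \<tau> c) = fmul c (Phi_tableau ip omega rho \<tau>)"
  by (simp add: Phi_def)

lemma Phi_zero [simp]: "\<Phi> 0 = 0"
  by (simp add: Phi_def)

lemma Phi_sum: "\<Phi> (\<Sum>i\<in>I. u i) = (\<Sum>i\<in>I. \<Phi> (u i))"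
  by (induction I rule: infinite_finite_induct) (simp_all add: Phi_add)

lemma Phi_cmul: "\<Phi> (cmul c u) = fmul c (\<Phi> u)"
proof -
  have "keys (cmul c u) \<subseteq> keys u" by (auto simp: in_keys_iff lookup_cmul)
  then show ?thesis
    using Phi_superset[of "keys u" "cmul c u"]
    by (simp add: Phi_def lookup_cmul FV.scale_sum_right)
qed

lemma rho_sum:
  assumes "\<And>i. i \<in> I \<Longrightarrow> v i \<in> fusion n"
  shows "(\<Sum>i\<in>I. v i) \<in> fusion n \<and> rho n (\<Sum>i\<in>I. v i) = (\<Sum>i\<in>I. rho n (v i))"
  using assms
proof (induction I rule: infinite_finite_induct)
  case (insert i I)
  then show ?case by (auto simp: rho_add fusion_def intro: FV.span_add)
qed (simp_all add: fusion_zero rho_zero)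

lemma fusion_scale: "v \<in> fusion n \<Longrightarrow> fmul c v \<in> fusion n"
  unfolding fusion_def by (rule FV.span_scale)

text \<open>One inclusion is \<open>charge0_fusion\<close>.  For the other, the coordinates of \<open>\<rho>(w)\<close> with respect to the zero weight vectors
are the coefficients of a preimage of \<open>w\<close>.\<close>

lemma Phi_stable_span: "\<Phi> ` stable_span (2 * n) = charge0 ` square_span n"
proof (rule subset_antisym; rule subsetI)
  fix w assume "w \<in> \<Phi> ` stable_span (2 * n)"
  then obtain u where u: "u \<in> stable_span (2 * n)" "w = \<Phi> u" by auto
  have "\<exists>g\<in>square_span n. \<Phi> u = charge0 g"
    using u(1) unfolding stable_span_def
  proof (induction rule: CV.span_induct_alt)
    case base
    have "0 \<in> square_span n" unfolding square_span_def by (rule CV.span_zero)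
    then show ?case by (intro bexI[of _ 0]) (simp_all add: charge0_def)
  next
    case (step c x y)
    then obtain S where S: "S \<in> tableaux (2 * n)" "x = single (extend (2 * n) S) 1"
      by (auto simp: stable_tableaux_def)
    obtain g where g: "g \<in> square_span n" "Phi_tableau ip omega rho (extend (2 * n) S) = charge0 g"
      using Phi_tableau_square[OF S(1)] by blast
    obtain g' where g': "g' \<in> square_span n" "\<Phi> y = charge0 g'" using step by blast
    have "\<Phi> (cmul c x + y) = charge0 (cmul c g + g')"
      by (simp add: Phi_add Phi_cmul S(2) Phi_single g(2) g'(2) charge0_add charge0_cmul)
    moreover have "cmul c g + g' \<in> square_span n"
      using g(1) g'(1) unfolding square_span_def by (intro CV.span_add CV.span_scale)
    ultimately show ?case by blast
  qed
  then show "w \<in> charge0 ` square_span n" using u(2) by auto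
next
  fix w assume "w \<in> charge0 ` square_span n"
  then obtain g where g: "g \<in> square_span n" "w = charge0 g" by auto
  have w: "w \<in> fusion n" using charge0_square_fusion g by simp
  obtain c where c: "\<And>S. lookup (rho n w) S = smult (c S) (zw (n - card S))"
    using rho_charge0 w unfolding g(2) by metis
  let ?K = "keys (rho n w)"
  have K: "?K \<subseteq> tableaux (2 * n)" by (rule tspace_keys[OF rho_tspace[OF w]])
  define u where "u = (\<Sum>S\<in>?K. cmul (c S) (single (extend (2 * n) S) 1))"
  have "u \<in> stable_span (2 * n)"
    unfolding u_def stable_span_def stable_tableaux_def using K
    by (intro CV.span_sum CV.span_scale CV.span_base) auto
  moreover have "\<Phi> u = w"
  proof (rule rho_inj[OF _ w])
    let ?v = "\<lambda>S. fmul (c S) (Phi_tableau ip omega rho (extend (2 * n) S))"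
    have Phi_u: "\<Phi> u = (\<Sum>S\<in>?K. ?v S)"
      unfolding u_def by (simp add: Phi_sum Phi_cmul Phi_single)
    have v: "?v S \<in> fusion n" "rho n (?v S) = tmul (c S) (zero_weight_at n S)" if "S \<in> ?K" for S
      using Phi_tableau_fusion[of S n] K that by (auto simp: rho_fmul fusion_scale)
    show "\<Phi> u \<in> fusion n" unfolding Phi_u using rho_sum[of ?K ?v n] v by blast
    have "rho n (\<Phi> u) = (\<Sum>S\<in>?K. tmul (c S) (zero_weight_at n S))"
      unfolding Phi_u using rho_sum[of ?K ?v n] v by simp
    also have "\<dots> = rho n w"
    proof (rule poly_mapping_eqI)
      fix S
      have "lookup (\<Sum>S\<in>?K. tmul (c S) (zero_weight_at n S)) S = (\<Sum>S'\<in>?K. if S' = S then lookup (rho n w) S' else 0)"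
        unfolding lookup_sum by (intro sum.cong refl) (simp add: tmul_lookup zero_weight_at_def lookup_single when_def c)
      then show "lookup (\<Sum>S\<in>?K. tmul (c S) (zero_weight_at n S)) S = lookup (rho n w) S"
        by (simp add: in_keys_iff)
    qed
    finally show "rho n (\<Phi> u) = rho n w" .
  qed
  ultimately show "w \<in> \<Phi> ` stable_span (2 * n)" by blast
qed

lemma square_size:
  assumes "\<nu> \<in> in_square k"
  shows "sum_list \<nu> \<le> k * k" and "sum_list \<nu> = k * k \<Longrightarrow> \<nu> = replicate k k"
proof -
  have len: "length \<nu> = k" and le: "\<And>x. x \<in> set \<nu> \<Longrightarrow> x \<le> k" using assms by (auto simp: in_square_def)
  have s: "sum_list \<nu> = (\<Sum>i<k. \<nu> ! i)" by (simp add: sum_list_sum_nth len atLeast0LessThan)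
  have kk: "k * k = (\<Sum>i<k. k)" by simp
  have le': "\<nu> ! i \<le> k" if "i \<in> {..<k}" for i using le that len by simp
  show "sum_list \<nu> \<le> k * k" unfolding s kk by (rule sum_mono[OF le'])
  assume "sum_list \<nu> = k * k"
  have "\<nu> ! i = k" if "i < k" for i
  proof (rule ccontr)
    assume "\<nu> ! i \<noteq> k"
    then have "(\<Sum>i<k. \<nu> ! i) < (\<Sum>i<k. k)" using that le' by (intro sum_strict_mono_ex1) (auto intro: le_neq_implies_less)
    then have "sum_list \<nu> < k * k" unfolding s kk .
    then show False using \<open>sum_list \<nu> = k * k\<close> by (simp only: less_irrefl)
  qed
  then show "\<nu> = replicate k k" by (intro nth_equalityI) (auto simp: len)
qed

lemma rho_schur_maj:
  assumes "\<nu> \<in> in_square k" and "S \<in> keys (rho k (charge0 (schur \<nu>)))"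
  shows "maj (2 * k) S = k * k - sum_list \<nu>"
proof (rule rho_maj)
  have "schur \<nu> \<in> square_span k" unfolding square_span_def by (rule CV.span_base) (use assms(1) in simp)
  then show "charge0 (schur \<nu>) \<in> fusion k" by (rule charge0_square_fusion)
  have "int k ^ 2 - int (k * k - sum_list \<nu>) = int (sum_list \<nu>)"
    using square_size(1)[OF assms(1)] by (simp add: of_nat_diff power2_eq_square)
  then show "homogeneous (int k ^ 2 - int (k * k - sum_list \<nu>)) (charge0 (schur \<nu>))"
    using homogeneous_charge0[OF hom_deg_schur[of \<nu>]] by simp
qed (rule assms(2))

text \<open>Write \<open>\<Phi>(\<tau>\<^sub>k) = c s + r\<close> with \<open>s\<close> the Schur function of the square and \<open>r\<close> a combination of smaller ones.  The grading
keeps \<open>\<rho>(r)\<close> away from the one-row tableau and puts \<open>\<rho>(s)\<close> there entirely, so \<open>\<rho>(c s) = \<rho>(\<Phi>(\<tau>\<^sub>k))\<close>.  This also shows that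
\<open>s\<close> does not vanish, without an independence theorem for Schur functions.\<close>

lemma Phi_principal:
  "\<exists>c. c \<noteq> 0 \<and> \<Phi> (single (principal_tableau k) 1) = charge0 (cmul c (schur (replicate k k)))"
proof -
  let ?s = "schur (replicate k k)" and ?R = "in_square k - {replicate k k}"
  let ?w = "Phi_tableau ip omega rho (extend (2 * k) {})"
  let ?\<phi> = "\<lambda>v. lookup (rho k v) {}"
  have sq: "replicate k k \<in> in_square k" by (simp add: in_square_def sorted_wrt_iff_nth_less)
  then have "schur ` in_square k = insert ?s (schur ` ?R)" by blast
  obtain g where g: "g \<in> square_span k" "?w = charge0 g" using Phi_tableau_square[of "{}" k] by auto
  obtain c where c: "g - cmul c ?s \<in> CV.span (schur ` ?R)"
    using g(1) unfolding square_span_def \<open>schur ` in_square k = _\<close> by (auto simp: CV.span_insert)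
  have sub: "CV.span (schur ` ?R) \<subseteq> square_span k" unfolding square_span_def by (rule CV.span_mono) auto
  \<comment> \<open>A proper subdiagram of the square has positive \<open>maj\<close>, but \<open>maj (2 * k) {} = 0\<close>.\<close>
  have vanish: "?\<phi> (charge0 f) = 0" if "f \<in> CV.span (schur ` ?R)" for f
  proof -
    have "?\<phi> (charge0 f) = 0 \<and> f \<in> CV.span (schur ` ?R)"
      using that
    proof (induction rule: CV.span_induct_alt)
      case base then show ?case by (simp add: charge0_def rho_zero CV.span_zero)
    next
      case (step b x y)
      then obtain \<nu> where \<nu>: "\<nu> \<in> in_square k" "\<nu> \<noteq> replicate k k" "x = schur \<nu>" by auto
      have "{} \<notin> keys (rho k (charge0 x))"
      proof
        assume "{} \<in> keys (rho k (charge0 x))"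
        then have "k * k - sum_list \<nu> = maj (2 * k) {}" unfolding \<nu>(3) using rho_schur_maj[OF \<nu>(1)] by metis
        also have "maj (2 * k) {} = 0" by (simp add: maj_def)
        finally show False using square_size[OF \<nu>(1)] \<nu>(2) by auto
      qed
      then have x0: "?\<phi> (charge0 x) = 0" by (simp add: in_keys_iff)
      have xs: "x \<in> CV.span (schur ` ?R)" using step(1) by (rule CV.span_base)
      have xf: "charge0 x \<in> fusion k" "charge0 y \<in> fusion k"
        using xs step(2) sub by (auto intro: charge0_square_fusion)
      have "rho k (charge0 (cmul b x + y)) = tmul b (rho k (charge0 x)) + rho k (charge0 y)"
        using xf by (simp add: charge0_add charge0_cmul rho_add rho_fmul fusion_scale)
      then show ?case using x0 step(2) xs by (simp add: lookup_add tmul_lookup CV.span_add CV.span_scale)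
    qed
    then show ?thesis ..
  qed
  have s_sq: "?s \<in> square_span k" unfolding square_span_def using sq by (intro CV.span_base) simp
  then have s_f: "charge0 ?s \<in> fusion k" and cs_f: "charge0 (cmul c ?s) \<in> fusion k"
    by (auto simp: charge0_cmul intro: charge0_square_fusion fusion_scale)
  have d_f: "charge0 (g - cmul c ?s) \<in> fusion k" using c sub by (auto intro: charge0_square_fusion)
  have w: "?w \<in> fusion k" "rho k ?w = zero_weight_at k {}" using Phi_tableau_fusion[of "{}" k] by simp_all
  have "?w = charge0 (g - cmul c ?s) + charge0 (cmul c ?s)" unfolding g(2) charge0_add[symmetric] by simp
  then have "?\<phi> ?w = ?\<phi> (charge0 (g - cmul c ?s)) + ?\<phi> (charge0 (cmul c ?s))"
    using rho_add[OF d_f cs_f] by (simp add: lookup_add)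
  then have phi: "?\<phi> (charge0 (cmul c ?s)) = zw k"
    unfolding vanish[OF c] w(2) by (simp add: zero_weight_at_def)
  have "rho k (charge0 (cmul c ?s)) = zero_weight_at k {}"
  proof (rule poly_mapping_eqI)
    fix S
    show "lookup (rho k (charge0 (cmul c ?s))) S = lookup (zero_weight_at k {}) S"
    proof (cases "S = {}")
      case True
      then show ?thesis using phi by (simp add: zero_weight_at_def)
    next
      case False
      have "S \<notin> keys (rho k (charge0 ?s))"
      proof
        assume S: "S \<in> keys (rho k (charge0 ?s))"
        then have "maj (2 * k) S = 0" using rho_schur_maj[OF sq S] by (simp add: sum_list_replicate)
        then show False using maj_zero[of S "2 * k"] tspace_keys[OF rho_tspace[OF s_f]] S False by auto
      qed
      then have "lookup (rho k (charge0 (cmul c ?s))) S = 0"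
        by (simp add: charge0_cmul rho_fmul[OF s_f] tmul_lookup in_keys_iff)
      then show ?thesis using False by (simp add: zero_weight_at_def lookup_single)
    qed
  qed
  then have "?w = charge0 (cmul c ?s)" using rho_inj[OF w(1) cs_f] w(2) by simp
  moreover have "c \<noteq> 0"
  proof
    assume "c = 0"
    then have "zw k = 0" using phi by (simp add: charge0_def rho_zero)
    then show False using zero_weight[of k] by auto
  qed
  ultimately show ?thesis unfolding principal_tableau_extend Phi_single by auto
qed

end

theorem theorem3:
  fixes ip :: "nat \<Rightarrow> complex poly \<Rightarrow> complex poly \<Rightarrow> complex"
    and omega :: "nat \<Rightarrow> complex poly"
    and rho :: "nat \<Rightarrow> fock \<Rightarrow> tabvec"
  assumes "\<And>d. d \<ge> 1 \<Longrightarrow> unitary_inner d (ip d)"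
    and "\<And>k. lowest_weight_vector (2 * k + 1) (omega k)"
    and "rho_family ip rho"
  shows "(\<forall>k. \<exists>c. c \<noteq> 0 \<and>
            Phi ip omega rho (Poly_Mapping.single (principal_tableau k) 1) =
              charge0 (cmul c (schur (replicate k k)))) \<and>
         (\<forall>k. Phi ip omega rho ` stable_span (2 * k) = charge0 ` square_span k) \<and>
         (\<forall>k. \<forall>\<nu>\<in>in_square k.
            charge0 (schur \<nu>) =
              fmul ((- 1) ^ (k * (k - 1) div 2))
                (\<Sum>\<mu>\<in>in_square k.
                   fmul (of_nat (kostka \<nu> \<mu>) / (\<Prod>j\<le>k. fact (count_list \<mu> j)))
                     (foldr (\<lambda>m. e_op (- (int k - int m))) \<mu> (vac (- int k)))))"
proof -
  interpret rho_setting ip omega rho by unfold_locales (fact assms)+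
  show ?thesis
    by (intro conjI allI ballI Phi_principal Phi_stable_span schur_e_words)
qed

end
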